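(* Let $w\in S_n$ and let $u\leq_w v$ in the poset $P_w$. Then the order complex $\Delta((u,v)_w)$ of the open interval $(u,v)_w=\{z\in P_w : u<_w z<_w v\}$ is homotopy equivalent to the sphere $\mathbb{S}^{|A_w(u,v)|-2}$ if the Bruhat interval polytope $Q_{u,v}$ is a face of $Q_w$, and is contractible otherwise. Consequently, the Möbius function of $P_w$ satisfies $\mu_{P_w}(u,v)=(-1)^{|A_w(u,v)|}$ if $Q_{u,v}$ is a face of $Q_w$, and $\mu_{P_w}(u,v)=0$ otherwise.
   Context: The symmetric group $S_n$ is viewed as a Coxeter group with the adjacent transpositions as simple reflections; $\ell$ denotes Coxeter length and $\preceq$ denotes (strong) Bruhat order. For $x\in S_n$ let $\mathbf{x}=(x^{-1}(1),\ldots,x^{-1}(n))\in\mathbb{R}^n$. For $y\preceq x$ the Bruhat interval polytope is $Q_{y,x}=\operatorname{conv}\{\mathbf{z} : y\preceq z\preceq x\}$, and $Q_x=Q_{e,x}$ where $e$ is the identity. The poset $P_w$ is the set $[e,w]=\{z: e\preceq z\preceq w\}$ with partial order $\leq_w$ generated by the cover relations $z\lessdot_w z'$ whenever $\ell(z')=\ell(z)+1$ and $\mathbf{z},\mathbf{z}'$ are joined by an edge of $Q_w$. (Every relation $u\le_w v$ implies $u\preceq v$, so $Q_{u,v}$ is defined.) $A_w(u,v)$ denotes the set of atoms of the closed interval $[u,v]_w$ of $P_w$, i.e. the elements $a$ with $u\lessdot_w a\leq_w v$. The order complex $\Delta(P)$ of a poset $P$ is the simplicial complex whose faces are the chains of $P$.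 The Möbius function is defined by $\mu(u,u)=1$ and $\mu(u,v)=-\sum_{u\le z<v}\mu(u,z)$ for $u<v$. *)

theory Defs
  imports "HOL-Analysis.Analysis" "HOL-Combinatorics.Combinatorics"
begin

text \<open>The symmetric group \<open>S_n\<close> is the set of \<open>x :: nat \<Rightarrow> nat\<close> with \<open>x permutes {1..n}\<close>, under
  composition of functions.\<close>

definition simple_reflections :: "nat \<Rightarrow> (nat \<Rightarrow> nat) set" where
  "simple_reflections n = {Transposition.transpose i (Suc i) | i. 1 \<le> i \<and> i < n}"

definition reflections :: "nat \<Rightarrow> (nat \<Rightarrow> nat) set" where
  "reflections n = {x \<circ> s \<circ> inv x | x s. x permutes {1..n} \<and> s \<in> simple_reflections n}"

definition coxeter_length :: "nat \<Rightarrow> (nat \<Rightarrow> nat) \<Rightarrow> nat" where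
  "coxeter_length n x =
     (LEAST k. \<exists>ss. length ss = k \<and> set ss \<subseteq> simple_reflections n \<and> foldr (\<circ>) ss id = x)"

definition bruhat_step :: "nat \<Rightarrow> (nat \<Rightarrow> nat) \<Rightarrow> (nat \<Rightarrow> nat) \<Rightarrow> bool" where
  "bruhat_step n x y \<longleftrightarrow>
     (\<exists>t\<in>reflections n. y = x \<circ> t \<and> coxeter_length n x < coxeter_length n y)"

definition bruhat_le :: "nat \<Rightarrow> (nat \<Rightarrow> nat) \<Rightarrow> (nat \<Rightarrow> nat) \<Rightarrow> bool" where
  "bruhat_le n x y \<longleftrightarrow> x permutes {1..n} \<and> y permutes {1..n} \<and> (bruhat_step n)\<^sup>*\<^sup>* x y"

definition bruhat_interval :: "nat \<Rightarrow> (nat \<Rightarrow> nat) \<Rightarrow> (nat \<Rightarrow> nat) \<Rightarrow> (nat \<Rightarrow> nat) set" where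
  "bruhat_interval n y x = {z. bruhat_le n y z \<and> bruhat_le n z x}"

text \<open>The space \<open>\<real>\<^sup>n\<close> is \<open>real ^ 'n\<close>. The parameter \<open>e\<close>, which is meant to be a bijection from \<open>'n\<close>
  onto \<open>{1..n}\<close>, says which coordinate is the first, the second, and so on, so that \<open>perm_vec e x\<close>
  is the vector \<open>(x\<inverse>(1), \<dots>, x\<inverse>(n))\<close>.\<close>

definition perm_vec :: "('n::finite \<Rightarrow> nat) \<Rightarrow> (nat \<Rightarrow> nat) \<Rightarrow> real ^ 'n" where
  "perm_vec e x = (\<chi> i. real (inv x (e i)))"

definition bruhat_polytope ::
    "nat \<Rightarrow> ('n::finite \<Rightarrow> nat) \<Rightarrow> (nat \<Rightarrow> nat) \<Rightarrow> (nat \<Rightarrow> nat) \<Rightarrow> (real ^ 'n) set" where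
  "bruhat_polytope n e y x = convex hull (perm_vec e ` bruhat_interval n y x)"

definition P_cover ::
    "nat \<Rightarrow> ('n::finite \<Rightarrow> nat) \<Rightarrow> (nat \<Rightarrow> nat) \<Rightarrow> (nat \<Rightarrow> nat) \<Rightarrow> (nat \<Rightarrow> nat) \<Rightarrow> bool" where
  "P_cover n e w z z' \<longleftrightarrow>
     z \<in> bruhat_interval n id w \<and> z' \<in> bruhat_interval n id w \<and>
     coxeter_length n z' = coxeter_length n z + 1 \<and>
     closed_segment (perm_vec e z) (perm_vec e z') edge_of bruhat_polytope n e id w"

text \<open>The poset \<open>P_w\<close> as a relation; its field is the carrier \<open>[id, w]\<close>.\<close>

definition P_rel ::
    "nat \<Rightarrow> ('n::finite \<Rightarrow> nat) \<Rightarrow> (nat \<Rightarrow> nat) \<Rightarrow> (nat \<Rightarrow> nat) rel" where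
  "P_rel n e w = {(u, v). u \<in> bruhat_interval n id w \<and> v \<in> bruhat_interval n id w \<and>
                          (P_cover n e w)\<^sup>*\<^sup>* u v}"

definition P_atoms ::
    "nat \<Rightarrow> ('n::finite \<Rightarrow> nat) \<Rightarrow> (nat \<Rightarrow> nat) \<Rightarrow> (nat \<Rightarrow> nat) \<Rightarrow> (nat \<Rightarrow> nat) \<Rightarrow> (nat \<Rightarrow> nat) set" where
  "P_atoms n e w u v = {a. P_cover n e w u a \<and> (a, v) \<in> P_rel n e w}"


text \<open>A poset is given by its reflexive order relation, with carrier the field of that relation.\<close>

definition open_interval :: "'a rel \<Rightarrow> 'a \<Rightarrow> 'a \<Rightarrow> 'a rel" where
  "open_interval r u v = Restr r {z. (u, z) \<in> r \<and> z \<noteq> u \<and> (z, v) \<in> r \<and> z \<noteq> v}"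

definition order_complex :: "'a rel \<Rightarrow> 'a set set" where
  "order_complex r = {\<sigma>. finite \<sigma> \<and> \<sigma> \<in> Chains r}"

text \<open>Geometric realization by barycentric coordinates. The subspace topology from the product is the
  right one for finite complexes, the only ones considered here.\<close>

definition geometric_realization :: "'a set set \<Rightarrow> ('a \<Rightarrow> real) topology" where
  "geometric_realization K = subtopology (powertop_real UNIV)
     {f. (\<forall>a. 0 \<le> f a) \<and> {a. f a \<noteq> 0} \<in> K \<and> (\<Sum>a | f a \<noteq> 0. f a) = 1}"

text \<open>Spheres of negative dimension are empty: this is the usual convention for \<open>d = -1\<close>, and
  \<open>d = -2\<close> occurs only for the (empty) open interval from \<open>u\<close> to \<open>u\<close>.\<close>

definition sphere_top :: "int \<Rightarrow> (nat \<Rightarrow> real) topology" where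
  "sphere_top d = (if d < 0 then trivial_topology else nsphere (nat d))"

text \<open>The conditions on \<open>r\<close> in the second branch only serve to make the recursion terminate; they
  hold for every locally finite poset.\<close>

function moebius :: "'a rel \<Rightarrow> 'a \<Rightarrow> 'a \<Rightarrow> int" where
  "moebius r u v =
     (if u = v then 1
      else if (u, v) \<in> r \<and> trans r \<and> antisym r \<and> refl_on (Field r) r \<and>
              finite {z. (u, z) \<in> r \<and> (z, v) \<in> r}
      then - (\<Sum>z | (u, z) \<in> r \<and> (z, v) \<in> r \<and> z \<noteq> v. moebius r u z)
      else 0)"
  by pat_completeness auto
termination
proof (relation "Wellfounded.measure (\<lambda>(r, u, v). card {z. (u, z) \<in> r \<and> (z, v) \<in> r})", goal_cases)
  case 1
  then show ?case by simp
next
  case (2 r u v z)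
  then have r: "(u, v) \<in> r" "trans r" "antisym r" "refl_on (Field r) r"
    and fin: "finite {z. (u, z) \<in> r \<and> (z, v) \<in> r}"
    and z: "(u, z) \<in> r" "(z, v) \<in> r" "z \<noteq> v"
    by auto
  have "(v, v) \<in> r"
    using r(1,4) by (auto simp: refl_on_def Field_def)
  moreover have "(v, z) \<notin> r"
    using r(3) z by (auto dest: antisymD)
  ultimately have "{y. (u, y) \<in> r \<and> (y, z) \<in> r} \<subset> {y. (u, y) \<in> r \<and> (y, v) \<in> r}"
    using r(1,2) z by (auto dest: transD)
  then show ?case
    using fin by (auto intro: psubset_card_mono)
qed

declare moebius.simps [simp del]

lemma moebius_refl: "moebius r u u = 1"
  by (simp add: moebius.simps)

lemma moebius_rec:
  assumes "partial_order_on (Field r) r" and "finite {z. (u, z) \<in> r \<and> (z, v) \<in> r}"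
    and "(u, v) \<in> r" and "u \<noteq> v"
  shows "moebius r u v = - (\<Sum>z | (u, z) \<in> r \<and> (z, v) \<in> r \<and> z \<noteq> v. moebius r u z)"
  using assms by (subst moebius.simps) (simp add: partial_order_on_def preorder_on_def)

lemma finite_bruhat_interval: "finite (bruhat_interval n y x)"
proof (rule finite_subset)
  show "bruhat_interval n y x \<subseteq> {z. z permutes {1..n}}"
    by (auto simp: bruhat_interval_def bruhat_le_def)
qed (simp add: finite_permutations)

lemma Field_P_rel: "Field (P_rel n e w) = bruhat_interval n id w"
  by (auto simp: P_rel_def Field_def)

lemma partial_order_P_rel: "partial_order_on (bruhat_interval n id w) (P_rel n e w)"
proof -
  have len: "coxeter_length n u < coxeter_length n v \<or> u = v" if "(P_cover n e w)\<^sup>*\<^sup>* u v" for u v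
    using that by induction (auto simp: P_cover_def)
  have "antisym (P_rel n e w)"
  proof (rule antisymI)
    fix x y assume "(x, y) \<in> P_rel n e w" "(y, x) \<in> P_rel n e w"
    then show "x = y"
      using len[of x y] len[of y x] by (auto simp: P_rel_def)
  qed
  moreover have "trans (P_rel n e w)"
    by (rule transI) (auto simp: P_rel_def)
  moreover have "refl_on (bruhat_interval n id w) (P_rel n e w)"
    by (auto simp: refl_on_def P_rel_def)
  moreover have "P_rel n e w \<subseteq> bruhat_interval n id w \<times> bruhat_interval n id w"
    by (auto simp: P_rel_def)
  ultimately show ?thesis
    by (simp add: partial_order_on_def preorder_on_def)
qed

end

theory Submission
  imports Defs
begin

text \<open>
  Put \<open>D = {z\<inverse> : z \<preceq> w}\<close>. Because \<open>[id, sw] = [id, w] \<union> s[id, w]\<close> for \<open>sw \<succ> w\<close>, induction on \<open>w\<close> shows that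
  on each chamber \<open>g\<close> of the braid fan all functionals are minimized over \<open>D\<close> by one and the same
  element \<open>opt g\<close>. Crossing a wall of the braid fan upwards in weak order either fixes \<open>opt\<close> or
  moves it along an edge of \<open>Q\<^sub>w\<close> that raises the length by one, and every cover of \<open>P\<^sub>w\<close> arises
  in this way. The fibres of \<open>opt\<close> have maxima \<open>M u\<close> in weak order, and \<open>u \<le>\<^sub>w v\<close> holds iff
  \<open>M u \<le> M v\<close> in weak order, so joins in \<open>P\<^sub>w\<close> come from joins in weak order. The atoms above \<open>u\<close>
  correspond to the ascents of \<open>M u\<close>; a set \<open>S\<close> of them defines a coset of a parabolic subgroup whose
  top chamber is mapped by \<open>opt\<close> to the join \<open>J u S\<close>. This join lies above no further atom, and the
  face of \<open>Q\<^sub>w\<close> belonging to the coset is \<open>Q\<^bsub>u, J u S\<^esub>\<close>. Hence \<open>Q\<^bsub>u,v\<^esub>\<close> is a face iff \<open>v\<close> is the join of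
  the atoms of \<open>[u, v]\<^sub>w\<close>. Finally, \<open>z \<mapsto> J u (atoms below z)\<close> retracts the open interval onto
  the joins of sets of atoms: these form the proper nonempty subsets of \<open>A\<^sub>w(u, v)\<close> if \<open>v\<close> is the join of
  all atoms, and a poset with a greatest element otherwise.
\<close>

section \<open>Homotopy type of order complexes\<close>

text \<open>Geometry is reduced to combinatorics by one fact: all points lie on a common sphere. So
  every point of \<open>D\<close> is a vertex, and a face is determined by the set
  \<open>Fmin c\<close> of points of \<open>D\<close> that it contains. Two steps carry the
  difficulty. A fibre of \<open>opt\<close> has a greatest element only because a wall that
  disappears at one chamber has also disappeared, up to a move inside the fibre, above every larger
  chamber; this is checked on the squares and hexagons of weak order, using that \<open>D\<close> is
  a Bruhat lower set. Secondly, the polytope of a pair \<open>u\<close>, \<open>v\<close> is spanned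
  by a Bruhat interval, whereas chambers only yield comparisons in the relation \<open>wle\<close>,
  which has fewer related pairs; that a face contains the whole Bruhat interval between any two of
  its points needs a rank argument. Only joins of atoms over one fixed \<open>u\<close> are
  constructed. They already control every interval that starts at \<open>u\<close>. The homotopy
  equivalences are explicit maps on barycentric coordinates.\<close>

definition simplicial_complex :: "'a set set \<Rightarrow> bool" where
  "simplicial_complex K \<longleftrightarrow> (\<forall>\<sigma>\<in>K. finite \<sigma> \<and> (\<forall>\<tau>. \<tau> \<subseteq> \<sigma> \<longrightarrow> \<tau> \<in> K))"

lemma simplicial_complex_order_complex: "simplicial_complex (order_complex r)"
  by (auto simp: simplicial_complex_def order_complex_def Chains_def intro: finite_subset)

lemma simplicial_complex_proper_subsets: "finite A \<Longrightarrow> simplicial_complex {S. S \<subset> A}"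
  by (auto simp: simplicial_complex_def intro: finite_subset)

lemma in_geometric_realization_iff:
  assumes "simplicial_complex K"
  shows "f \<in> topspace (geometric_realization K) \<longleftrightarrow>
    (\<forall>a. 0 \<le> f a) \<and> (\<exists>\<sigma>\<in>K. (\<forall>a. f a \<noteq> 0 \<longrightarrow> a \<in> \<sigma>) \<and> (\<Sum>a\<in>\<sigma>. f a) = 1)"
proof
  assume "f \<in> topspace (geometric_realization K)"
  then show "(\<forall>a. 0 \<le> f a) \<and> (\<exists>\<sigma>\<in>K. (\<forall>a. f a \<noteq> 0 \<longrightarrow> a \<in> \<sigma>) \<and> (\<Sum>a\<in>\<sigma>. f a) = 1)"
    by (auto simp: geometric_realization_def intro!: bexI[of _ "{a. f a \<noteq> 0}"])
next
  assume R: "(\<forall>a. 0 \<le> f a) \<and> (\<exists>\<sigma>\<in>K. (\<forall>a. f a \<noteq> 0 \<longrightarrow> a \<in> \<sigma>) \<and> (\<Sum>a\<in>\<sigma>. f a) = 1)"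
  then obtain \<sigma> where \<sigma>: "\<sigma> \<in> K" "{a. f a \<noteq> 0} \<subseteq> \<sigma>" "(\<Sum>a\<in>\<sigma>. f a) = 1" by auto
  have fin: "finite \<sigma>" and "{a. f a \<noteq> 0} \<in> K"
    using \<sigma> assms by (auto simp: simplicial_complex_def)
  moreover have "(\<Sum>a | f a \<noteq> 0. f a) = (\<Sum>a\<in>\<sigma>. f a)"
    by (rule sum.mono_neutral_left) (use \<sigma> fin in auto)
  ultimately show "f \<in> topspace (geometric_realization K)"
    using R \<sigma> by (simp add: geometric_realization_def)
qed

lemma continuous_map_into_geometric_realization:
  "continuous_map X (geometric_realization K) h \<longleftrightarrow>
    (\<forall>a. continuous_map X euclideanreal (\<lambda>x. h x a)) \<and>
    (\<forall>x\<in>topspace X. h x \<in> topspace (geometric_realization K))"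
  by (auto simp: geometric_realization_def continuous_map_in_subtopology
      continuous_map_componentwise_UNIV)

lemma continuous_map_barycentric_coordinate:
  "continuous_map (geometric_realization K) euclideanreal (\<lambda>x. x a)"
  using continuous_map_id[of "geometric_realization K"]
  by (simp add: continuous_map_into_geometric_realization del: continuous_map_id)

lemma continuous_map_prod_fst_real:
  "continuous_map (prod_topology (top_of_set S) X) euclideanreal fst"
  using continuous_map_fst[of "top_of_set S" X] by (simp add: continuous_map_in_subtopology)

lemma continuous_map_prod_snd:
  "continuous_map X Y f \<Longrightarrow> continuous_map (prod_topology Z X) Y (\<lambda>p. f (snd p))"
  using continuous_map_compose[OF continuous_map_snd, of X Y f Z] by (simp add: o_def)

text \<open>The segment from \<open>h x\<close> to \<open>k x\<close> stays inside one simplex, so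
  the straight-line homotopy never leaves the complex.\<close>

lemma homotopic_common_simplex:
  assumes K: "simplicial_complex K"
    and h: "continuous_map X (geometric_realization K) h"
    and k: "continuous_map X (geometric_realization K) k"
    and common: "\<And>x. x \<in> topspace X \<Longrightarrow> \<exists>\<sigma>\<in>K. \<forall>a. h x a \<noteq> 0 \<or> k x a \<noteq> 0 \<longrightarrow> a \<in> \<sigma>"
  shows "homotopic_with (\<lambda>_. True) X (geometric_realization K) h k"
proof -
  define H where "H = (\<lambda>(t::real, x) a. (1 - t) * h x a + t * k x a)"
  have cont: "continuous_map X euclideanreal (\<lambda>x. h x a)"
    "continuous_map X euclideanreal (\<lambda>x. k x a)" for a
    using h k by (simp_all add: continuous_map_into_geometric_realization)
  have "H (t, x) \<in> topspace (geometric_realization K)" if t: "0 \<le> t" "t \<le> 1" and x: "x \<in> topspace X" for t x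
  proof -
    obtain \<sigma> where \<sigma>: "\<sigma> \<in> K" "\<And>a. h x a \<noteq> 0 \<Longrightarrow> a \<in> \<sigma>" "\<And>a. k x a \<noteq> 0 \<Longrightarrow> a \<in> \<sigma>"
      using common[OF x] by auto
    have fin: "finite \<sigma>" using \<sigma> K by (auto simp: simplicial_complex_def)
    have hx: "h x \<in> topspace (geometric_realization K)" and kx: "k x \<in> topspace (geometric_realization K)"
      using h k x by (simp_all add: continuous_map_into_geometric_realization)
    have "(\<Sum>a\<in>\<sigma>. h x a) = (\<Sum>a | h x a \<noteq> 0. h x a)" "(\<Sum>a\<in>\<sigma>. k x a) = (\<Sum>a | k x a \<noteq> 0. k x a)"
      using \<sigma> fin by (auto intro!: sum.mono_neutral_right)
    then have "(\<Sum>a\<in>\<sigma>. h x a) = 1" "(\<Sum>a\<in>\<sigma>. k x a) = 1" "\<And>a. 0 \<le> h x a" "\<And>a. 0 \<le> k x a"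
      using hx kx by (auto simp: geometric_realization_def)
    moreover from this have "(\<Sum>a\<in>\<sigma>. H (t, x) a) = 1"
      by (simp add: H_def sum.distrib flip: sum_distrib_left)
    moreover have "H (t, x) a \<noteq> 0 \<Longrightarrow> a \<in> \<sigma>" for a using \<sigma>(2)[of a] \<sigma>(3)[of a] by (cases "h x a = 0") (auto simp: H_def)
    ultimately show ?thesis
      using t \<sigma>(1) unfolding in_geometric_realization_iff[OF K] by (auto simp: H_def)
  qed
  moreover have "continuous_map (prod_topology (top_of_set {0..1}) X) euclideanreal (\<lambda>p. H p a)" for a
    unfolding H_def split_beta
    by (intro continuous_intros continuous_map_prod_fst_real continuous_map_prod_snd cont) 
  ultimately have "continuous_map (prod_topology (top_of_set {0..1}) X) (geometric_realization K) H"
    by (auto simp: continuous_map_into_geometric_realization)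
  then show ?thesis
    unfolding homotopic_with_def by (intro exI[of _ H]) (auto simp: H_def)
qed

locale finite_poset =
  fixes I :: "'a set" and r :: "'a rel"
  assumes poset: "partial_order_on I r" and fin: "finite I"
begin

lemma in_field: "(x, y) \<in> r \<Longrightarrow> x \<in> I \<and> y \<in> I"
  using poset by (auto simp: partial_order_on_def preorder_on_def)

lemma refl: "x \<in> I \<Longrightarrow> (x, x) \<in> r"
  using poset by (auto simp: partial_order_on_def preorder_on_def refl_on_def)

lemma trans: "(x, y) \<in> r \<Longrightarrow> (y, z) \<in> r \<Longrightarrow> (x, z) \<in> r"
  using poset by (auto simp: partial_order_on_def preorder_on_def dest: transD)

lemma antisym: "(x, y) \<in> r \<Longrightarrow> (y, x) \<in> r \<Longrightarrow> x = y"
  using poset by (auto simp: partial_order_on_def dest: antisymD)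

abbreviation realization :: "('a \<Rightarrow> real) topology" where
  "realization \<equiv> geometric_realization (order_complex r)"

lemma in_realization_iff:
  "x \<in> topspace realization \<longleftrightarrow>
    (\<forall>a. 0 \<le> x a) \<and> (\<forall>a b. x a \<noteq> 0 \<longrightarrow> x b \<noteq> 0 \<longrightarrow> (a, b) \<in> r \<or> (b, a) \<in> r) \<and> (\<Sum>a\<in>I. x a) = 1"
    (is "?L \<longleftrightarrow> ?R")
proof
  assume ?L
  then obtain pos: "\<forall>a. 0 \<le> x a" and C: "{a. x a \<noteq> 0} \<in> Chains r" and 1: "(\<Sum>a | x a \<noteq> 0. x a) = 1"
    by (auto simp: geometric_realization_def order_complex_def)
  have "{a. x a \<noteq> 0} \<subseteq> I" using C by (auto simp: Chains_def dest: in_field)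
  then have "(\<Sum>a\<in>I. x a) = 1"
    using 1 fin by (subst sum.mono_neutral_right[of I "{a. x a \<noteq> 0}"]) auto
  then show ?R using pos C by (auto simp: Chains_def)
next
  assume R: ?R
  then have C: "{a. x a \<noteq> 0} \<in> Chains r" by (auto simp: Chains_def)
  then have sub: "{a. x a \<noteq> 0} \<subseteq> I" by (auto simp: Chains_def dest: in_field)
  then have "(\<Sum>a | x a \<noteq> 0. x a) = 1"
    using R fin by (subst sum.mono_neutral_left[of I "{a. x a \<noteq> 0}"]) auto
  then show ?L using R C sub fin
    by (auto simp: geometric_realization_def order_complex_def intro: finite_subset)
qed

text \<open>The simplicial map induced by \<open>f\<close>, written in barycentric
  coordinates.\<close>

definition pushforward :: "('a \<Rightarrow> 'a) \<Rightarrow> ('a \<Rightarrow> real) \<Rightarrow> 'a \<Rightarrow> real" where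
  "pushforward f x a = (\<Sum>z\<in>I. if f z = a then x z else 0)"

lemma pushforward_nonzeroD:
  assumes "pushforward f x a \<noteq> 0" obtains z where "z \<in> I" "f z = a" "x z \<noteq> 0"
proof -
  obtain z where "z \<in> I" "(if f z = a then x z else 0) \<noteq> 0"
    using assms unfolding pushforward_def by (rule sum.not_neutral_contains_not_neutral)
  then show ?thesis using that by (auto split: if_splits)
qed

lemma sum_if_image:
  assumes "f ` I \<subseteq> I" shows "(\<Sum>a\<in>I. \<Sum>z\<in>I. if f z = a then g z else (0::real)) = (\<Sum>z\<in>I. g z)"
proof -
  have "(\<Sum>a\<in>I. \<Sum>z\<in>I. if f z = a then g z else 0) = (\<Sum>z\<in>I. \<Sum>a\<in>I. if f z = a then g z else 0)"
    by (rule sum.swap)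
  also have "\<dots> = (\<Sum>z\<in>I. g z)"
    using assms fin by (intro sum.cong) auto
  finally show ?thesis .
qed

text \<open>The support of a point together with its image need not be a chain, so the straight line
  homotopy is not available. Instead the mass is moved from the bottom of the support upwards: at time
  \<open>t\<close> the lowest part of total mass \<open>t\<close> has been moved.\<close>

lemma pushforward_homotopic_id:
  assumes mono: "\<And>x y. (x, y) \<in> r \<Longrightarrow> (f x, f y) \<in> r" and le: "\<And>x. x \<in> I \<Longrightarrow> (f x, x) \<in> r"
  shows "homotopic_with (\<lambda>_. True) realization realization id (pushforward f)"
proof -
  \<comment> \<open>\<open>below x z\<close> is the mass of \<open>x\<close> strictly under
    \<open>z\<close>. The support is a chain, so stacking the masses from the bottom makes
    \<open>z\<close> occupy the stretch from \<open>below x z\<close> to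
    \<open>below x z + x z\<close>; \<open>low t x z\<close> is the part of it below height
    \<open>t\<close>.\<close>
  define below where "below x z = (\<Sum>y | (y, z) \<in> r \<and> y \<noteq> z. x y)" for x :: "'a \<Rightarrow> real" and z
  define low where "low t x z = min (x z) (max 0 (t - below x z))" for t x z
  define H where "H = (\<lambda>(t, x) a. (\<Sum>z\<in>I. if f z = a then low t x z else 0) + (if a \<in> I then x a - low t x a else 0))"
  have fI: "f ` I \<subseteq> I" using le in_field by blast
  have finbelow: "finite {y. (y, z) \<in> r \<and> y \<noteq> z}" for z
    by (rule finite_subset[OF _ fin]) (auto dest: in_field)
  have H_in: "H (t, x) \<in> topspace realization"
    if x: "x \<in> topspace realization" and t: "0 \<le> t" "t \<le> 1" for t x
  proof -
    have pos: "0 \<le> x a" for a using x by (auto simp: in_realization_iff)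
    have comp: "(a, b) \<in> r \<or> (b, a) \<in> r" if "x a \<noteq> 0" "x b \<noteq> 0" for a b
      using x that by (auto simp: in_realization_iff)
    have low: "0 \<le> low t x z" "low t x z \<le> x z" for z
      using pos[of z] by (auto simp: low_def)
    have nonneg: "0 \<le> H (t, x) a" for a
      by (auto simp: H_def low intro!: add_nonneg_nonneg sum_nonneg)
    have "(\<Sum>a\<in>I. H (t, x) a) = 1"
      using x by (simp add: H_def sum.distrib sum_if_image[OF fI] sum_subtractf in_realization_iff)
    moreover have "(a, b) \<in> r \<or> (b, a) \<in> r" if ab: "H (t, x) a \<noteq> 0" "H (t, x) b \<noteq> 0" for a b
    proof -
      have cases: "(\<exists>z. f z = a \<and> low t x z \<noteq> 0 \<and> z \<in> I) \<or> (low t x a < x a \<and> a \<in> I)" if "H (t, x) a \<noteq> 0" for a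
      proof (rule ccontr)
        assume neg: "\<not> ?thesis"
        then have "(\<Sum>z\<in>I. if f z = a then low t x z else 0) = 0"
          by (intro sum.neutral) auto
        then show False using that neg low(2)[of a] by (auto simp: H_def split: if_splits)
      qed
      have xz: "x z \<noteq> 0" if "low t x z \<noteq> 0" for z using that low[of z] by auto
      have xz': "x z \<noteq> 0" if "low t x z < x z" for z using that low[of z] by auto
      \<comment> \<open>Part of \<open>z\<close> has moved while part of \<open>b\<close> has not,
        so \<open>b\<close> cannot lie strictly below \<open>z\<close>: its whole mass would be
        counted in \<open>below x z\<close> and moved first. Hence \<open>f z\<close> is below
        \<open>z\<close>, which is below \<open>b\<close>, and the support stays a chain.\<close>
      have key: "(f z, b) \<in> r" if z: "low t x z \<noteq> 0" "z \<in> I" and b: "low t x b < x b" "b \<in> I" for z b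
      proof -
        have "(z, b) \<in> r"
        proof (rule ccontr)
          assume "(z, b) \<notin> r"
          then have bz: "(b, z) \<in> r" "b \<noteq> z"
            using comp[of z b] xz[of z] xz'[of b] z b refl by auto
          have "below x b + x b = (\<Sum>y \<in> insert b {y. (y, b) \<in> r \<and> y \<noteq> b}. x y)"
            using finbelow[of b] by (simp add: below_def)
          also have "\<dots> \<le> below x z"
            unfolding below_def using bz finbelow[of z]
            by (intro sum_mono2) (auto intro: pos trans dest: antisym trans)
          finally have "below x b + x b \<le> below x z" .
          moreover have "below x z < t" using z(1) low(1)[of z] by (auto simp: low_def)
          moreover have "t - below x b < x b" using b(1) by (auto simp: low_def)
          ultimately show False by linarith
        qed
        then show ?thesis using le[OF z(2)] trans by blast
      qed
      from cases[OF ab(1)] cases[OF ab(2)] show ?thesis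
      proof (elim disjE exE conjE)
        fix z z' assume "f z = a" "low t x z \<noteq> 0" "z \<in> I" "f z' = b" "low t x z' \<noteq> 0" "z' \<in> I"
        then show ?thesis using comp[of z z'] xz mono by metis
      next
        fix z assume "f z = a" "low t x z \<noteq> 0" "z \<in> I" "low t x b < x b" "b \<in> I"
        then show ?thesis using key by blast
      next
        fix z assume "f z = b" "low t x z \<noteq> 0" "z \<in> I" "low t x a < x a" "a \<in> I"
        then show ?thesis using key by blast
      next
        assume "low t x a < x a" "low t x b < x b"
        then show ?thesis using comp xz' by blast
      qed
    qed
    ultimately show ?thesis using nonneg by (auto simp: in_realization_iff)
  qed
  have c1: "continuous_map (prod_topology (top_of_set {0..1}) realization) euclideanreal (\<lambda>p. snd p a)" for a
    by (rule continuous_map_prod_snd[OF continuous_map_barycentric_coordinate])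
  have c2: "continuous_map (prod_topology (top_of_set {0..1}) realization) euclideanreal (\<lambda>p. low (fst p) (snd p) z)" for z
    unfolding low_def below_def
    by (intro continuous_intros continuous_map_prod_fst_real c1 finbelow) simp
  have "continuous_map (prod_topology (top_of_set {0..1}) realization) euclideanreal (\<lambda>p. H p a)" for a
    unfolding H_def split_beta by (auto intro!: continuous_intros c1 c2 fin)
  then have "continuous_map (prod_topology (top_of_set {0..1}) realization) realization H"
    using H_in by (auto simp: continuous_map_into_geometric_realization)
  moreover have "H (0, x) = id x" if x: "x \<in> topspace realization" for x
  proof
    fix a
    have "0 \<le> x z" "0 \<le> below x z" for z
      using x by (auto simp: in_realization_iff below_def intro!: sum_nonneg)
    then have "low 0 x z = 0" for z
      by (simp add: low_def min_absorb2)
    moreover have "x a = 0" if "a \<notin> I"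
      using x that by (force simp: in_realization_iff dest: in_field)
    ultimately show "H (0, x) a = id x a" by (auto simp: H_def intro!: sum.neutral)
  qed
  moreover have "H (1, x) = pushforward f x" if x: "x \<in> topspace realization" for x
  proof
    fix a
    have pos: "\<And>a. 0 \<le> x a" and 1: "(\<Sum>a\<in>I. x a) = 1"
      using x by (auto simp: in_realization_iff)
    have "low 1 x z = x z" if "z \<in> I" for z
    proof -
      have "below x z + x z = (\<Sum>y \<in> insert z {y. (y, z) \<in> r \<and> y \<noteq> z}. x y)"
        using finbelow[of z] by (simp add: below_def)
      also have "\<dots> \<le> (\<Sum>y\<in>I. x y)"
        using that pos by (intro sum_mono2 fin) (auto dest: in_field)
      finally show ?thesis using 1 by (auto simp: low_def)
    qed
    then show "H (1, x) a = pushforward f x a"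
      by (auto simp: H_def pushforward_def intro!: sum.cong)
  qed
  ultimately show ?thesis
    by (subst homotopic_with) auto
qed

text \<open>A conical contraction: \<open>x\<close> descends to \<open>f x\<close>, which lies below
  the fixed element \<open>m\<close>. The second homotopy runs inside cones with apex
  \<open>m\<close>.\<close>

lemma contractible_realization:
  assumes mono: "\<And>x y. (x, y) \<in> r \<Longrightarrow> (f x, f y) \<in> r" and le: "\<And>x. x \<in> I \<Longrightarrow> (f x, x) \<in> r"
    and m: "m \<in> I" "\<And>x. x \<in> I \<Longrightarrow> (f x, m) \<in> r"
  shows "contractible_space realization" "topspace realization \<noteq> {}"
proof -
  have cone: "(\<lambda>a. if a = m then 1 else 0) \<in> topspace realization"
    using m fin refl by (auto simp: in_realization_iff)
  then show "topspace realization \<noteq> {}" by blast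
  have hom: "homotopic_with (\<lambda>_. True) realization realization id (pushforward f)"
    by (rule pushforward_homotopic_id[OF mono le])
  have "homotopic_with (\<lambda>_. True) realization realization (pushforward f) (\<lambda>_ a. if a = m then 1 else 0)"
  proof (rule homotopic_common_simplex[OF simplicial_complex_order_complex])
    show "continuous_map realization realization (pushforward f)"
      using hom by (rule homotopic_with_imp_continuous_maps[THEN conjunct2])
    show "continuous_map realization realization (\<lambda>_ a. if a = m then 1 else 0)"
      using cone by simp
    fix x assume x: "x \<in> topspace realization"
    have comp: "(a, b) \<in> r \<or> (b, a) \<in> r" if "x a \<noteq> 0" "x b \<noteq> 0" for a b
      using x that by (auto simp: in_realization_iff)
    have sub: "f ` I \<subseteq> I" using le in_field by blast
    show "\<exists>\<sigma>\<in>order_complex r. \<forall>a. pushforward f x a \<noteq> 0 \<or> (if a = m then 1 else 0) \<noteq> (0::real) \<longrightarrow> a \<in> \<sigma>"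
    proof (intro bexI allI impI)
      show "insert m {f z | z. z \<in> I \<and> x z \<noteq> 0} \<in> order_complex r"
      proof -
        have "finite (insert m {f z | z. z \<in> I \<and> x z \<noteq> 0})"
          by (rule finite_subset[of _ "insert m (f ` I)"]) (use fin in auto)
        moreover have "insert m {f z | z. z \<in> I \<and> x z \<noteq> 0} \<in> Chains r"
          using m refl comp mono by (auto simp: Chains_def) blast
        ultimately show ?thesis by (simp add: order_complex_def)
      qed
      fix a assume "pushforward f x a \<noteq> 0 \<or> (if a = m then 1 else 0) \<noteq> (0::real)"
      then show "a \<in> insert m {f z | z. z \<in> I \<and> x z \<noteq> 0}"
        by (auto split: if_splits elim!: pushforward_nonzeroD)
    qed
  qed
  then show "contractible_space realization"
    using homotopic_with_trans[OF hom] unfolding contractible_space_def by blast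
qed

end

section \<open>The boundary of a simplex is a sphere\<close>

lemma continuous_map_real_Min:
  fixes f :: "'i \<Rightarrow> 'x \<Rightarrow> real"
  assumes "finite F" "F \<noteq> {}" "\<And>i. i \<in> F \<Longrightarrow> continuous_map X euclideanreal (f i)"
  shows "continuous_map X euclideanreal (\<lambda>x. Min ((\<lambda>i. f i x) ` F))"
  using assms
proof (induction rule: finite_ne_induct)
  case (insert i F)
  then have "continuous_map X euclideanreal (\<lambda>x. min (f i x) (Min ((\<lambda>i. f i x) ` F)))"
    by (intro continuous_intros) auto
  then show ?case using insert by simp
qed simp

lemma in_simplex_boundary_iff:
  assumes "finite A"
  shows "p \<in> topspace (geometric_realization {S. S \<subset> A}) \<longleftrightarrow>
    (\<forall>a. 0 \<le> p a) \<and> (\<forall>a. p a \<noteq> 0 \<longrightarrow> a \<in> A) \<and> (\<exists>a\<in>A. p a = 0) \<and> (\<Sum>a\<in>A. p a) = 1" (is "?L \<longleftrightarrow> ?R")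
proof
  assume ?L
  then have p: "\<forall>a. 0 \<le> p a" "{a. p a \<noteq> 0} \<subset> A" "(\<Sum>a | p a \<noteq> 0. p a) = 1"
    by (auto simp: geometric_realization_def)
  moreover have "(\<Sum>a\<in>A. p a) = (\<Sum>a | p a \<noteq> 0. p a)"
    by (rule sum.mono_neutral_right) (use p assms in auto)
  ultimately show ?R by auto
next
  assume R: ?R
  have "(\<Sum>a | p a \<noteq> 0. p a) = (\<Sum>a\<in>A. p a)"
    by (rule sum.mono_neutral_left) (use R assms in auto)
  then show ?L using R by (auto simp: geometric_realization_def)
qed

text \<open>Modulo constants and positive scaling, a nonconstant vector on \<open>A\<close> has
  exactly one representative with minimum 0 and sum 1, a point of the boundary, and exactly one with
  last coordinate 0 and Euclidean norm 1, a point of the sphere. \<open>F\<close> and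
  \<open>G\<close> exchange these normal forms.\<close>

lemma simplex_boundary_homeomorphic_nsphere:
  assumes card: "card A = d + 2"
  shows "geometric_realization {S. S \<subset> A} homeomorphic_space nsphere d"
proof -
  have fin: "finite A" using card by (metis card.infinite add_2_eq_Suc' nat.distinct(1))
  have "card A = card {..Suc d}" using card by simp
  then obtain en where "bij_betw en {..Suc d} A"
    using fin finite_same_card_bij by (metis finite_atMost)
  then have inj: "inj_on en {..Suc d}" and im: "en ` {..Suc d} = A" by (auto simp: bij_betw_def)
  let ?N = "Suc d"
  let ?B = "geometric_realization {S. S \<subset> A}"
  define num where "num = inv_into {..?N} en"
  have num: "num a \<le> ?N" "en (num a) = a" if "a \<in> A" for a
    using that im inv_into_into[of a en "{..?N}"] f_inv_into_f[of a en "{..?N}"] by (auto simp: num_def)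
  have num_en: "num (en i) = i" "en i \<in> A" if "i \<le> ?N" for i
    using that inj im by (auto simp: num_def)
  define \<nu> where "\<nu> p = sqrt (\<Sum>i\<le>d. (p (en i) - p (en ?N))\<^sup>2)" for p :: "'a \<Rightarrow> real"
  define F where "F p i = (if i \<le> d then (p (en i) - p (en ?N)) / \<nu> p else 0)" for p :: "'a \<Rightarrow> real" and i
  define \<mu> where "\<mu> q = Min (q ` {..?N})" for q :: "nat \<Rightarrow> real"
  define \<sigma> where "\<sigma> q = (\<Sum>i\<le>?N. q i - \<mu> q)" for q :: "nat \<Rightarrow> real"
  define G where "G q a = (if a \<in> A then (q (num a) - \<mu> q) / \<sigma> q else 0)" for q a
  have sumA: "(\<Sum>a\<in>A. g a) = (\<Sum>i\<le>?N. g (en i))" for g :: "'a \<Rightarrow> real"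
    using sum.reindex[OF inj, of g] im by simp
  have \<mu>: "\<mu> q \<le> q i" if "i \<le> ?N" for q i
    using that by (auto simp: \<mu>_def)
  have \<mu>_ex: "\<exists>i\<le>?N. q i = \<mu> q" for q
  proof -
    have "\<mu> q \<in> q ` {..?N}" unfolding \<mu>_def by (intro Min_in) auto
    then show ?thesis by (metis imageE atMost_iff)
  qed
  have \<nu>_pos: "\<nu> p > 0" if "p \<in> topspace ?B" for p
  proof -
    have R: "\<exists>a\<in>A. p a = 0" "(\<Sum>a\<in>A. p a) = 1" using that by (auto simp: in_simplex_boundary_iff[OF fin])
    have "\<exists>i\<le>d. p (en i) \<noteq> p (en ?N)"
    proof (rule ccontr)
      assume "\<not> ?thesis"
      then have eq: "p (en i) = p (en ?N)" if "i \<le> ?N" for i using that by (auto simp: le_Suc_eq)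
      then have "p a = p (en ?N)" if "a \<in> A" for a using num[OF that] by metis
      then have "p a = 0" if "a \<in> A" for a using R that by metis
      then show False using R by simp
    qed
    then have "(\<Sum>i\<le>d. (p (en i) - p (en ?N))\<^sup>2) > 0"
      by (auto intro!: sum_pos2)
    then show ?thesis by (simp add: \<nu>_def)
  qed
  have sphere: "q \<in> topspace (nsphere d) \<longleftrightarrow> (\<forall>i>d. q i = 0) \<and> (\<Sum>i\<le>d. (q i)\<^sup>2) = 1" for q
    by (auto simp: nsphere)
  have \<sigma>_pos: "\<sigma> q > 0" if "q \<in> topspace (nsphere d)" for q
  proof (rule ccontr)
    assume "\<not> \<sigma> q > 0"
    moreover have "\<sigma> q \<ge> 0" unfolding \<sigma>_def by (intro sum_nonneg) (use \<mu> in force)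
    ultimately have "\<sigma> q = 0" by simp
    then have "\<forall>i\<in>{..?N}. q i - \<mu> q = 0"
      unfolding \<sigma>_def using \<mu> by (subst (asm) sum_nonneg_eq_0_iff) force+
    then have "q i = q ?N" if "i \<le> d" for i using that by force
    moreover have "q ?N = 0" using that by (simp add: sphere)
    ultimately show False using that by (simp add: sphere)
  qed
  have "homeomorphic_maps ?B (nsphere d) F G"
    unfolding homeomorphic_maps_def
  proof (intro conjI ballI)
    have cF: "continuous_map ?B euclideanreal (\<lambda>p. F p i)" for i
    proof (cases "i \<le> d")
      case True
      have "continuous_map ?B euclideanreal (\<lambda>p. (p (en i) - p (en ?N)) / \<nu> p)"
      proof (intro continuous_intros continuous_map_barycentric_coordinate)
        show "continuous_map ?B euclideanreal \<nu>"
          unfolding \<nu>_def by (intro continuous_intros continuous_map_barycentric_coordinate) auto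
        show "\<nu> p \<noteq> 0" if "p \<in> topspace ?B" for p using \<nu>_pos[OF that] by simp
      qed
      then show ?thesis using True by (simp add: F_def)
    qed (simp add: F_def)
    have "F p \<in> topspace (nsphere d)" if "p \<in> topspace ?B" for p
    proof -
      have "(\<Sum>i\<le>d. (F p i)\<^sup>2) = (\<Sum>i\<le>d. (p (en i) - p (en ?N))\<^sup>2) / (\<nu> p)\<^sup>2"
        by (simp add: F_def power_divide sum_divide_distrib)
      also have "(\<Sum>i\<le>d. (p (en i) - p (en ?N))\<^sup>2) = (\<nu> p)\<^sup>2"
        by (simp add: \<nu>_def sum_nonneg)
      finally show ?thesis using \<nu>_pos[OF that] by (simp add: sphere F_def)
    qed
    then show "continuous_map ?B (nsphere d) F"
      using cF by (auto simp: nsphere continuous_map_in_subtopology continuous_map_componentwise_UNIV)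
    have c\<mu>: "continuous_map (nsphere d) euclideanreal \<mu>"
      unfolding \<mu>_def by (intro continuous_map_real_Min continuous_map_nsphere_projection) auto
    have cG: "continuous_map (nsphere d) euclideanreal (\<lambda>q. G q a)" for a
    proof (cases "a \<in> A")
      case True
      have "continuous_map (nsphere d) euclideanreal (\<lambda>q. (q (num a) - \<mu> q) / \<sigma> q)"
      proof (intro continuous_intros continuous_map_nsphere_projection c\<mu>)
        show "continuous_map (nsphere d) euclideanreal \<sigma>"
          unfolding \<sigma>_def by (intro continuous_intros continuous_map_nsphere_projection c\<mu>) auto
        show "\<sigma> q \<noteq> 0" if "q \<in> topspace (nsphere d)" for q using \<sigma>_pos[OF that] by simp
      qed
      then show ?thesis using True by (simp add: G_def)
    qed (simp add: G_def)
    have "G q \<in> topspace ?B" if "q \<in> topspace (nsphere d)" for q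
    proof -
      obtain i where "i \<le> ?N" "q i = \<mu> q" using \<mu>_ex by blast
      then have "en i \<in> A" "G q (en i) = 0" by (simp_all add: G_def num_en)
      moreover have "(\<Sum>a\<in>A. G q a) = \<sigma> q / \<sigma> q"
        by (simp add: sumA G_def num_en \<sigma>_def flip: sum_divide_distrib)
      moreover have "0 \<le> G q a" for a
        using \<mu>[OF num(1), of a q] \<sigma>_pos[OF that] by (auto simp: G_def)
      ultimately show ?thesis using \<sigma>_pos[OF that]
        by (auto simp: in_simplex_boundary_iff[OF fin]) (auto simp: G_def split: if_splits)
    qed
    then show "continuous_map (nsphere d) ?B G"
      using cG by (simp add: continuous_map_into_geometric_realization)
    show "G (F p) = p" if p: "p \<in> topspace ?B" for p
    proof
      fix a
      have R: "\<forall>a. 0 \<le> p a" "\<forall>a. p a \<noteq> 0 \<longrightarrow> a \<in> A" "\<exists>a\<in>A. p a = 0" "(\<Sum>a\<in>A. p a) = 1"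
        using p by (simp_all add: in_simplex_boundary_iff[OF fin])
      have Fi: "F p i = (p (en i) - p (en ?N)) / \<nu> p" if "i \<le> ?N" for i
        using that by (cases "i = ?N") (auto simp: F_def)
      obtain b where b: "b \<in> A" "p b = 0" using R by blast
      have "\<mu> (F p) = - p (en ?N) / \<nu> p"
      proof (rule antisym)
        show "\<mu> (F p) \<le> - p (en ?N) / \<nu> p"
          using \<mu>[OF num(1)[OF b(1)], of "F p"] b num[OF b(1)] Fi by simp
        obtain i where "i \<le> ?N" "F p i = \<mu> (F p)" using \<mu>_ex by blast
        then show "- p (en ?N) / \<nu> p \<le> \<mu> (F p)"
          using R \<nu>_pos[OF p] by (auto simp: Fi divide_simps dest: sym)
      qed
      then have diff: "F p i - \<mu> (F p) = p (en i) / \<nu> p" if "i \<le> ?N" for i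
        using that by (simp add: Fi diff_divide_distrib)
      then have "\<sigma> (F p) = (\<Sum>i\<le>?N. p (en i)) / \<nu> p"
        unfolding \<sigma>_def sum_divide_distrib by (intro sum.cong) auto
      then have "\<sigma> (F p) = 1 / \<nu> p" using R(4) by (simp add: sumA)
      then show "G (F p) a = p a"
        using R(2) \<nu>_pos[OF p] num[of a] by (auto simp: G_def diff)
    qed
    show "F (G q) = q" if q: "q \<in> topspace (nsphere d)" for q
    proof
      fix i
      have R: "\<forall>i>d. q i = 0" "(\<Sum>i\<le>d. (q i)\<^sup>2) = 1" using q by (simp_all add: sphere)
      have diff: "G q (en i) - G q (en ?N) = q i / \<sigma> q" if "i \<le> ?N" for i
        using that R by (simp add: G_def num_en diff_divide_distrib)
      then have "(\<Sum>i\<le>d. (G q (en i) - G q (en ?N))\<^sup>2) = (\<Sum>i\<le>d. (q i)\<^sup>2) / (\<sigma> q)\<^sup>2"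
        by (simp add: power_divide sum_divide_distrib)
      then have "\<nu> (G q) = 1 / \<sigma> q"
        using R \<sigma>_pos[OF q] by (simp add: \<nu>_def real_sqrt_divide)
      then show "F (G q) i = q i"
        using R \<sigma>_pos[OF q] by (auto simp: F_def diff)
    qed
  qed
  then show ?thesis by (auto simp: homeomorphic_space_def)
qed

section \<open>Crosscut equivalence with the boundary of a simplex\<close>

context finite_poset begin

text \<open>\<open>ats\<close> and \<open>J\<close> relate \<open>I\<close> to the face poset of the
  simplex boundary: \<open>ats\<close> after \<open>J\<close> is the identity, and \<open>J\<close>
  after \<open>ats\<close> lies below the identity. The comparison maps are written directly on
  realizations, with superlevel sets of \<open>p\<close> in place of a barycentric
  subdivision.\<close>

lemma crosscut_equivalence:
  fixes A :: "'b set" and ats :: "'a \<Rightarrow> 'b set" and J :: "'b set \<Rightarrow> 'a"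
  assumes finA: "finite A"
    and ats: "\<And>x. x \<in> I \<Longrightarrow> ats x \<noteq> {} \<and> ats x \<subset> A"
    and at_mono: "\<And>x y. (x, y) \<in> r \<Longrightarrow> ats x \<subseteq> ats y"
    and J_mono: "\<And>S T. S \<noteq> {} \<Longrightarrow> S \<subseteq> T \<Longrightarrow> T \<subset> A \<Longrightarrow> (J S, J T) \<in> r"
    and at_J: "\<And>S. S \<noteq> {} \<Longrightarrow> S \<subset> A \<Longrightarrow> ats (J S) = S"
    and J_le: "\<And>x. x \<in> I \<Longrightarrow> (J (ats x), x) \<in> r"
  shows "realization homotopy_equivalent_space geometric_realization {S. S \<subset> A}"
proof -
  let ?B = "geometric_realization {S. S \<subset> A}"
  note B = simplicial_complex_proper_subsets[OF finA]
  define Pr where "Pr = {S. S \<noteq> {} \<and> S \<subset> A}"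
  have finPr: "finite Pr" using finA by (auto simp: Pr_def intro: finite_subset[of _ "Pow A"])
  have J_in: "J S \<in> I" if "S \<in> Pr" for S using J_mono[of S S] that in_field by (auto simp: Pr_def)
  \<comment> \<open>The mass at \<open>z\<close> is spread evenly over its atoms, so
    \<open>z\<close> goes to the barycentre of the face \<open>ats z\<close>.\<close>
  define \<phi> where "\<phi> x a = (\<Sum>z\<in>I. if a \<in> ats z then x z / card (ats z) else 0)" for x :: "'a \<Rightarrow> real" and a
  \<comment> \<open>Nonzero exactly when all values of \<open>p\<close> on \<open>S\<close> exceed
    all values on \<open>A - S\<close>. The sets that receive weight are thus superlevel sets of
    \<open>p\<close> and form a chain.\<close>
  define lam where "lam S p = (\<Prod>a\<in>S. \<Prod>b\<in>A - S. max 0 (p a - p b))" for S and p :: "'b \<Rightarrow> real"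
  define Lam where "Lam p = (\<Sum>S\<in>Pr. lam S p)" for p
  define \<psi> where "\<psi> p c = (\<Sum>S\<in>Pr. if J S = c then lam S p else 0) / Lam p" for p c
  have fin_at: "finite (ats z)" if "z \<in> I" for z using ats[OF that] finA by (auto intro: finite_subset)
  have lam_nonneg: "0 \<le> lam S p" for S p by (auto simp: lam_def intro!: prod_nonneg)
  have lam_pos: "lam S p \<noteq> 0 \<longleftrightarrow> (\<forall>a\<in>S. \<forall>b\<in>A - S. p b < p a)" if "S \<in> Pr" for S p
  proof -
    have "finite S" using that finA by (auto simp: Pr_def intro: finite_subset)
    then have "lam S p = 0 \<longleftrightarrow> (\<exists>a\<in>S. \<exists>b\<in>A - S. max 0 (p a - p b) = 0)"
      using finA by (simp add: lam_def prod_zero_iff)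
    moreover have "max 0 (p a - p b) = 0 \<longleftrightarrow> \<not> p b < p a" for a b by auto
    ultimately show ?thesis by blast
  qed
  have Lam_pos: "Lam p > 0" if p: "p \<in> topspace ?B" for p
  proof -
    let ?T = "{a. p a \<noteq> 0}"
    have R: "\<forall>a. 0 \<le> p a" "\<forall>a. p a \<noteq> 0 \<longrightarrow> a \<in> A" "\<exists>a\<in>A. p a = 0" "(\<Sum>a\<in>A. p a) = 1"
      using p by (simp_all add: in_simplex_boundary_iff[OF finA])
    then have "?T \<noteq> {}" by (intro notI) auto
    then have T: "?T \<in> Pr" using R by (auto simp: Pr_def)
    have "lam ?T p \<noteq> 0"
      unfolding lam_pos[OF T] using R(1) by (auto simp: less_le)
    then have "lam ?T p > 0" using lam_nonneg[of ?T p] by linarith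
    then show ?thesis unfolding Lam_def using lam_nonneg
      by (intro sum_pos2[OF finPr T]) auto
  qed
  have \<phi>_supp: "\<exists>z\<in>I. x z \<noteq> 0 \<and> a \<in> ats z" if nz: "\<phi> x a \<noteq> 0" for x a
  proof -
    obtain z where "z \<in> I" "(if a \<in> ats z then x z / card (ats z) else 0) \<noteq> 0"
      using nz unfolding \<phi>_def by (rule sum.not_neutral_contains_not_neutral)
    then show ?thesis by (auto split: if_splits)
  qed
  have \<phi>_in: "\<phi> x \<in> topspace ?B" if x: "x \<in> topspace realization" for x
  proof -
    have pos: "0 \<le> x a" for a using x by (auto simp: in_realization_iff)
    have comp: "(a, b) \<in> r \<or> (b, a) \<in> r" if "x a \<noteq> 0" "x b \<noteq> 0" for a b
      using x that by (auto simp: in_realization_iff)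
    have sum1: "(\<Sum>a\<in>I. x a) = 1" using x by (auto simp: in_realization_iff)
    let ?C = "{z \<in> I. x z \<noteq> 0}"
    have "?C \<noteq> {}" using sum1 by (intro notI) auto
    \<comment> \<open>The supported elements form a chain, so their atom sets are nested and the
      largest one carries \<open>\<phi> x\<close>.\<close>
    then obtain m where m: "m \<in> ?C" and max: "\<forall>z\<in>?C. ats m \<subseteq> ats z \<longrightarrow> ats m = ats z"
      using finite_has_maximal[of "ats ` ?C"] fin by auto
    have sub: "ats z \<subseteq> ats m" if z: "z \<in> ?C" for z
      using comp[of z m] z m max at_mono by blast
    have "(\<Sum>a\<in>ats m. \<phi> x a) = (\<Sum>z\<in>I. \<Sum>a\<in>ats m. if a \<in> ats z then x z / card (ats z) else 0)"
      unfolding \<phi>_def by (rule sum.swap)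
    also have "\<dots> = (\<Sum>z\<in>I. x z)"
    proof (rule sum.cong[OF HOL.refl])
      fix z assume z: "z \<in> I"
      show "(\<Sum>a\<in>ats m. if a \<in> ats z then x z / card (ats z) else 0) = x z"
      proof (cases "x z = 0")
        case False
        then have "ats m \<inter> ats z = ats z" using sub z by auto
        moreover have "card (ats z) \<noteq> 0" using ats[OF z] fin_at[OF z] by simp
        ultimately show ?thesis using fin_at[of m] m by (simp add: sum.If_cases Int_def[symmetric])
      qed (simp add: sum.neutral)
    qed
    finally have "(\<Sum>a\<in>ats m. \<phi> x a) = 1" using sum1 by simp
    moreover have "0 \<le> \<phi> x a" for a using pos by (auto simp: \<phi>_def intro!: sum_nonneg)
    moreover have "a \<in> ats m" if "\<phi> x a \<noteq> 0" for a using \<phi>_supp[OF that] sub by auto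
    ultimately show ?thesis
      unfolding in_geometric_realization_iff[OF B] using ats[of m] m by blast
  qed
  have "continuous_map realization euclideanreal (\<lambda>x. \<phi> x a)" for a
    unfolding \<phi>_def using ats fin_at
    by (auto intro!: continuous_intros fin continuous_map_barycentric_coordinate)
  then have \<phi>_cont: "continuous_map realization ?B \<phi>"
    using \<phi>_in by (simp add: continuous_map_into_geometric_realization)
  have \<psi>_supp: "\<exists>S\<in>Pr. J S = c \<and> (\<forall>a\<in>S. \<forall>b\<in>A - S. p b < p a)" if "\<psi> p c \<noteq> 0" for p c
  proof -
    have "(\<Sum>S\<in>Pr. if J S = c then lam S p else 0) \<noteq> 0" using that by (auto simp: \<psi>_def)
    then obtain S where "S \<in> Pr" "(if J S = c then lam S p else 0) \<noteq> 0"
      by (rule sum.not_neutral_contains_not_neutral)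
    then show ?thesis using lam_pos by (auto split: if_splits)
  qed
  have \<psi>_in: "\<psi> p \<in> topspace realization" if p: "p \<in> topspace ?B" for p
  proof -
    have "(\<Sum>c\<in>I. \<Sum>S\<in>Pr. if J S = c then lam S p else 0) = (\<Sum>S\<in>Pr. \<Sum>c\<in>I. if J S = c then lam S p else 0)"
      by (rule sum.swap)
    also have "\<dots> = Lam p"
      unfolding Lam_def using J_in fin by (intro sum.cong) auto
    finally have "(\<Sum>c\<in>I. \<psi> p c) = 1"
      using Lam_pos[OF p] by (simp add: \<psi>_def flip: sum_divide_distrib)
    moreover have "0 \<le> \<psi> p c" for c
      using Lam_pos[OF p] lam_nonneg by (auto simp: \<psi>_def intro!: divide_nonneg_pos sum_nonneg)
    moreover have "(c, c') \<in> r \<or> (c', c) \<in> r" if c: "\<psi> p c \<noteq> 0" "\<psi> p c' \<noteq> 0" for c c'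
    proof -
      obtain S where S: "S \<in> Pr" "J S = c" "\<forall>a\<in>S. \<forall>b\<in>A - S. p b < p a"
        using \<psi>_supp[OF c(1)] by blast
      obtain S' where S': "S' \<in> Pr" "J S' = c'" "\<forall>a\<in>S'. \<forall>b\<in>A - S'. p b < p a"
        using \<psi>_supp[OF c(2)] by blast
      have "S \<subseteq> S' \<or> S' \<subseteq> S"
      proof (rule ccontr)
        assume "\<not> ?thesis"
        then obtain a b where "a \<in> S" "a \<notin> S'" "b \<in> S'" "b \<notin> S" by blast
        then have "p b < p a" "p a < p b" using S S' by (auto simp: Pr_def)
        then show False by simp
      qed
      then show ?thesis using S(1,2) S'(1,2) J_mono[of S S'] J_mono[of S' S] by (auto simp: Pr_def)
    qed
    ultimately show ?thesis by (auto simp: in_realization_iff)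
  qed
  have "continuous_map ?B euclideanreal (\<lambda>p. \<psi> p c)" for c
  proof -
    have fS: "finite S" if "S \<in> Pr" for S using that finA by (auto simp: Pr_def intro: finite_subset)
    have l: "continuous_map ?B euclideanreal (lam S)" if "S \<in> Pr" for S
      unfolding lam_def using fS[OF that] finA
      by (intro continuous_intros continuous_map_barycentric_coordinate) auto
    then have L: "continuous_map ?B euclideanreal Lam"
      unfolding Lam_def by (intro continuous_intros finPr)
    have "continuous_map ?B euclideanreal (\<lambda>p. \<Sum>S\<in>Pr. if J S = c then lam S p else 0)"
    proof (rule continuous_map_sum[OF finPr])
      fix S assume "S \<in> Pr"
      then show "continuous_map ?B euclideanreal (\<lambda>p. if J S = c then lam S p else 0)"
        using l by (cases "J S = c") auto
    qed
    then show ?thesis unfolding \<psi>_def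
      by (rule continuous_map_real_divide[OF _ L]) (use Lam_pos in force)
  qed
  then have \<psi>_cont: "continuous_map ?B realization \<psi>"
    using \<psi>_in by (simp add: continuous_map_into_geometric_realization)
  let ?f = "\<lambda>z. J (ats z)"
  have f_mono: "(?f x, ?f y) \<in> r" if "(x, y) \<in> r" for x y
    using J_mono[of "ats x" "ats y"] at_mono[OF that] ats in_field[OF that] by auto
  have push: "homotopic_with (\<lambda>_. True) realization realization id (pushforward ?f)"
    by (rule pushforward_homotopic_id[OF f_mono J_le])
  have "homotopic_with (\<lambda>_. True) realization realization (\<psi> \<circ> \<phi>) (pushforward ?f)"
  proof (rule homotopic_common_simplex[OF simplicial_complex_order_complex])
    show "continuous_map realization realization (\<psi> \<circ> \<phi>)"
      using \<phi>_cont \<psi>_cont by (rule continuous_map_compose)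
    show "continuous_map realization realization (pushforward ?f)"
      using push by (rule homotopic_with_imp_continuous_maps[THEN conjunct2])
    fix x assume x: "x \<in> topspace realization"
    have pos: "0 \<le> x a" for a using x by (auto simp: in_realization_iff)
    have comp: "(a, b) \<in> r \<or> (b, a) \<in> r" if "x a \<noteq> 0" "x b \<noteq> 0" for a b
      using x that by (auto simp: in_realization_iff)
    let ?\<sigma> = "{?f z | z. z \<in> I \<and> x z \<noteq> 0}"
    have "finite ?\<sigma>" by (rule finite_subset[of _ "?f ` I"]) (use fin in auto)
    moreover have "?\<sigma> \<in> Chains r" using comp f_mono by (auto simp: Chains_def)
    ultimately have "?\<sigma> \<in> order_complex r" by (simp add: order_complex_def)
    moreover have "c \<in> ?\<sigma>" if nz: "\<psi> (\<phi> x) c \<noteq> 0" for c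
    proof -
      obtain S where S: "S \<in> Pr" "J S = c" "\<forall>a\<in>S. \<forall>b\<in>A - S. \<phi> x b < \<phi> x a"
        using \<psi>_supp[OF nz] by blast
      have le: "\<phi> x a \<le> \<phi> x b" if "\<And>z. z \<in> I \<Longrightarrow> x z \<noteq> 0 \<Longrightarrow> a \<in> ats z \<Longrightarrow> b \<in> ats z" for a b
        unfolding \<phi>_def
      proof (rule sum_mono)
        fix z assume "z \<in> I"
        then show "(if a \<in> ats z then x z / card (ats z) else 0) \<le> (if b \<in> ats z then x z / card (ats z) else 0)"
          using that[of z] pos[of z] by (cases "x z = 0") auto
      qed
      \<comment> \<open>Every set that receives weight from \<open>\<phi> x\<close> is the atom set
        of a supported \<open>z\<close>, so \<open>\<psi> (\<phi> x)\<close> is carried by the same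
        chain as the pushforward of \<open>x\<close>.\<close>
      have "\<exists>z\<in>I. x z \<noteq> 0 \<and> ats z = S"
      proof -
        have ne: "S \<noteq> {}" "\<exists>b. b \<in> A - S" using S(1) by (auto simp: Pr_def)
        have sep: "\<exists>z\<in>I. x z \<noteq> 0 \<and> a \<in> ats z \<and> b \<notin> ats z" if "a \<in> S" "b \<in> A - S" for a b
        proof (rule ccontr)
          assume "\<not> ?thesis"
          then have "\<phi> x a \<le> \<phi> x b" by (intro le) blast
          then show False using S(3) that by (meson not_le)
        qed
        let ?C = "{z\<in>I. x z \<noteq> 0 \<and> ats z \<subseteq> S}"
        \<comment> \<open>If no supported \<open>z\<close> with \<open>a\<close> in
          \<open>ats z\<close> stayed within \<open>S\<close>, the smallest such
          \<open>ats z\<close> would contain some \<open>b\<close> outside \<open>S\<close>; then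
          \<open>b\<close> would accompany \<open>a\<close> everywhere, contradicting
          \<open>sep\<close>.\<close>
        have C1: "\<exists>z\<in>?C. a \<in> ats z" if a: "a \<in> S" for a
        proof (rule ccontr)
          assume no: "\<not> ?thesis"
          let ?D = "{z\<in>I. x z \<noteq> 0 \<and> a \<in> ats z}"
          obtain b0 where "b0 \<in> A - S" using ne by blast
          then have "?D \<noteq> {}" using sep[OF a] by blast
          then obtain m where m: "m \<in> ?D" and min: "\<forall>z\<in>?D. ats z \<subseteq> ats m \<longrightarrow> ats m = ats z"
            using finite_has_minimal[of "ats ` ?D"] fin by auto
          have msub: "ats m \<subseteq> ats z" if z: "z \<in> ?D" for z
            using comp[of z m] z m min at_mono by blast
          have "\<not> ats m \<subseteq> S" using no m by blast
          then obtain b where b: "b \<in> ats m" "b \<in> A - S" using ats[of m] m by blast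
          then obtain z where "z \<in> ?D" "b \<notin> ats z" using sep[OF a b(2)] by blast
          then show False using msub b by blast
        qed
        then have "?C \<noteq> {}" using ne by blast
        then obtain m where m: "m \<in> ?C" and max: "\<forall>z\<in>?C. ats m \<subseteq> ats z \<longrightarrow> ats m = ats z"
          using finite_has_maximal[of "ats ` ?C"] fin by auto
        have "S \<subseteq> ats m"
        proof
          fix a assume "a \<in> S"
          then obtain z where z: "z \<in> ?C" "a \<in> ats z" using C1 by blast
          then have "ats z \<subseteq> ats m" using comp[of z m] m max at_mono by blast
          then show "a \<in> ats m" using z by blast
        qed
        then show ?thesis using m by blast
      qed
      then show ?thesis using S(2) by blast
    qed
    moreover have "c \<in> ?\<sigma>" if "pushforward ?f x c \<noteq> 0" for c
      using that by (rule pushforward_nonzeroD) auto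
    ultimately show "\<exists>\<sigma>\<in>order_complex r. \<forall>a. (\<psi> \<circ> \<phi>) x a \<noteq> 0 \<or> pushforward ?f x a \<noteq> 0 \<longrightarrow> a \<in> \<sigma>"
      by (intro bexI[of _ ?\<sigma>]) auto
  qed
  then have "homotopic_with (\<lambda>_. True) realization realization (\<psi> \<circ> \<phi>) id"
    using push homotopic_with_sym homotopic_with_trans by blast
  moreover have "homotopic_with (\<lambda>_. True) ?B ?B (\<phi> \<circ> \<psi>) id"
  proof (rule homotopic_common_simplex[OF B])
    show "continuous_map ?B ?B (\<phi> \<circ> \<psi>)"
      using \<psi>_cont \<phi>_cont by (rule continuous_map_compose)
    fix p assume p: "p \<in> topspace ?B"
    have R: "\<forall>a. 0 \<le> p a" "\<forall>a. p a \<noteq> 0 \<longrightarrow> a \<in> A" "\<exists>a\<in>A. p a = 0"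
      using p by (simp_all add: in_simplex_boundary_iff[OF finA])
    \<comment> \<open>A value of \<open>p\<close> on \<open>S\<close> exceeds a nonnegative value
      outside \<open>S\<close>. Hence \<open>\<phi> (\<psi> p)\<close> stays in the face spanned by
      the support of \<open>p\<close>.\<close>
    have "p a \<noteq> 0" if nz: "\<phi> (\<psi> p) a \<noteq> 0" for a
    proof -
      obtain z where z: "z \<in> I" "\<psi> p z \<noteq> 0" "a \<in> ats z" using \<phi>_supp[OF nz] by blast
      obtain S where S: "S \<in> Pr" "J S = z" "\<forall>a\<in>S. \<forall>b\<in>A - S. p b < p a"
        using \<psi>_supp[OF z(2)] by blast
      then have "a \<in> S" "\<exists>b. b \<in> A - S" using z(3) at_J by (auto simp: Pr_def)
      then show ?thesis using S(3) R(1) by (metis less_le_not_le)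
    qed
    then show "\<exists>\<sigma>\<in>{S. S \<subset> A}. \<forall>a. (\<phi> \<circ> \<psi>) p a \<noteq> 0 \<or> id p a \<noteq> 0 \<longrightarrow> a \<in> \<sigma>"
      using R by (intro bexI[of _ "{a. p a \<noteq> 0}"]) auto
  qed simp
  ultimately show ?thesis
    unfolding homotopy_equivalent_space_def using \<phi>_cont \<psi>_cont by blast
qed

end

section \<open>Intervals whose atoms have joins\<close>

lemma homotopy_equivalent_space_empty:
  assumes "topspace X = {}" "topspace Y = {}"
  shows "X homotopy_equivalent_space Y"
  unfolding homotopy_equivalent_space_def
  using assms by (auto simp: null_topspace_iff_trivial homotopic_with)

text \<open>\<open>C\<close> stands for the elements covering \<open>u\<close>, and
  \<open>J S\<close> for the join of \<open>S\<close> among the elements above \<open>u\<close>. By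
  the last assumption a join lies above no further atom, so \<open>J\<close> embeds the Boolean
  lattice of subsets of \<open>C\<close>.\<close>

locale atom_joins = finite_poset X r for X :: "'a set" and r +
  fixes u :: 'a and C :: "'a set" and J :: "'a set \<Rightarrow> 'a"
  assumes above: "a \<in> C \<Longrightarrow> (u, a) \<in> r \<and> a \<noteq> u"
    and atomic: "(u, z) \<in> r \<Longrightarrow> z \<noteq> u \<Longrightarrow> \<exists>a\<in>C. (a, z) \<in> r"
    and J_le_iff: "S \<subseteq> C \<Longrightarrow> (u, z) \<in> r \<Longrightarrow> (J S, z) \<in> r \<longleftrightarrow> (\<forall>a\<in>S. (a, z) \<in> r)"
    and u_le_J: "S \<subseteq> C \<Longrightarrow> (u, J S) \<in> r"
    and le_J_imp: "S \<subseteq> C \<Longrightarrow> a \<in> C \<Longrightarrow> (a, J S) \<in> r \<Longrightarrow> a \<in> S"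
begin

definition atoms :: "'a \<Rightarrow> 'a set" where
  "atoms z = {a \<in> C. (a, z) \<in> r}"

lemma C_le_J: "S \<subseteq> C \<Longrightarrow> a \<in> S \<Longrightarrow> (a, J S) \<in> r"
  using J_le_iff[of S "J S"] u_le_J[of S] refl in_field by blast

lemma atoms_J: "S \<subseteq> C \<Longrightarrow> atoms (J S) = S"
  using C_le_J le_J_imp by (auto simp: atoms_def)

lemma J_atoms_le: "(u, z) \<in> r \<Longrightarrow> (J (atoms z), z) \<in> r"
  using J_le_iff[of "atoms z" z] by (auto simp: atoms_def)

lemma atoms_mono: "(x, y) \<in> r \<Longrightarrow> atoms x \<subseteq> atoms y"
  using trans by (auto simp: atoms_def)

lemma atoms_subset: "atoms z \<subseteq> C"
  by (auto simp: atoms_def)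

lemma J_mono: "S \<subseteq> T \<Longrightarrow> T \<subseteq> C \<Longrightarrow> (J S, J T) \<in> r"
  using J_le_iff[of S "J T"] u_le_J[of T] C_le_J[of T] by blast

lemma J_empty: "u \<in> X \<Longrightarrow> J {} = u"
  using J_le_iff[of "{}" u] u_le_J[of "{}"] refl antisym by auto

lemma finite_C: "finite C"
  by (rule finite_subset[OF _ fin]) (auto dest: above in_field)

lemma sum_minus_one_power_card:
  assumes "finite A" "A \<noteq> {}"
  shows "(\<Sum>S\<in>Pow A. (-1) ^ card S) = (0::int)"
proof -
  obtain a where "a \<in> A" using assms by blast
  then obtain B where A: "A = insert a B" "a \<notin> B" by (meson mk_disjoint_insert)
  then have finB: "finite B" using assms by simp
  have "(\<Sum>S\<in>insert a ` Pow B. (-1) ^ card S) = (\<Sum>S\<in>Pow B. (-1) ^ card (insert a S) :: int)"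
    by (rule sum.reindex_cong[of "insert a"]) (use A in \<open>auto simp: inj_on_def\<close>)
  also have "\<dots> = (\<Sum>S\<in>Pow B. - ((-1) ^ card S))"
  proof (rule sum.cong)
    fix S assume "S \<in> Pow B"
    then have "finite S" "a \<notin> S" using A finB by (auto intro: finite_subset)
    then show "(- 1) ^ card (insert a S) = - ((- 1) ^ card S :: int)" by simp
  qed simp
  finally show ?thesis
    unfolding A(1) Pow_insert using A finB
    by (subst sum.union_disjoint) (auto simp: sum_negf)
qed

text \<open>Only joins of atom sets contribute to the recursion. Those below \<open>v\<close> are
  the \<open>J S\<close> with \<open>S\<close> a subset of \<open>atoms v\<close>, a Boolean
  lattice, over which the alternating sum vanishes unless \<open>u = v\<close>.\<close>

lemma moebius_eq:
  assumes "(u, v) \<in> r"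
  shows "moebius r u v = (if v = J (atoms v) then (-1) ^ card (atoms v) else 0)"
  using assms
proof (induction "card {y. (u, y) \<in> r \<and> (y, v) \<in> r}" arbitrary: v rule: less_induct)
  case less
  have X: "u \<in> X" "v \<in> X" using less.prems in_field by auto
  have finI: "finite {y. (u, y) \<in> r \<and> (y, z) \<in> r}" for z
    by (rule finite_subset[OF _ fin]) (auto dest: in_field)
  show ?case
  proof (cases "u = v")
    case True
    have "(a, u) \<notin> r" if "a \<in> C" for a using above[OF that] antisym by blast
    then have "atoms v = {}" using True by (auto simp: atoms_def)
    then show ?thesis using J_empty X True by (simp add: moebius_refl)
  next
    case False
    define g where "g z = (if z = J (atoms z) then (-1) ^ card (atoms z) else (0::int))" for z
    have g: "moebius r u z = g z" if z: "(u, z) \<in> r" "(z, v) \<in> r" "z \<noteq> v" for z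
    proof -
      have "(v, z) \<notin> r" using z antisym by blast
      then have "{y. (u, y) \<in> r \<and> (y, z) \<in> r} \<subset> {y. (u, y) \<in> r \<and> (y, v) \<in> r}"
        using z less.prems refl X trans by blast
      then have "card {y. (u, y) \<in> r \<and> (y, z) \<in> r} < card {y. (u, y) \<in> r \<and> (y, v) \<in> r}"
        by (rule psubset_card_mono[OF finI])
      then show ?thesis unfolding g_def by (rule less.hyps[OF _ z(1)])
    qed
    have "Field r = X" using in_field refl by (auto simp: Field_def)
    then have "moebius r u v = - (\<Sum>z | (u, z) \<in> r \<and> (z, v) \<in> r \<and> z \<noteq> v. moebius r u z)"
      using poset by (intro moebius_rec finI less.prems False) simp
    also have "\<dots> = - (\<Sum>z | (u, z) \<in> r \<and> (z, v) \<in> r \<and> z \<noteq> v. g z)"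
      using g by simp
    also have "\<dots> = g v - (\<Sum>z | (u, z) \<in> r \<and> (z, v) \<in> r. g z)"
    proof -
      have "{z. (u, z) \<in> r \<and> (z, v) \<in> r} = insert v {z. (u, z) \<in> r \<and> (z, v) \<in> r \<and> z \<noteq> v}"
        using less.prems refl X by auto
      moreover have "finite {z. (u, z) \<in> r \<and> (z, v) \<in> r \<and> z \<noteq> v}"
        by (rule finite_subset[OF _ finI[of v]]) auto
      ultimately show ?thesis by simp
    qed
    also have "(\<Sum>z | (u, z) \<in> r \<and> (z, v) \<in> r. g z) = (\<Sum>z\<in>J ` Pow (atoms v). g z)"
    proof (rule sum.mono_neutral_right[OF finI])
      show "J ` Pow (atoms v) \<subseteq> {z. (u, z) \<in> r \<and> (z, v) \<in> r}"
      proof safe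
        fix S assume S: "S \<subseteq> atoms v"
        then have "S \<subseteq> C" using atoms_subset by blast
        then show "(u, J S) \<in> r" by (rule u_le_J)
        show "(J S, v) \<in> r" using J_le_iff[OF \<open>S \<subseteq> C\<close> less.prems] S by (auto simp: atoms_def)
      qed
      show "\<forall>z\<in>{z. (u, z) \<in> r \<and> (z, v) \<in> r} - J ` Pow (atoms v). g z = 0"
        using atoms_mono by (fastforce simp: g_def)
    qed
    also have "\<dots> = (\<Sum>S\<in>Pow (atoms v). g (J S))"
    proof (rule sum.reindex_cong[of J])
      show "inj_on J (Pow (atoms v))"
        by (rule inj_on_inverseI[of _ atoms]) (use atoms_subset in \<open>auto intro!: atoms_J\<close>)
    qed auto
    also have "\<dots> = (\<Sum>S\<in>Pow (atoms v). (-1) ^ card S)"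
    proof (rule sum.cong)
      fix S assume "S \<in> Pow (atoms v)"
      then have "S \<subseteq> C" using atoms_subset by blast
      then show "g (J S) = (-1) ^ card S" by (simp add: g_def atoms_J)
    qed simp
    also have "\<dots> = 0"
      using atomic[OF less.prems] False finite_C
      by (intro sum_minus_one_power_card) (auto simp: atoms_def)
    finally show ?thesis by (simp add: g_def)
  qed
qed

lemma open_interval_poset:
  "finite_poset {z. (u, z) \<in> r \<and> z \<noteq> u \<and> (z, v) \<in> r \<and> z \<noteq> v} (open_interval r u v)"
proof
  let ?I = "{z. (u, z) \<in> r \<and> z \<noteq> u \<and> (z, v) \<in> r \<and> z \<noteq> v}"
  have "refl_on ?I (open_interval r u v)"
    by (auto simp: refl_on_def open_interval_def dest: in_field intro: refl)
  moreover have "trans (open_interval r u v)"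
    by (auto simp: trans_def open_interval_def intro: trans)
  moreover have "antisym (open_interval r u v)"
    by (auto simp: antisym_def open_interval_def intro: antisym)
  ultimately show "partial_order_on ?I (open_interval r u v)"
    by (auto simp: partial_order_on_def preorder_on_def open_interval_def)
  show "finite ?I"
    by (rule finite_subset[OF _ fin]) (auto dest: in_field)
qed

lemma interval_homotopy_type:
  assumes uv: "(u, v) \<in> r"
  shows "if v = J (atoms v)
    then geometric_realization (order_complex (open_interval r u v)) homotopy_equivalent_space
         sphere_top (int (card (atoms v)) - 2)
    else contractible_space (geometric_realization (order_complex (open_interval r u v))) \<and>
         topspace (geometric_realization (order_complex (open_interval r u v))) \<noteq> {}"
proof -
  let ?I = "{z. (u, z) \<in> r \<and> z \<noteq> u \<and> (z, v) \<in> r \<and> z \<noteq> v}"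
  let ?A = "atoms v"
  interpret I: finite_poset ?I "open_interval r u v"
    by (rule open_interval_poset)
  have sub: "(x, y) \<in> r" if "(x, y) \<in> open_interval r u v" for x y
    using that by (auto simp: open_interval_def)
  have int: "(x, y) \<in> open_interval r u v" if "x \<in> ?I" "y \<in> ?I" "(x, y) \<in> r" for x y
    using that by (auto simp: open_interval_def)
  have finA: "finite ?A" using finite_C atoms_subset by (rule rev_finite_subset)
  have J_in: "J S \<in> ?I" if S: "S \<subseteq> ?A" "S \<noteq> {}" "J S \<noteq> v" for S
  proof -
    have SC: "S \<subseteq> C" using S atoms_subset by blast
    obtain a where a: "a \<in> S" using S by blast
    have "J S \<noteq> u"
    proof
      assume "J S = u"
      then have "(a, u) \<in> r" using C_le_J[OF SC a] by simp
      then show False using above[of a] a SC antisym by blast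
    qed
    moreover have "(J S, v) \<in> r" using J_le_iff[OF SC uv] S(1) by (auto simp: atoms_def)
    ultimately show ?thesis using u_le_J[OF SC] S(3) by blast
  qed
  have atoms_ne: "atoms z \<noteq> {}" if "(u, z) \<in> r" "z \<noteq> u" for z
    using atomic[OF that] by (auto simp: atoms_def)
  show ?thesis
  proof (cases "v = J ?A")
    case vJ: True
    have J_ne: "J S \<noteq> v" if "S \<subset> ?A" for S
    proof
      assume "J S = v"
      moreover have "S \<subseteq> C" using that atoms_subset by blast
      ultimately have "atoms v = S" using atoms_J by blast
      then show False using that by blast
    qed
    have ne: "atoms z \<subset> ?A" if "z \<in> ?I" for z
    proof -
      have "atoms z \<subseteq> ?A" using that atoms_mono by blast
      moreover have "atoms z \<noteq> ?A"
        using J_atoms_le[of z] that vJ antisym by auto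
      ultimately show ?thesis by blast
    qed
    have "I.realization homotopy_equivalent_space sphere_top (int (card ?A) - 2)"
    \<comment> \<open>With fewer than two atoms \<open>?A\<close> has no nonempty proper subset, so
      the open interval is empty and corresponds to a sphere of negative dimension.\<close>
    proof (cases "card ?A < 2")
      case True
      have "?I = {}"
      proof (rule ccontr)
        assume "?I \<noteq> {}"
        then obtain z where z: "z \<in> ?I" by blast
        then have "card (atoms z) < card ?A" using ne finA by (intro psubset_card_mono)
        moreover have "card (atoms z) \<noteq> 0"
          using atoms_ne[of z] z finite_C atoms_subset[of z] by (auto dest: finite_subset)
        ultimately show False using True by simp
      qed
      have "x \<notin> topspace I.realization" for x
      proof
        assume "x \<in> topspace I.realization"
        then have "sum x ?I = 1" unfolding I.in_realization_iff by blast
        then show False unfolding \<open>?I = {}\<close> by simp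
      qed
      then have "topspace I.realization = {}" by blast
      moreover have "topspace (sphere_top (int (card ?A) - 2)) = {}"
        using True by (simp add: sphere_top_def)
      ultimately show ?thesis by (rule homotopy_equivalent_space_empty)
    next
      case False
      have "I.realization homotopy_equivalent_space geometric_realization {S. S \<subset> ?A}"
      proof (rule I.crosscut_equivalence[of ?A atoms J])
        show "atoms x \<noteq> {} \<and> atoms x \<subset> ?A" if "x \<in> ?I" for x
          using atoms_ne[of x] ne that by blast
        show "atoms x \<subseteq> atoms y" if "(x, y) \<in> open_interval r u v" for x y
          using sub[OF that] by (rule atoms_mono)
        show "(J S, J T) \<in> open_interval r u v" if "S \<noteq> {}" "S \<subseteq> T" "T \<subset> ?A" for S T
        proof (rule int)
          show "J S \<in> ?I" "J T \<in> ?I" by (rule J_in; use that J_ne in blast)+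
          show "(J S, J T) \<in> r" using that atoms_subset by (intro J_mono) auto
        qed
        show "atoms (J S) = S" if "S \<noteq> {}" "S \<subset> ?A" for S
          using that atoms_subset by (intro atoms_J) auto
        show "(J (atoms x), x) \<in> open_interval r u v" if x: "x \<in> ?I" for x
        proof (rule int)
          show "J (atoms x) \<in> ?I"
            using ne[OF x] J_ne atoms_ne[of x] x by (intro J_in) auto
          show "(J (atoms x), x) \<in> r" using x by (auto intro: J_atoms_le)
        qed (rule x)
      qed (rule finA)
      also have "geometric_realization {S. S \<subset> ?A} homotopy_equivalent_space nsphere (card ?A - 2)"
        using False by (intro homeomorphic_imp_homotopy_equivalent_space simplex_boundary_homeomorphic_nsphere) simp
      also have "nsphere (card ?A - 2) = sphere_top (int (card ?A) - 2)"
        using False by (simp add: sphere_top_def nat_diff_distrib)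
      finally show ?thesis .
    qed
    then show ?thesis using vJ by simp
  next
    case False
    have "u \<noteq> v"
    proof
      assume "u = v"
      then have "?A = {}" using above antisym by (auto simp: atoms_def)
      then show False using False \<open>u = v\<close> J_empty uv in_field by auto
    qed
    then have ne: "?A \<noteq> {}" using atoms_ne[OF uv] by blast
    have Jin: "J (atoms x) \<in> ?I" if x: "x \<in> ?I" for x
    proof -
      have "J (atoms x) \<noteq> v"
        using J_atoms_le[of x] x antisym by auto
      then show ?thesis using x atoms_ne[of x] atoms_mono by (intro J_in) auto
    qed
    have "J ?A \<in> ?I" using ne False by (intro J_in) auto
    moreover have "(J (atoms x), J (atoms y)) \<in> open_interval r u v"
      if "(x, y) \<in> open_interval r u v" for x y
      using that sub[OF that] I.in_field[OF that] atoms_mono atoms_subset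
      by (intro int Jin J_mono) auto
    moreover have "(J (atoms x), x) \<in> open_interval r u v" if "x \<in> ?I" for x
      using that by (intro int Jin J_atoms_le) auto
    moreover have "(J (atoms x), J ?A) \<in> open_interval r u v" if "x \<in> ?I" for x
      using that atoms_mono atoms_subset by (intro int Jin J_mono \<open>J ?A \<in> ?I\<close>) auto
    ultimately have "contractible_space I.realization" "topspace I.realization \<noteq> {}"
      using I.contractible_realization[of "\<lambda>x. J (atoms x)" "J ?A"] by blast+
    then show ?thesis using False by simp
  qed
qed

end

section \<open>Length and Bruhat order\<close>

declare One_nat_def [simp del]

abbreviation tp :: "'a \<Rightarrow> 'a \<Rightarrow> 'a \<Rightarrow> 'a" where "tp \<equiv> Transposition.transpose"

lemmas tp_def = Transposition.transpose_def

definition inversions :: "nat \<Rightarrow> (nat \<Rightarrow> nat) \<Rightarrow> (nat \<times> nat) set" where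
  "inversions n x = {(i, j). 1 \<le> i \<and> i < j \<and> j \<le> n \<and> x j < x i}"

lemma finite_inversions [simp]: "finite (inversions n x)"
  by (rule finite_subset[of _ "{1..n} \<times> {1..n}"]) (auto simp: inversions_def)

lemma permutes_inj_eq: "x permutes S \<Longrightarrow> x i = x j \<longleftrightarrow> i = j"
  using permutes_inj by (auto dest: injD)

lemma permutes_tp: "1 \<le> i \<Longrightarrow> i \<le> n \<Longrightarrow> 1 \<le> j \<Longrightarrow> j \<le> n \<Longrightarrow> tp i j permutes {1..n}"
  by (rule permutes_swap_id) auto

lemma permutes_comp_tp:
  "x permutes {1..n} \<Longrightarrow> 1 \<le> i \<Longrightarrow> i \<le> n \<Longrightarrow> 1 \<le> j \<Longrightarrow> j \<le> n \<Longrightarrow> x \<circ> tp i j permutes {1..n}"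
  by (rule permutes_compose[OF permutes_tp])

text \<open>The transposition carries an inversion of \<open>x\<close> to one of
  \<open>x \<circ> tp i j\<close> unless it reverses the order of the two positions; such pairs stay
  where they are. This injection \<open>\<phi>\<close> misses \<open>(i, j)\<close>, and nothing
  else when no intermediate position carries an intermediate value.\<close>

lemma card_inversions_comp_tp:
  assumes x: "x permutes {1..n}" and ij: "1 \<le> i" "i < j" "j \<le> n" "x i < x j"
  shows "card (inversions n x) < card (inversions n (x \<circ> tp i j))"
    and "(\<And>l. i < l \<Longrightarrow> l < j \<Longrightarrow> \<not> (x i < x l \<and> x l < x j)) \<Longrightarrow>
      card (inversions n (x \<circ> tp i j)) = Suc (card (inversions n x))"
proof -
  let ?t = "tp i j" and ?y = "x \<circ> tp i j"
  define \<phi> where "\<phi> = (\<lambda>(c, d). if ?t c < ?t d then (?t c, ?t d) else (c, d))"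
  have range: "1 \<le> ?t c \<and> ?t c \<le> n \<longleftrightarrow> 1 \<le> c \<and> c \<le> n" for c
    using ij by (auto simp: tp_def)
  have rev: "(c, d) = (i, j) \<or> (c = i \<and> i < d \<and> d < j) \<or> (d = j \<and> i < c \<and> c < j)"
    if "c < d" "\<not> ?t c < ?t d" for c d
    using that ij by (auto simp: tp_def split: if_splits)
  have tij: "?t i = j" "?t j = i" and tl: "\<And>l. l \<noteq> i \<Longrightarrow> l \<noteq> j \<Longrightarrow> ?t l = l"
    by (auto simp: tp_def)
  have inj: "inj_on \<phi> (inversions n x)"
    by (rule inj_onI)
      (auto simp: \<phi>_def inversions_def split: if_splits, auto simp: tp_def split: if_splits)
  have sub: "insert (i, j) (\<phi> ` inversions n x) \<subseteq> inversions n ?y"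
  proof -
    have "\<phi> (c, d) \<in> inversions n ?y" if cd: "(c, d) \<in> inversions n x" for c d
    proof (cases "?t c < ?t d")
      case True
      then show ?thesis using cd range[of c] range[of d] by (auto simp: \<phi>_def inversions_def)
    next
      case False
      then show ?thesis using cd rev[of c d] ij by (auto simp: \<phi>_def inversions_def tij tl)
    qed
    then have "\<phi> ` inversions n x \<subseteq> inversions n ?y"
      by (intro image_subsetI) (metis surj_pair)
    moreover have "(i, j) \<in> inversions n ?y" using ij by (simp add: inversions_def tij)
    ultimately show ?thesis by blast
  qed
  have nin: "(i, j) \<notin> \<phi> ` inversions n x"
  proof
    assume "(i, j) \<in> \<phi> ` inversions n x"
    then obtain c d where cd: "(c, d) \<in> inversions n x" "\<phi> (c, d) = (i, j)" by auto
    show False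
    proof (cases "?t c < ?t d")
      case True
      then have "?t c = i" "?t d = j" using cd by (auto simp: \<phi>_def)
      then have "c = j" "d = i" by (metis transpose_involutory tij)+
      then show False using cd ij by (auto simp: inversions_def)
    next
      case False
      then show False using cd ij by (auto simp: \<phi>_def inversions_def)
    qed
  qed
  have card: "card (insert (i, j) (\<phi> ` inversions n x)) = Suc (card (inversions n x))"
    using nin card_image[OF inj] by simp
  show "card (inversions n x) < card (inversions n ?y)"
    using card_mono[OF finite_inversions sub] card by simp
  assume between: "\<And>l. i < l \<Longrightarrow> l < j \<Longrightarrow> \<not> (x i < x l \<and> x l < x j)"
  have "inversions n ?y \<subseteq> insert (i, j) (\<phi> ` inversions n x)"
  proof
    fix p assume "p \<in> inversions n ?y"
    then obtain c d where p: "p = (c, d)" and cd: "(c, d) \<in> inversions n ?y" by (cases p) auto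
    show "p \<in> insert (i, j) (\<phi> ` inversions n x)"
    proof (cases "?t c < ?t d")
      case True
      then have "(?t c, ?t d) \<in> inversions n x"
        using cd range[of c] range[of d] by (auto simp: inversions_def)
      moreover have "\<phi> (?t c, ?t d) = (c, d)" using cd by (auto simp: \<phi>_def inversions_def)
      ultimately show ?thesis unfolding p by (metis imageI insertI2)
    next
      case False
      have "p = (i, j) \<or> (c, d) \<in> inversions n x"
      proof -
        have "c < d" using cd by (auto simp: inversions_def)
        then consider "p = (i, j)" | "c = i" "i < d" "d < j" | "d = j" "i < c" "c < j"
          using rev[OF _ False] p by blast
        then show ?thesis
        proof cases
          case 2
          then have "x d < x j" using cd by (simp add: inversions_def tij tl)
          moreover have "x d \<noteq> x i" using permutes_inj_eq[OF x] 2 by auto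
          ultimately have "x d < x i" using between[of d] 2 by simp
          then show ?thesis using cd 2 by (simp add: inversions_def)
        next
          case 3
          then have "x i < x c" using cd by (simp add: inversions_def tij tl)
          moreover have "x c \<noteq> x j" using permutes_inj_eq[OF x] 3 by auto
          ultimately have "x j < x c" using between[of c] 3 by simp
          then show ?thesis using cd 3 by (simp add: inversions_def)
        qed simp
      qed
      moreover have "\<phi> (c, d) = p" using False by (simp add: \<phi>_def p)
      ultimately show ?thesis by (metis imageI insertCI)
    qed
  qed
  then show "card (inversions n ?y) = Suc (card (inversions n x))"
    using card sub by (metis subset_antisym)
qed

lemma permutes_no_descent_id:
  assumes x: "x permutes {1..n}" and asc: "\<And>i. 1 \<le> i \<Longrightarrow> i < n \<Longrightarrow> x i < x (Suc i)"
  shows "x = id"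
proof (rule permutes_natset_ge[OF x], rule ballI)
  fix i assume "i \<in> {1..n}"
  then have "1 \<le> i" "i \<le> n" by auto
  then show "i \<le> x i"
  proof (induction i rule: dec_induct)
    case base
    then show ?case using permutes_in_image[OF x, of 1] by auto
  next
    case (step m)
    then show ?case using asc[of m] by auto
  qed
qed

lemma ex_descent:
  assumes x: "x permutes {1..n}" and "x \<noteq> id"
  obtains i where "1 \<le> i" "i < n" "x (Suc i) < x i"
proof -
  obtain i where "1 \<le> i" "i < n" "\<not> x i < x (Suc i)" using permutes_no_descent_id[OF x] assms(2) by blast
  then show ?thesis using that[of i] permutes_inj_eq[OF x, of i "Suc i"] by (auto simp: not_less le_less)
qed

lemma card_inversions_comp_simple:
  assumes x: "x permutes {1..n}" and i: "1 \<le> i" "i < n"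
  shows "x i < x (Suc i) \<Longrightarrow> card (inversions n (x \<circ> tp i (Suc i))) = Suc (card (inversions n x))"
    and "x (Suc i) < x i \<Longrightarrow> card (inversions n x) = Suc (card (inversions n (x \<circ> tp i (Suc i))))"
proof -
  show "x i < x (Suc i) \<Longrightarrow> card (inversions n (x \<circ> tp i (Suc i))) = Suc (card (inversions n x))"
    using i by (intro card_inversions_comp_tp(2) x) auto
  assume "x (Suc i) < x i"
  then have "card (inversions n ((x \<circ> tp i (Suc i)) \<circ> tp i (Suc i))) = Suc (card (inversions n (x \<circ> tp i (Suc i))))"
    using i by (intro card_inversions_comp_tp(2) permutes_comp_tp x) auto
  then show "card (inversions n x) = Suc (card (inversions n (x \<circ> tp i (Suc i))))"
    by (simp add: comp_assoc)
qed

lemma foldr_comp_append: "foldr (\<circ>) (ss @ [s]) id = foldr (\<circ>) ss id \<circ> s"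
proof -
  have "foldr (\<circ>) ss f = foldr (\<circ>) ss id \<circ> f" for f :: "'a \<Rightarrow> 'a"
  proof (induction ss)
    case (Cons a ss)
    have "foldr (\<circ>) (a # ss) g = a \<circ> foldr (\<circ>) ss g" for g :: "'a \<Rightarrow> 'a" by simp
    then show ?case using Cons.IH by (metis comp_assoc)
  qed simp
  from this[of s] show ?thesis by simp
qed

lemma ex_word:
  assumes "x permutes {1..n}"
  shows "\<exists>ss. length ss = card (inversions n x) \<and> set ss \<subseteq> simple_reflections n \<and> foldr (\<circ>) ss id = x"
  using assms
proof (induction "card (inversions n x)" arbitrary: x)
  case 0
  have "x = id"
  proof (rule ccontr)
    assume "x \<noteq> id"
    then obtain i where "1 \<le> i" "i < n" "x (Suc i) < x i" using ex_descent[OF 0(2)] by blast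
    then have "(i, Suc i) \<in> inversions n x" by (simp add: inversions_def)
    then show False using 0(1) by simp
  qed
  then show ?case using 0 by (intro exI[of _ "[]"]) auto
next
  case (Suc k)
  have "inversions n id = {}" by (auto simp: inversions_def)
  then have "x \<noteq> id" using Suc(2) by auto
  then obtain i where i: "1 \<le> i" "i < n" "x (Suc i) < x i" using ex_descent[OF Suc.prems] by blast
  let ?y = "x \<circ> tp i (Suc i)"
  have y: "?y permutes {1..n}" using i Suc.prems by (intro permutes_comp_tp) auto
  moreover have "k = card (inversions n ?y)"
    using card_inversions_comp_simple(2)[OF Suc.prems i] Suc(2) by simp
  ultimately obtain ss where ss: "length ss = k" "set ss \<subseteq> simple_reflections n" "foldr (\<circ>) ss id = ?y"
    using Suc(1)[of ?y] by blast
  have "foldr (\<circ>) (ss @ [tp i (Suc i)]) id = x"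
    unfolding foldr_comp_append ss(3) by (simp add: comp_assoc)
  moreover have "tp i (Suc i) \<in> simple_reflections n" using i by (auto simp: simple_reflections_def)
  ultimately show ?case using ss Suc(2) by (intro exI[of _ "ss @ [tp i (Suc i)]"]) auto
qed

lemma card_inversions_word:
  assumes "set ss \<subseteq> simple_reflections n"
  shows "foldr (\<circ>) ss id permutes {1..n} \<and> card (inversions n (foldr (\<circ>) ss id)) \<le> length ss"
  using assms
proof (induction ss rule: rev_induct)
  case Nil
  have fold: "foldr (\<circ>) [] id = (id :: nat \<Rightarrow> nat)" by simp
  have inv: "inversions n id = {}" by (auto simp: inversions_def)
  show ?case unfolding fold inv by (rule conjI, rule permutes_id, simp)
next
  case (snoc s ss)
  let ?x = "foldr (\<circ>) ss id"
  note fold = foldr_comp_append[of ss s]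
  obtain i where i: "1 \<le> i" "i < n" "s = tp i (Suc i)" using snoc.prems by (auto simp: simple_reflections_def)
  have x: "?x permutes {1..n}" and le: "card (inversions n ?x) \<le> length ss"
    using snoc.IH snoc.prems by (simp_all only: set_append Un_subset_iff)
  have "card (inversions n (?x \<circ> s)) \<le> Suc (card (inversions n ?x))"
    using card_inversions_comp_simple[OF x i(1,2)] permutes_inj_eq[OF x, of i "Suc i"] unfolding i(3)
    by (cases "?x i" "?x (Suc i)" rule: linorder_cases) auto
  moreover have "?x \<circ> s permutes {1..n}" using x i by (auto intro!: permutes_comp_tp)
  moreover have "length (ss @ [s]) = Suc (length ss)" by simp
  ultimately show ?case using le unfolding fold by linarith
qed

lemma coxeter_length_eq:
  assumes "x permutes {1..n}"
  shows "coxeter_length n x = card (inversions n x)"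
  unfolding coxeter_length_def
proof (rule Least_equality)
  show "\<exists>ss. length ss = card (inversions n x) \<and> set ss \<subseteq> simple_reflections n \<and> foldr (\<circ>) ss id = x"
    by (rule ex_word[OF assms])
qed (use card_inversions_word in blast)

lemma comp_tp_inv:
  assumes "x permutes S"
  shows "x \<circ> tp i j \<circ> inv x = tp (x i) (x j)"
proof
  fix k
  obtain l where l: "k = x l" using permutes_surj[OF assms] by blast
  have "inv x k = l" using l by (simp add: permutes_inverses[OF assms])
  then show "(x \<circ> tp i j \<circ> inv x) k = tp (x i) (x j) k"
    using l permutes_inj_eq[OF assms] by (auto simp: tp_def)
qed

lemma reflections_eq: "reflections n = {tp i j | i j. 1 \<le> i \<and> i < j \<and> j \<le> n}"
proof safe
  fix t assume "t \<in> reflections n"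
  then obtain x k where x: "x permutes {1..n}" and k: "1 \<le> k" "k < n" and t: "t = tp (x k) (x (Suc k))"
    by (auto simp: reflections_def simple_reflections_def comp_tp_inv)
  have r: "x k \<in> {1..n}" "x (Suc k) \<in> {1..n}" "x k \<noteq> x (Suc k)"
    using k permutes_in_image[OF x] permutes_inj_eq[OF x] by auto
  show "\<exists>i j. t = tp i j \<and> 1 \<le> i \<and> i < j \<and> j \<le> n"
  proof (cases "x k < x (Suc k)")
    case True
    then show ?thesis using r t by auto
  next
    case False
    then have "x (Suc k) < x k" using r by linarith
    then show ?thesis using r t by (intro exI[of _ "x (Suc k)"] exI[of _ "x k"]) (auto simp: transpose_commute)
  qed
next
  fix i j assume ij: "1 \<le> i" "i < j" "j \<le> n"
  \<comment> \<open>This conjugator fixes \<open>i\<close> and sends \<open>Suc i\<close> to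
    \<open>j\<close>; it is the identity when \<open>j = Suc i\<close>.\<close>
  let ?x = "tp (Suc i) j"
  have x: "?x permutes {1..n}" using ij by (intro permutes_tp) auto
  have "?x i = i" "?x (Suc i) = j" using ij by (auto simp: tp_def)
  then have "tp i j = ?x \<circ> tp i (Suc i) \<circ> inv ?x" using comp_tp_inv[OF x, of i "Suc i"] by metis
  moreover have "tp i (Suc i) \<in> simple_reflections n" using ij by (auto simp: simple_reflections_def)
  ultimately show "tp i j \<in> reflections n" using x unfolding reflections_def by blast
qed

section \<open>Bruhat order by exchanges of positions\<close>

definition step :: "nat \<Rightarrow> (nat \<Rightarrow> nat) \<Rightarrow> (nat \<Rightarrow> nat) \<Rightarrow> bool" where
  "step n x y \<longleftrightarrow> (\<exists>i j. 1 \<le> i \<and> i < j \<and> j \<le> n \<and> x i < x j \<and> y = x \<circ> tp i j)"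

lemma step_permutes: "step n x y \<Longrightarrow> x permutes {1..n} \<Longrightarrow> y permutes {1..n}"
  by (auto simp: step_def intro!: permutes_comp_tp)

lemma step_card_inversions: "step n x y \<Longrightarrow> x permutes {1..n} \<Longrightarrow> card (inversions n x) < card (inversions n y)"
  by (auto simp: step_def intro: card_inversions_comp_tp)

lemma bruhat_step_eq:
  assumes x: "x permutes {1..n}" shows "bruhat_step n x y \<longleftrightarrow> step n x y"
proof
  assume "bruhat_step n x y"
  then obtain i j where ij: "1 \<le> i" "i < j" "j \<le> n" and y: "y = x \<circ> tp i j"
    and l: "coxeter_length n x < coxeter_length n y"
    by (auto simp: bruhat_step_def reflections_eq)
  have yp: "y permutes {1..n}" using ij x y by (auto intro!: permutes_comp_tp)
  have "\<not> x j < x i"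
  proof
    assume "x j < x i"
    then have "card (inversions n y) < card (inversions n (y \<circ> tp i j))"
      using ij yp y by (intro card_inversions_comp_tp) auto
    then show False using l x yp y by (simp add: coxeter_length_eq comp_assoc)
  qed
  then have "x i < x j" using permutes_inj_eq[OF x, of i j] ij by linarith
  then show "step n x y" using ij y by (auto simp: step_def)
next
  assume s: "step n x y"
  then have "coxeter_length n x < coxeter_length n y"
    using x step_permutes[OF s x] step_card_inversions[OF s x] by (simp add: coxeter_length_eq)
  then show "bruhat_step n x y" using s by (auto simp: bruhat_step_def step_def reflections_eq)
qed

text \<open>Conjugation by \<open>x\<close> turns the exchange of positions \<open>i\<close>,
  \<open>j\<close> into that of the values \<open>x i\<close>, \<open>x j\<close>. Invariance of
  Bruhat order under inversion lets the proof work with the coordinates \<open>inv z\<close> instead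
  of \<open>z\<close>.\<close>

lemma step_inv:
  assumes x: "x permutes {1..n}" and s: "step n x y" shows "step n (inv x) (inv y)"
proof -
  obtain i j where ij: "1 \<le> i" "i < j" "j \<le> n" "x i < x j" and y: "y = x \<circ> tp i j"
    using s by (auto simp: step_def)
  have t: "tp i j permutes {1..n}" using ij by (intro permutes_tp) auto
  have "inv y = inv (tp i j) \<circ> inv x"
    using y permutes_bij[OF x] permutes_bij[OF t] by (simp add: o_inv_distrib)
  also have "\<dots> = inv x \<circ> (x \<circ> tp i j \<circ> inv x)"
    using permutes_inv_o(2)[OF x] by (simp add: flip: comp_assoc)
  also have "\<dots> = inv x \<circ> tp (x i) (x j)" by (simp add: comp_tp_inv[OF x])
  finally have "inv y = inv x \<circ> tp (x i) (x j)" .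
  moreover have "1 \<le> x i" "x j \<le> n"
    using ij permutes_in_image[OF x, of i] permutes_in_image[OF x, of j] by auto
  moreover have "inv x (x i) = i" "inv x (x j) = j" by (simp_all add: permutes_inverses[OF x])
  ultimately show ?thesis
    unfolding step_def using ij by (intro exI[of _ "x i"] exI[of _ "x j"] conjI) simp_all
qed

definition le :: "nat \<Rightarrow> (nat \<Rightarrow> nat) \<Rightarrow> (nat \<Rightarrow> nat) \<Rightarrow> bool" where
  "le n x y \<longleftrightarrow> x permutes {1..n} \<and> y permutes {1..n} \<and> (step n)\<^sup>*\<^sup>* x y"

lemma le_refl: "x permutes {1..n} \<Longrightarrow> le n x x"
  by (simp add: le_def)

lemma le_trans: "le n x y \<Longrightarrow> le n y z \<Longrightarrow> le n x z"
  by (auto simp: le_def)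

lemma step_le: "step n x y \<Longrightarrow> x permutes {1..n} \<Longrightarrow> le n x y"
  by (auto simp: le_def intro: step_permutes)

lemma le_card_inversions: 
  assumes "le n x y" shows "x = y \<or> card (inversions n x) < card (inversions n y)"
proof -
  have "(step n)\<^sup>*\<^sup>* x y" "x permutes {1..n}" using assms by (auto simp: le_def)
  then have "y permutes {1..n} \<and> (x = y \<or> card (inversions n x) < card (inversions n y))"
    by (induction rule: rtranclp_induct) (auto dest: step_permutes step_card_inversions)
  then show ?thesis by blast
qed

lemma le_antisym: "le n x y \<Longrightarrow> le n y x \<Longrightarrow> x = y"
  using le_card_inversions[of n x y] le_card_inversions[of n y x] by auto

lemma le_induct [consumes 1, case_names refl step]:
  assumes "le n x y" "P y"
    and "\<And>x z. step n x z \<Longrightarrow> x permutes {1..n} \<Longrightarrow> le n z y \<Longrightarrow> P z \<Longrightarrow> P x"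
  shows "P x"
proof -
  have "(step n)\<^sup>*\<^sup>* x y" "x permutes {1..n}" "y permutes {1..n}" using assms(1) by (auto simp: le_def)
  then show ?thesis
  proof (induction rule: converse_rtranclp_induct)
    case (step x z)
    then have "z permutes {1..n}" by (blast intro: step_permutes)
    then show ?case using step assms(3)[of x z] by (auto simp: le_def)
  qed (rule assms(2))
qed

lemma bruhat_le_eq: "bruhat_le n x y \<longleftrightarrow> le n x y"
proof -
  have "(bruhat_step n)\<^sup>*\<^sup>* x y \<and> x permutes {1..n} \<longleftrightarrow> (step n)\<^sup>*\<^sup>* x y \<and> x permutes {1..n}"
  proof safe
    assume "(bruhat_step n)\<^sup>*\<^sup>* x y" "x permutes {1..n}"
    then have "(step n)\<^sup>*\<^sup>* x y \<and> y permutes {1..n}"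
      by (induction rule: rtranclp_induct) (auto simp: bruhat_step_eq dest: step_permutes intro: rtranclp.rtrancl_into_rtrancl)
    then show "(step n)\<^sup>*\<^sup>* x y" by simp
  next
    assume "(step n)\<^sup>*\<^sup>* x y" "x permutes {1..n}"
    then have "(bruhat_step n)\<^sup>*\<^sup>* x y \<and> y permutes {1..n}"
      by (induction rule: rtranclp_induct)
        (auto simp: bruhat_step_eq dest: step_permutes intro: rtranclp.rtrancl_into_rtrancl)
    then show "(bruhat_step n)\<^sup>*\<^sup>* x y" by simp
  qed
  then show ?thesis by (auto simp: bruhat_le_def le_def)
qed

lemma le_inv: assumes "le n x y" shows "le n (inv x) (inv y)"
  using assms
proof (induction rule: le_induct)
  case refl
  then show ?case using assms by (auto simp: le_def permutes_inv)
next
  case (step x z)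
  then show ?case using step_inv step_le permutes_inv le_trans by metis
qed

lemma bruhat_le_inv: "x permutes {1..n} \<Longrightarrow> y permutes {1..n} \<Longrightarrow> bruhat_le n x y \<longleftrightarrow> le n (inv x) (inv y)"
  using le_inv[of n x y] le_inv[of n "inv x" "inv y"] by (auto simp: bruhat_le_eq permutes_inv_inv)

section \<open>Minimizing linear functionals over a lower Bruhat interval\<close>

lemma permutes_range: "x permutes {1..n} \<Longrightarrow> 1 \<le> i \<Longrightarrow> i \<le> n \<Longrightarrow> 1 \<le> x i \<and> x i \<le> n"
  using permutes_in_image[of x "{1..n}" i] by auto

lemma inv_range: "x permutes {1..n} \<Longrightarrow> 1 \<le> i \<Longrightarrow> i \<le> n \<Longrightarrow> 1 \<le> inv x i \<and> inv x i \<le> n"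
  by (rule permutes_range[OF permutes_inv])

lemma tp_values_comp:
  assumes "x permutes S" shows "tp (x i) (x j) \<circ> x = x \<circ> tp i j"
  using permutes_inj_eq[OF assms] by (auto simp: fun_eq_iff tp_def)

text \<open>Exchanging the values \<open>k\<close> and \<open>Suc k\<close> preserves the order of
  every other pair of values, so an upward step survives unless it is this very exchange.\<close>

lemma step_tp_values:
  assumes s: "step n x y"
  shows "step n (tp k (Suc k) \<circ> x) (tp k (Suc k) \<circ> y) \<or> y = tp k (Suc k) \<circ> x \<or> \<not> x permutes {1..n}"
proof -
  obtain i j where ij: "1 \<le> i" "i < j" "j \<le> n" "x i < x j" and y: "y = x \<circ> tp i j"
    using s by (auto simp: step_def)
  show ?thesis
  proof (cases "x i = k \<and> x j = Suc k")
    case True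
    then show ?thesis using y tp_values_comp[of x "{1..n}" i j] by auto
  next
    case False
    then have "tp k (Suc k) (x i) < tp k (Suc k) (x j)"
      using ij by (auto simp: tp_def)
    then show ?thesis using ij y unfolding step_def by (auto simp: comp_assoc)
  qed
qed

lemma lower_set_lifting:
  assumes W: "W permutes {1..n}" and k: "1 \<le> k" "k < n" "inv W k < inv W (Suc k)"
  defines "s \<equiv> tp k (Suc k)"
  shows "le n W (s \<circ> W)"
    and "le n y (s \<circ> W) \<longleftrightarrow> (\<exists>y0. le n y0 W \<and> (y = y0 \<or> y = s \<circ> y0))"
proof -
  have s: "s permutes {1..n}" using k by (auto simp: s_def intro!: permutes_tp)
  have ss: "s \<circ> (s \<circ> x) = x" for x :: "nat \<Rightarrow> nat" by (auto simp: s_def)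
  have sperm: "x permutes {1..n} \<Longrightarrow> s \<circ> x permutes {1..n}" for x by (rule permutes_compose[OF _ s])
  have lift: "step n (s \<circ> x) (s \<circ> z) \<or> z = s \<circ> x" if "step n x z" "x permutes {1..n}" for x z
    using step_tp_values[OF that(1), of k] that(2) by (auto simp: s_def)
  show W1: "le n W (s \<circ> W)"
  proof -
    have "1 \<le> inv W k" "inv W (Suc k) \<le> n"
      using k inv_range[OF W, of k] inv_range[OF W, of "Suc k"] by auto
    moreover have "W (inv W k) = k" "W (inv W (Suc k)) = Suc k" by (simp_all add: permutes_inverses[OF W])
    moreover from this have "s \<circ> W = W \<circ> tp (inv W k) (inv W (Suc k))"
      using tp_values_comp[OF W, of "inv W k" "inv W (Suc k)"] by (simp add: s_def)
    ultimately have "step n W (s \<circ> W)"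
      unfolding step_def using k by (intro exI[of _ "inv W k"] exI[of _ "inv W (Suc k)"]) simp
    then show ?thesis using W by (rule step_le)
  qed
  have up: "le n (s \<circ> x) (s \<circ> W)" if "le n x W" for x
    using that
  proof (induction rule: le_induct)
    case refl
    then show ?case using W by (intro le_refl sperm)
  next
    case (step x z)
    then show ?case
      using lift[of x z] le_trans[OF _ W1] step_le[of n "s \<circ> x" "s \<circ> z"] sperm[of x] le_trans by metis
  qed
  have down: "le n x W \<or> le n (s \<circ> x) W" if "le n x (s \<circ> W)" for x
    using that
  proof (induction rule: le_induct)
    case refl
    then show ?case unfolding ss using le_refl[OF W] by blast
  next
    case (step x z)
    from step.IH show ?case
    proof
      assume "le n z W" then show ?thesis using step_le[OF step(1,2)] le_trans by blast
    next
      assume "le n (s \<circ> z) W"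
      then show ?thesis
        using lift[OF step(1,2)] step_le[OF _ sperm[OF step(2)]] le_trans ss by metis
    qed
  qed
  show "le n y (s \<circ> W) \<longleftrightarrow> (\<exists>y0. le n y0 W \<and> (y = y0 \<or> y = s \<circ> y0))"
    using up down le_trans[OF _ W1] ss by metis
qed

text \<open>Permutations play two roles below: \<open>x\<close>, \<open>y\<close>, \<open>z\<close> are points of \<open>\<real>\<^sup>n\<close>, and \<open>g\<close>, \<open>h\<close> stand for the
  chambers of the braid fan, \<open>g\<close> for the one of all functionals \<open>c\<close> with \<open>c i > c j\<close> whenever
  \<open>g i < g j\<close>. Maximizing all counts \<open>cnt n z g q m\<close> simultaneously means minimizing each
  \<open>c\<close> in the chamber of \<open>g\<close>, by summation by parts.\<close>

definition cnt :: "nat \<Rightarrow> (nat \<Rightarrow> nat) \<Rightarrow> (nat \<Rightarrow> nat) \<Rightarrow> nat \<Rightarrow> nat \<Rightarrow> nat" where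
  "cnt n x g q m = card {i \<in> {1..n}. x i \<le> q \<and> g i \<le> m}"

lemma cnt_value:
  assumes x: "x permutes {1..n}" and a: "a \<in> {1..n}"
  shows "cnt n x g (x a) m = cnt n x g (x a - 1) m + (if g a \<le> m then 1 else 0)"
proof -
  have xa: "x a \<ge> 1" using permutes_in_image[OF x, of a] a by auto
  have "{i \<in> {1..n}. x i \<le> x a \<and> g i \<le> m} =
      {i \<in> {1..n}. x i \<le> x a - 1 \<and> g i \<le> m} \<union> (if g a \<le> m then {a} else {})"
  proof (intro set_eqI)
    fix i
    have "x i \<le> x a \<longleftrightarrow> x i \<le> x a - 1 \<or> i = a"
      using permutes_inj_eq[OF x, of i a] xa by auto
    then show "i \<in> {i \<in> {1..n}. x i \<le> x a \<and> g i \<le> m} \<longleftrightarrow>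
      i \<in> {i \<in> {1..n}. x i \<le> x a - 1 \<and> g i \<le> m} \<union> (if g a \<le> m then {a} else {})"
      using a by auto
  qed
  moreover have "a \<notin> {i \<in> {1..n}. x i \<le> x a - 1 \<and> g i \<le> m}" using xa by auto
  ultimately show ?thesis by (cases "g a \<le> m") (simp_all add: cnt_def)
qed

lemma cnt_commute: "cnt n x g q m = cnt n g x m q"
  by (auto simp: cnt_def intro: arg_cong[of _ _ card])

lemma cnt_position:
  assumes "g permutes {1..n}" "a \<in> {1..n}"
  shows "cnt n x g q (g a) = cnt n x g q (g a - 1) + (if x a \<le> q then 1 else 0)"
  using cnt_value[OF assms, of x q] by (simp add: cnt_commute)

lemma cnt_mono: "q \<le> q' \<Longrightarrow> cnt n x g q m \<le> cnt n x g q' m"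
  unfolding cnt_def by (intro card_mono) auto

lemma cnt_Suc:
  assumes x: "x permutes {1..n}" shows "cnt n x g (Suc q) m \<le> Suc (cnt n x g q m)"
proof (cases "Suc q \<le> n")
  case True
  then have "inv x (Suc q) \<in> {1..n}" using inv_range[OF x, of "Suc q"] by auto
  then show ?thesis using cnt_value[OF x, of "inv x (Suc q)" g m] by (simp add: permutes_inverses[OF x])
next
  case False
  have "x i \<le> q" if "i \<in> {1..n}" for i using permutes_in_image[OF x, of i] that False by auto
  then have "{i \<in> {1..n}. x i \<le> Suc q \<and> g i \<le> m} = {i \<in> {1..n}. x i \<le> q \<and> g i \<le> m}" by (auto simp: le_Suc_eq)
  then show ?thesis by (simp add: cnt_def)
qed

lemma permutes_eqI: "x permutes S \<Longrightarrow> y permutes S \<Longrightarrow> (\<And>i. i \<in> S \<Longrightarrow> x i = y i) \<Longrightarrow> x = y"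
  by (rule ext) (metis permutes_not_in)

definition optimal :: "nat \<Rightarrow> (nat \<Rightarrow> nat) \<Rightarrow> (nat \<Rightarrow> nat) \<Rightarrow> (nat \<Rightarrow> nat) \<Rightarrow> bool" where
  "optimal n W g z \<longleftrightarrow> le n z W \<and> (\<forall>y. le n y W \<longrightarrow> (\<forall>q m. cnt n y g q m \<le> cnt n z g q m))"

text \<open>Induction on \<open>W\<close>: since \<open>[id, sW] = [id, W] \<union> s[id, W]\<close>, an optimal element for \<open>sW\<close> is obtained
  from one for \<open>W\<close> by putting the smaller of the two values exchanged by \<open>s\<close> on the position that
  comes first for \<open>g\<close>.\<close>

lemma ex_optimal:
  assumes g: "g permutes {1..n}" and W: "W permutes {1..n}"
  shows "\<exists>z. optimal n W g z"
  using W
proof (induction "card (inversions n W)" arbitrary: W rule: less_induct)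
  case (less W)
  note W = less.prems
  show ?case
  proof (cases "inv W = id")
    case True
    then have W: "W = id" using permutes_inv_inv[OF W] by simp
    have "inversions n W = {}" by (auto simp: W inversions_def)
    then have "y = W" if "le n y W" for y using le_card_inversions[OF that] by auto
    then have "optimal n W g W" using le_refl[OF less.prems] unfolding optimal_def by blast
    then show ?thesis by blast
  next
    case False
    then obtain k where k: "1 \<le> k" "k < n" "inv W (Suc k) < inv W k"
      using ex_descent[OF permutes_inv[OF W]] by blast
    let ?s = "tp k (Suc k)"
    define W0 where "W0 = ?s \<circ> W"
    have s: "?s permutes {1..n}" using k by (intro permutes_tp) auto
    have W0: "W0 permutes {1..n}" unfolding W0_def by (rule permutes_compose[OF W s])
    have WW0: "W = ?s \<circ> W0" by (simp add: W0_def flip: comp_assoc)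
    have "inv W0 = inv W \<circ> ?s"
      unfolding W0_def using permutes_bij[OF W] permutes_bij[OF s] by (simp add: o_inv_distrib)
    then have k0: "inv W0 k < inv W0 (Suc k)" using k by simp
    note lift = lower_set_lifting[OF W0 k(1,2) k0, folded WW0]
    have "W0 \<noteq> W"
    proof
      assume "W0 = W"
      then have "?s \<circ> W = id \<circ> W" by (simp add: W0_def)
      then have "?s = id" using permutes_surj[OF W] by (metis surj_fun_eq)
      then show False by (metis id_apply n_not_Suc_n transpose_apply_first)
    qed
    then have "card (inversions n W0) < card (inversions n W)" using le_card_inversions[OF lift(1)] by blast
    then obtain z0 where z0: "optimal n W0 g z0" using less.hyps W0 by blast
    have z0p: "z0 permutes {1..n}" using z0 by (auto simp: optimal_def le_def)
    \<comment> \<open>The exchange of \<open>k\<close> and \<open>Suc k\<close> is visible only to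
      the threshold \<open>q = k\<close>; all other counts are inherited.\<close>
    have cs: "cnt n (?s \<circ> x) g q m = cnt n x g q m" if "q \<noteq> k" for x q m
    proof -
      have "?s v \<le> q \<longleftrightarrow> v \<le> q" for v using that by (auto simp: tp_def)
      then show ?thesis by (simp add: cnt_def)
    qed
    define z where "z = (if g (inv z0 k) < g (inv z0 (Suc k)) then z0 else ?s \<circ> z0)"
    have zp: "z permutes {1..n}" using z0p permutes_compose[OF z0p s] by (simp add: z_def)
    have zcnt: "cnt n z g q m = cnt n z0 g q m" if "q \<noteq> k" for q m
      using cs[OF that] by (simp add: z_def)
    have invz: "inv (?s \<circ> z0) = inv z0 \<circ> ?s"
      using permutes_bij[OF z0p] permutes_bij[OF s] by (simp add: o_inv_distrib)
    have order: "g (inv z k) < g (inv z (Suc k))"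
    proof (cases "g (inv z0 k) < g (inv z0 (Suc k))")
      case False
      have "g (inv z0 k) \<noteq> g (inv z0 (Suc k))"
        using permutes_inj_eq[OF g] permutes_inj_eq[OF permutes_inv[OF z0p]] by simp
      then show ?thesis using False by (simp add: z_def invz)
    qed (simp add: z_def)
    have pos: "inv z k \<in> {1..n}" "inv z (Suc k) \<in> {1..n}"
      using k inv_range[OF zp, of k] inv_range[OF zp, of "Suc k"] by auto
    have zinv: "z (inv z k) = k" "z (inv z (Suc k)) = Suc k" by (simp_all add: permutes_inverses[OF zp])
    have "cnt n y g q m \<le> cnt n z g q m" if y: "le n y W" for y q m
    proof -
      have le: "cnt n y g q m \<le> cnt n z g q m" if "q \<noteq> k" for q
      proof -
        obtain y0 where y0: "le n y0 W0" "y = y0 \<or> y = ?s \<circ> y0" using lift(2) y by blast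
        then have "cnt n y g q m = cnt n y0 g q m" using cs[OF that] by auto
        also have "\<dots> \<le> cnt n z0 g q m" using z0 y0 by (auto simp: optimal_def)
        also have "\<dots> = cnt n z g q m" using zcnt[OF that] by simp
        finally show ?thesis .
      qed
      have yp: "y permutes {1..n}" using y by (simp add: le_def)
      show ?thesis
      proof (cases "q = k")
        case True
        show ?thesis
        \<comment> \<open>Threshold \<open>k\<close> is bounded from its neighbours. Either
          \<open>z\<close> gains one between \<open>k - 1\<close> and \<open>k\<close>, the most
          that any point can gain, or, by \<open>order\<close>, \<open>z\<close> gains nothing
          between \<open>k\<close> and \<open>Suc k\<close>, where the bound is known.\<close>
        proof (cases "g (inv z k) \<le> m")
          case g1: True
          have "cnt n y g k m \<le> Suc (cnt n y g (k - 1) m)"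
            using cnt_Suc[OF yp, of g "k - 1" m] k by simp
          also have "\<dots> \<le> Suc (cnt n z g (k - 1) m)" using le[of "k - 1"] k by simp
          also have "\<dots> = cnt n z g k m" using cnt_value[OF zp pos(1), of g m] g1 zinv by simp
          finally show ?thesis using True by simp
        next
          case False
          then have "\<not> g (inv z (Suc k)) \<le> m" using order by simp
          then have "cnt n z g (Suc k) m = cnt n z g k m"
            using cnt_value[OF zp pos(2), of g m] zinv by simp
          then show ?thesis using le[of "Suc k"] cnt_mono[of k "Suc k" n y g m] True by simp
        qed
      qed (rule le)
    qed
    moreover have "le n z W" using z0 lift(2)[of z] by (auto simp: z_def optimal_def)
    ultimately have "optimal n W g z" unfolding optimal_def by blast
    then show ?thesis by blast
  qed
qed

lemma cnt_determines:
  assumes g: "g permutes {1..n}" and y: "y permutes {1..n}" and z: "z permutes {1..n}"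
    and a: "a \<in> {1..n}" and eq: "\<And>q. cnt n y g q (g a) = cnt n z g q (g a)" "\<And>q. cnt n y g q (g a - 1) = cnt n z g q (g a - 1)"
  shows "y a = z a"
proof -
  have "y a \<le> q \<longleftrightarrow> z a \<le> q" for q
    using cnt_position[OF g a, of y q] cnt_position[OF g a, of z q] eq by (auto split: if_splits)
  then show ?thesis using order_eq_iff by blast
qed

lemma optimal_unique:
  assumes g: "g permutes {1..n}" and y: "optimal n W g y" and z: "optimal n W g z"
  shows "y = z"
proof -
  have p: "y permutes {1..n}" "z permutes {1..n}" using y z by (auto simp: optimal_def le_def)
  have eq: "cnt n y g q m = cnt n z g q m" for q m
    using y z unfolding optimal_def by (intro antisym) auto
  show ?thesis by (rule permutes_eqI[OF p]) (rule cnt_determines[OF g p _ eq eq])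
qed

text \<open>Summation by parts: \<open>C k * P k\<close> bounds the \<open>k\<close>-th partial sum
  of the weighted differences from below, and \<open>P n = 0\<close>.\<close>

lemma abel_le:
  fixes C a b :: "nat \<Rightarrow> real"
  assumes anti: "\<And>l. 1 \<le> l \<Longrightarrow> l < n \<Longrightarrow> C (Suc l) \<le> C l"
    and part: "\<And>m. m \<le> n \<Longrightarrow> (\<Sum>l=1..m. a l) \<le> (\<Sum>l=1..m. b l)"
    and total: "(\<Sum>l=1..n. a l) = (\<Sum>l=1..n. b l)"
  shows "(\<Sum>l=1..n. C l * a l) \<le> (\<Sum>l=1..n. C l * b l)"
proof (cases "n = 0")
  case False
  define P where "P m = (\<Sum>l=1..m. b l - a l)" for m
  have P: "0 \<le> P m" if "m \<le> n" for m using part[OF that] by (simp add: P_def sum_subtractf)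
  have "C k * P k \<le> (\<Sum>l=1..k. C l * (b l - a l))" if "1 \<le> k" "k \<le> n" for k
    using that
  proof (induction k rule: dec_induct)
    case base
    then show ?case by (simp add: P_def)
  next
    case (step k)
    have "C (Suc k) * P k \<le> C k * P k" using anti[of k] P[of k] step by (intro mult_right_mono) auto
    then show ?case using step by (simp add: P_def algebra_simps)
  qed
  from this[of n] have "C n * P n \<le> (\<Sum>l=1..n. C l * (b l - a l))" using False by simp
  moreover have "P n = 0" using total by (simp add: P_def sum_subtractf)
  ultimately show ?thesis by (simp add: algebra_simps sum_subtractf)
qed simp

text \<open>Double counting: position \<open>i\<close> fails to be counted at exactly
  \<open>y i\<close> of the thresholds \<open>q < n\<close>. Large counts therefore mean small sums
  over the initial segments of \<open>g\<close>.\<close>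

lemma sum_prefix_cnt:
  assumes y: "y permutes {1..n}"
  shows "(\<Sum>i | i \<in> {1..n} \<and> g i \<le> m. y i) + (\<Sum>q<n. cnt n y g q m) = n * card {i \<in> {1..n}. g i \<le> m}"
proof -
  let ?G = "{i \<in> {1..n}. g i \<le> m}"
  have "y i + card {q. q < n \<and> y i \<le> q} = n" if "i \<in> ?G" for i
  proof -
    have "y i \<le> n" using permutes_in_image[OF y, of i] that by auto
    moreover have "{q. q < n \<and> y i \<le> q} = {y i..<n}" by auto
    ultimately show ?thesis by simp
  qed
  then have "(\<Sum>i\<in>?G. y i + card {q. q < n \<and> y i \<le> q}) = (\<Sum>i\<in>?G. n)" by (rule sum.cong[OF refl])
  moreover have "(\<Sum>i\<in>?G. card {q. q < n \<and> y i \<le> q}) = (\<Sum>q<n. cnt n y g q m)"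
  proof -
    have "(\<Sum>i\<in>?G. card {q. q < n \<and> y i \<le> q}) = (\<Sum>i\<in>?G. \<Sum>q<n. if y i \<le> q then 1 else 0)"
      by (rule sum.cong[OF refl]) (simp add: sum.If_cases lessThan_def Collect_conj_eq)
    also have "\<dots> = (\<Sum>q<n. \<Sum>i\<in>?G. if y i \<le> q then 1 else 0)" by (rule sum.swap)
    also have "\<dots> = (\<Sum>q<n. cnt n y g q m)"
    proof (rule sum.cong[OF refl])
      fix q
      have "?G \<inter> {i. y i \<le> q} = {i \<in> {1..n}. y i \<le> q \<and> g i \<le> m}" by auto
      then show "(\<Sum>i\<in>?G. if y i \<le> q then 1 else 0) = cnt n y g q m" by (simp add: sum.If_cases cnt_def)
    qed
    finally show ?thesis .
  qed
  ultimately show ?thesis by (simp add: sum.distrib)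
qed

locale schubert =
  fixes n :: nat and W :: "nat \<Rightarrow> nat"
  assumes W: "W permutes {1..n}"
begin

definition D :: "(nat \<Rightarrow> nat) set" where "D = {x. le n x W}"

lemma D_permutes: "x \<in> D \<Longrightarrow> x permutes {1..n}"
  by (simp add: D_def le_def)

lemma D_down: "x \<in> D \<Longrightarrow> le n y x \<Longrightarrow> y \<in> D"
  using le_trans by (auto simp: D_def)

lemma D_down_step: "x \<in> D \<Longrightarrow> 1 \<le> i \<Longrightarrow> i < j \<Longrightarrow> j \<le> n \<Longrightarrow> x j < x i \<Longrightarrow> x \<circ> tp i j \<in> D"
proof (rule D_down)
  assume x: "x \<in> D" and ij: "1 \<le> i" "i < j" "j \<le> n" "x j < x i"
  have p: "x \<circ> tp i j permutes {1..n}" using ij D_permutes[OF x] by (intro permutes_comp_tp) auto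
  moreover have "step n (x \<circ> tp i j) x"
    unfolding step_def using ij by (intro exI[of _ i] exI[of _ j]) (simp add: comp_assoc)
  ultimately show "le n (x \<circ> tp i j) x" by (intro step_le)
qed

lemma finite_D: "finite D"
  by (rule finite_subset[of _ "{x. x permutes {1..n}}"]) (auto simp: D_permutes finite_permutations)

definition opt :: "(nat \<Rightarrow> nat) \<Rightarrow> nat \<Rightarrow> nat" where
  "opt g = (THE z. optimal n W g z)"

lemma optimal_opt: "g permutes {1..n} \<Longrightarrow> optimal n W g (opt g)"
proof -
  assume g: "g permutes {1..n}"
  then have "\<exists>!z. optimal n W g z" using ex_optimal[OF g W] optimal_unique[OF g] by blast
  then show ?thesis unfolding opt_def by (rule theI')
qed

lemma opt_in_D: "g permutes {1..n} \<Longrightarrow> opt g \<in> D"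
  using optimal_opt by (simp add: optimal_def D_def)

lemma cnt_le_opt: "g permutes {1..n} \<Longrightarrow> y \<in> D \<Longrightarrow> cnt n y g q m \<le> cnt n (opt g) g q m"
  using optimal_opt by (simp add: optimal_def D_def)

definition val :: "(nat \<Rightarrow> real) \<Rightarrow> (nat \<Rightarrow> nat) \<Rightarrow> real" where
  "val c x = (\<Sum>i=1..n. c i * real (x i))"

text \<open>\<open>c\<close> lies in the closed chamber of \<open>g\<close>; positions with equal
  \<open>c\<close> may be ranked by \<open>g\<close> at will.\<close>

definition refines :: "(nat \<Rightarrow> nat) \<Rightarrow> (nat \<Rightarrow> real) \<Rightarrow> bool" where
  "refines g c \<longleftrightarrow> (\<forall>i\<in>{1..n}. \<forall>j\<in>{1..n}. c j < c i \<longrightarrow> g i < g j)"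

lemma opt_minimizes:
  assumes g: "g permutes {1..n}" and c: "refines g c" and y: "y \<in> D"
  shows "val c (opt g) \<le> val c y"
proof -
  have re: "(\<Sum>i=1..n. f i) = (\<Sum>l=1..n. f (inv g l))" for f :: "nat \<Rightarrow> real"
    using sum.permute[OF permutes_inv[OF g], of f] by (simp add: o_def)
  have pre: "(\<Sum>l=1..m. real (x (inv g l))) = real (\<Sum>i | i \<in> {1..n} \<and> g i \<le> m. x i)" if "m \<le> n" for m x
  proof -
    have "(\<Sum>i | i \<in> {1..n} \<and> g i \<le> m. real (x i)) = (\<Sum>l=1..m. real (x (inv g l)))"
    proof (rule sum.reindex_bij_witness[of _ "inv g" g])
      fix l assume l: "l \<in> {1..m}"
      then have "inv g l \<in> {1..n}" using inv_range[OF g, of l] that by auto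
      then show "inv g l \<in> {i \<in> {1..n}. g i \<le> m}" using l by (simp add: permutes_inverses[OF g])
    next
      fix i assume "i \<in> {i \<in> {1..n}. g i \<le> m}"
      then show "g i \<in> {1..m}" using permutes_in_image[OF g, of i] by auto
    qed (simp_all add: permutes_inverses[OF g])
    then show ?thesis by simp
  qed
  have op: "opt g \<in> D" by (rule opt_in_D[OF g])
  have "(\<Sum>l=1..n. c (inv g l) * real (opt g (inv g l))) \<le> (\<Sum>l=1..n. c (inv g l) * real (y (inv g l)))"
  proof (rule abel_le)
    fix l assume l: "1 \<le> l" "l < n"
    then have "inv g l \<in> {1..n}" "inv g (Suc l) \<in> {1..n}"
      using inv_range[OF g, of l] inv_range[OF g, of "Suc l"] by auto
    then have "c (inv g l) < c (inv g (Suc l)) \<Longrightarrow> g (inv g (Suc l)) < g (inv g l)"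
      using c unfolding refines_def by blast
    then show "c (inv g (Suc l)) \<le> c (inv g l)"
      by (force simp: permutes_inverses[OF g])
  next
    fix m assume m: "m \<le> n"
    have "(\<Sum>q<n. cnt n y g q m) \<le> (\<Sum>q<n. cnt n (opt g) g q m)"
      by (intro sum_mono cnt_le_opt g y)
    then have "(\<Sum>i | i \<in> {1..n} \<and> g i \<le> m. opt g i) \<le> (\<Sum>i | i \<in> {1..n} \<and> g i \<le> m. y i)"
      using sum_prefix_cnt[OF D_permutes[OF y], of g m] sum_prefix_cnt[OF D_permutes[OF op], of g m] by linarith
    then show "(\<Sum>l=1..m. real (opt g (inv g l))) \<le> (\<Sum>l=1..m. real (y (inv g l)))"
      unfolding pre[OF m] by (simp only: of_nat_le_iff)
  next
    have "(\<Sum>l=1..n. real (x (inv g l))) = (\<Sum>l=1..n. real l)" if "x \<in> D" for x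
      using re[of "\<lambda>i. real (x i)"] sum.permute[OF D_permutes[OF that], of real] by (simp add: o_def)
    then show "(\<Sum>l=1..n. real (opt g (inv g l))) = (\<Sum>l=1..n. real (y (inv g l)))" using op y by simp
  qed
  then show ?thesis
    using re[of "\<lambda>i. c i * real (opt g i)"] re[of "\<lambda>i. c i * real (y i)"] by (simp only: val_def)
qed

text \<open>If the smaller value stood on the position that \<open>g\<close> ranks later, the
  exchange would raise the count at threshold \<open>opt g j\<close> over the first
  \<open>g i\<close> ranks.\<close>

lemma opt_local:
  assumes g: "g permutes {1..n}" and ij: "i \<in> {1..n}" "j \<in> {1..n}" "g i < g j"
    and D: "opt g \<circ> tp i j \<in> D"
  shows "opt g i < opt g j"
proof (rule ccontr)
  let ?z = "opt g"
  have z: "?z permutes {1..n}" by (intro D_permutes opt_in_D g)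
  assume "\<not> ?z i < ?z j"
  then have gt: "?z j < ?z i" using permutes_inj_eq[OF z, of i j] ij by auto
  let ?P = "\<lambda>x. {l \<in> {1..n}. x l \<le> ?z j \<and> g l \<le> g i}"
  have "?P (?z \<circ> tp i j) = insert i (?P ?z)"
    using ij gt by (auto simp: tp_def split: if_splits)
  moreover have "i \<notin> ?P ?z" using gt by auto
  ultimately have "cnt n (?z \<circ> tp i j) g (?z j) (g i) = Suc (cnt n ?z g (?z j) (g i))"
    by (simp add: cnt_def)
  then show False using cnt_le_opt[OF g D, of "?z j" "g i"] by simp
qed

text \<open>Undoing an inversion of \<open>opt g\<close> leads down in Bruhat order and stays in
  \<open>D\<close>, so \<open>opt_local\<close> applies.\<close>

lemma inversions_opt:
  assumes g: "g permutes {1..n}" shows "inversions n (opt g) \<subseteq> inversions n g"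
proof
  fix p assume "p \<in> inversions n (opt g)"
  then obtain i j where p: "p = (i, j)" and ij: "1 \<le> i" "i < j" "j \<le> n" "opt g j < opt g i"
    by (auto simp: inversions_def)
  have "opt g \<circ> tp i j \<in> D" using ij by (intro D_down_step opt_in_D g)
  then have "\<not> g i < g j" using opt_local[OF g, of i j] ij by auto
  then show "p \<in> inversions n g" using ij permutes_inj_eq[OF g, of i j] by (auto simp: p inversions_def)
qed

end

section \<open>Chambers of the braid fan and weak order\<close>

text \<open>Ranks positions by decreasing \<open>c\<close>, ties by increasing \<open>d\<close>: a
  chamber whose closure contains \<open>c\<close>, selected by \<open>d\<close>.\<close>

definition sort_perm :: "nat \<Rightarrow> (nat \<Rightarrow> real) \<Rightarrow> (nat \<Rightarrow> real) \<Rightarrow> nat \<Rightarrow> nat" where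
  "sort_perm n c d i =
    (if i \<in> {1..n} then card {j \<in> {1..n}. c i < c j \<or> c j = c i \<and> d j \<le> d i} else i)"

lemma sort_perm_less_iff:
  assumes d: "inj_on d {1..n}" and ij: "i \<in> {1..n}" "j \<in> {1..n}"
  shows "sort_perm n c d i < sort_perm n c d j \<longleftrightarrow> c j < c i \<or> c i = c j \<and> d i < d j"
proof -
  have less: "sort_perm n c d i < sort_perm n c d j"
    if "i \<in> {1..n}" "j \<in> {1..n}" "c j < c i \<or> c i = c j \<and> d i < d j" for i j
  proof -
    have "{k \<in> {1..n}. c i < c k \<or> c k = c i \<and> d k \<le> d i} \<subset> {k \<in> {1..n}. c j < c k \<or> c k = c j \<and> d k \<le> d j}"
    proof (rule psubsetI)
      have "j \<in> {k \<in> {1..n}. c j < c k \<or> c k = c j \<and> d k \<le> d j}"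
        "j \<notin> {k \<in> {1..n}. c i < c k \<or> c k = c i \<and> d k \<le> d i}" using that by auto
      then show "{k \<in> {1..n}. c i < c k \<or> c k = c i \<and> d k \<le> d i} \<noteq> {k \<in> {1..n}. c j < c k \<or> c k = c j \<and> d k \<le> d j}"
        by blast
    qed (use that in auto)
    then show ?thesis using that by (simp add: sort_perm_def psubset_card_mono)
  qed
  show ?thesis
  proof
    assume lt: "sort_perm n c d i < sort_perm n c d j"
    show "c j < c i \<or> c i = c j \<and> d i < d j"
    proof (rule ccontr)
      assume neg: "\<not> ?thesis"
      then have "i = j \<or> c i < c j \<or> c j = c i \<and> d j < d i"
        using inj_onD[OF d _ ij] by fastforce
      then show False using less[OF ij(2,1)] lt by auto
    qed
  qed (rule less[OF ij])
qed

lemma permutes_sort_perm: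
  assumes d: "inj_on d {1..n}" shows "sort_perm n c d permutes {1..n}"
proof (rule bij_imp_permutes)
  have inj: "inj_on (sort_perm n c d) {1..n}"
  proof (rule inj_onI)
    fix i j assume ij: "i \<in> {1..n}" "j \<in> {1..n}" and eq: "sort_perm n c d i = sort_perm n c d j"
    then have "\<not> (c j < c i \<or> c i = c j \<and> d i < d j)" "\<not> (c i < c j \<or> c j = c i \<and> d j < d i)"
      using sort_perm_less_iff[OF d ij, of c] sort_perm_less_iff[OF d ij(2,1), of c] by auto
    then have "d i = d j" by auto
    then show "i = j" using d ij by (auto dest: inj_onD)
  qed
  moreover have "sort_perm n c d ` {1..n} \<subseteq> {1..n}"
  proof
    fix k assume "k \<in> sort_perm n c d ` {1..n}"
    then obtain i where i: "i \<in> {1..n}" and k: "k = card {j \<in> {1..n}. c i < c j \<or> c j = c i \<and> d j \<le> d i}"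
      by (auto simp: sort_perm_def)
    have "k \<le> card {1..n}" unfolding k by (intro card_mono) auto
    moreover have "i \<in> {j \<in> {1..n}. c i < c j \<or> c j = c i \<and> d j \<le> d i}" using i by simp
    then have "k \<noteq> 0" unfolding k by (subst card_0_eq) auto
    ultimately show "k \<in> {1..n}" by simp
  qed
  ultimately show "bij_betw (sort_perm n c d) {1..n} {1..n}"
    by (simp add: bij_betw_def endo_inj_surj)
qed (auto simp: sort_perm_def)

lemma inj_on_real_permutes: "x permutes S \<Longrightarrow> inj_on (\<lambda>i. real (x i)) A"
  by (auto simp: inj_on_def permutes_inj_eq)

text \<open>Then \<open>g \<circ> tp i j\<close> covers \<open>g\<close> in weak order, which is
  expressed throughout by containment of inversion sets. Geometrically, a wall of the chamber of
  \<open>g\<close> is crossed.\<close>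

definition adj :: "nat \<Rightarrow> (nat \<Rightarrow> nat) \<Rightarrow> nat \<Rightarrow> nat \<Rightarrow> bool" where
  "adj n g i j \<longleftrightarrow> 1 \<le> i \<and> i < j \<and> j \<le> n \<and> g j = Suc (g i)"

lemma adj_permutes: "adj n g i j \<Longrightarrow> g permutes {1..n} \<Longrightarrow> g \<circ> tp i j permutes {1..n}"
  by (auto simp: adj_def intro!: permutes_comp_tp)

lemma inversions_adj:
  assumes g: "g permutes {1..n}" and a: "adj n g i j"
  shows "inversions n (g \<circ> tp i j) = insert (i, j) (inversions n g)"
proof -
  have swap: "g \<circ> tp i j = tp (g i) (Suc (g i)) \<circ> g"
    using tp_values_comp[OF g, of i j] a by (simp add: adj_def)
  have "tp k (Suc k) b < tp k (Suc k) a \<longleftrightarrow> (b < a \<and> \<not> (b = k \<and> a = Suc k)) \<or> (a = k \<and> b = Suc k)" for k a b :: nat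
    by (auto simp: tp_def)
  then have *: "(a, b) \<in> inversions n (g \<circ> tp i j) \<longleftrightarrow> 1 \<le> a \<and> a < b \<and> b \<le> n \<and>
      ((g b < g a \<and> \<not> (b = i \<and> a = j)) \<or> (a = i \<and> b = j))" for a b
    using a permutes_inj_eq[OF g, of a i] permutes_inj_eq[OF g, of a j] permutes_inj_eq[OF g, of b i]
      permutes_inj_eq[OF g, of b j]
    unfolding swap by (auto simp: inversions_def adj_def)
  show ?thesis
  proof (rule set_eqI)
    fix p :: "nat \<times> nat"
    obtain a' b' where p: "p = (a', b')" by (cases p)
    show "p \<in> inversions n (g \<circ> tp i j) \<longleftrightarrow> p \<in> insert (i, j) (inversions n g)"
      unfolding p * using a by (auto simp: inversions_def adj_def)
  qed
qed

lemma adj_notin_inversions: "adj n g i j \<Longrightarrow> (i, j) \<notin> inversions n g"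
  by (auto simp: adj_def inversions_def)

lemma card_le_value:
  assumes x: "x permutes {1..n}" and i: "i \<in> {1..n}"
  shows "card {j \<in> {1..n}. x j \<le> x i} = x i"
proof -
  have "bij_betw x {j \<in> {1..n}. x j \<le> x i} {1..x i}"
  proof (rule bij_betw_byWitness[of _ "inv x"])
    show "x ` {j \<in> {1..n}. x j \<le> x i} \<subseteq> {1..x i}"
    proof
      fix k assume "k \<in> x ` {j \<in> {1..n}. x j \<le> x i}"
      then obtain j where "j \<in> {1..n}" "k = x j" "x j \<le> x i" by blast
      then show "k \<in> {1..x i}" using permutes_range[OF x, of j] by simp
    qed
    show "inv x ` {1..x i} \<subseteq> {j \<in> {1..n}. x j \<le> x i}"
    proof
      fix j assume "j \<in> inv x ` {1..x i}"
      then obtain k where "k \<in> {1..x i}" "j = inv x k" by blast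
      then show "j \<in> {j \<in> {1..n}. x j \<le> x i}"
        using inv_range[OF x, of k] permutes_range[OF x, of i] i by (simp add: permutes_inverses[OF x])
    qed
  qed (simp_all add: permutes_inverses[OF x])
  then show ?thesis by (simp add: bij_betw_same_card)
qed

lemma inversions_eqD:
  assumes g: "g permutes {1..n}" and h: "h permutes {1..n}" and eq: "inversions n g = inversions n h"
  shows "g = h"
proof (rule permutes_eqI[OF g h])
  fix i assume i: "i \<in> {1..n}"
  have "g j \<le> g i \<longleftrightarrow> h j \<le> h i" if j: "j \<in> {1..n}" for j
  proof (cases i j rule: linorder_cases)
    case less
    then have "g j < g i \<longleftrightarrow> h j < h i" using eq i j by (auto simp: inversions_def set_eq_iff)
    then show ?thesis using permutes_inj_eq[OF g, of j i] permutes_inj_eq[OF h, of j i] by linarith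
  next
    case greater
    then have "g i < g j \<longleftrightarrow> h i < h j" using eq i j by (auto simp: inversions_def set_eq_iff)
    then show ?thesis by linarith
  qed simp
  then have "{j \<in> {1..n}. g j \<le> g i} = {j \<in> {1..n}. h j \<le> h i}" by auto
  then show "g i = h i" using card_le_value[OF g i] card_le_value[OF h i] by simp
qed

text \<open>If \<open>h\<close> inverted no ascent of \<open>g\<close>, reading \<open>h\<close> in
  the order given by \<open>g\<close> would be increasing throughout: the other consecutive pairs
  are inversions of \<open>g\<close>, hence of \<open>h\<close>.\<close>

lemma ex_ascent:
  assumes g: "g permutes {1..n}" and h: "h permutes {1..n}"
    and sub: "inversions n g \<subseteq> inversions n h" and ne: "g \<noteq> h"
  shows "\<exists>i j. adj n g i j \<and> (i, j) \<in> inversions n h"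
proof (rule ccontr)
  assume no: "\<not> ?thesis"
  have "h \<circ> inv g = id"
  proof (rule permutes_no_descent_id)
    show "h \<circ> inv g permutes {1..n}" by (intro permutes_compose permutes_inv g h)
    fix k assume k: "1 \<le> k" "k < n"
    let ?i = "inv g k" and ?j = "inv g (Suc k)"
    have r: "1 \<le> ?i" "?i \<le> n" "1 \<le> ?j" "?j \<le> n"
      using k inv_range[OF g, of k] inv_range[OF g, of "Suc k"] by auto
    have gg: "g ?i = k" "g ?j = Suc k" by (simp_all add: permutes_inverses[OF g])
    then have ne: "?i \<noteq> ?j" by auto
    then have hne: "h ?i \<noteq> h ?j" using permutes_inj_eq[OF h] by blast
    show "(h \<circ> inv g) k < (h \<circ> inv g) (Suc k)"
    proof (cases "?i < ?j")
      case True
      then have "adj n g ?i ?j" using r gg by (simp add: adj_def)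
      then have "(?i, ?j) \<notin> inversions n h" using no by blast
      then show ?thesis using True r hne by (auto simp: inversions_def)
    next
      case False
      then have "?j < ?i" using ne by simp
      then have "(?j, ?i) \<in> inversions n g" using r gg by (simp add: inversions_def)
      then have "(?j, ?i) \<in> inversions n h" using sub by blast
      then show ?thesis by (simp add: inversions_def)
    qed
  qed
  then have "h = g"
    by (metis comp_assoc comp_id id_comp permutes_inv_o(2)[OF g])
  then show False using ne by simp
qed

lemma weak_order_induct [consumes 3, case_names top ascent]:
  assumes g: "g permutes {1..n}" and h: "h permutes {1..n}"
    and sub: "inversions n g \<subseteq> inversions n h"
    and top: "Q h"
    and ascent: "\<And>g i j. g permutes {1..n} \<Longrightarrow> adj n g i j \<Longrightarrow> (i, j) \<in> inversions n h \<Longrightarrow>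
      inversions n g \<subseteq> inversions n h \<Longrightarrow> inversions n (g \<circ> tp i j) \<subseteq> inversions n h \<Longrightarrow>
      Q (g \<circ> tp i j) \<Longrightarrow> Q g"
  shows "Q g"
  using g sub
proof (induction "card (inversions n h - inversions n g)" arbitrary: g rule: less_induct)
  case less
  show ?case
  proof (cases "g = h")
    case False
    then obtain i j where a: "adj n g i j" and ij: "(i, j) \<in> inversions n h"
      using ex_ascent[OF less.prems(1) h less.prems(2)] by blast
    have inv: "inversions n (g \<circ> tp i j) = insert (i, j) (inversions n g)"
      by (rule inversions_adj[OF less.prems(1) a])
    then have "inversions n h - inversions n (g \<circ> tp i j) \<subset> inversions n h - inversions n g"
      using ij adj_notin_inversions[OF a] by auto
    then have "card (inversions n h - inversions n (g \<circ> tp i j)) < card (inversions n h - inversions n g)"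
      by (intro psubset_card_mono) auto
    then have "Q (g \<circ> tp i j)"
      using less.hyps adj_permutes[OF a less.prems(1)] inv ij less.prems(2) by auto
    then show ?thesis using ascent[OF less.prems(1) a ij less.prems(2)] inv ij less.prems(2) by auto
  qed (use top in simp)
qed

lemma agree_off_pair:
  assumes x: "x permutes {1..n}" and y: "y permutes {1..n}" and ij: "i \<noteq> j"
    and agree: "\<And>l. l \<noteq> i \<Longrightarrow> l \<noteq> j \<Longrightarrow> x l = y l"
  shows "y = x \<or> y = x \<circ> tp i j"
proof -
  have "y i = x i \<or> y i = x j"
  proof (rule ccontr)
    assume "\<not> ?thesis"
    moreover obtain l where l: "y i = x l" using permutes_surj[OF x] by blast
    ultimately have "l \<noteq> i" "l \<noteq> j" by auto
    then show False using agree[of l] l permutes_inj_eq[OF y] by simp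
  qed
  moreover have "y j = x i \<or> y j = x j"
  proof (rule ccontr)
    assume "\<not> ?thesis"
    moreover obtain l where l: "y j = x l" using permutes_surj[OF x] by blast
    ultimately have "l \<noteq> i" "l \<noteq> j" by auto
    then show False using agree[of l] l permutes_inj_eq[OF y] by simp
  qed
  moreover have "y i \<noteq> y j" using permutes_inj_eq[OF y] ij by simp
  ultimately have "y i = x i \<and> y j = x j \<or> y i = x j \<and> y j = x i" by auto
  then show ?thesis using agree by (fastforce simp: fun_eq_iff tp_def)
qed

section \<open>Faces, chambers and walls\<close>

context schubert begin

definition Fmin :: "(nat \<Rightarrow> real) \<Rightarrow> (nat \<Rightarrow> nat) set" where
  "Fmin c = {y \<in> D. \<forall>x\<in>D. val c y \<le> val c x}"

lemma refines_sort_perm: "inj_on d {1..n} \<Longrightarrow> refines (sort_perm n c d) c"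
  unfolding refines_def using sort_perm_less_iff by blast

lemma opt_in_Fmin: "g permutes {1..n} \<Longrightarrow> refines g c \<Longrightarrow> opt g \<in> Fmin c"
  by (simp add: Fmin_def opt_in_D opt_minimizes)

lemma opt_eqI:
  assumes "g permutes {1..n}" "refines g c" "y \<in> D" "\<And>x. x \<in> D \<Longrightarrow> x \<noteq> y \<Longrightarrow> val c y < val c x"
  shows "opt g = y"
proof (rule ccontr)
  assume "opt g \<noteq> y"
  then have "val c y < val c (opt g)" using assms(4) opt_in_D[OF assms(1)] by blast
  then show False using opt_minimizes[OF assms(1-3)] by linarith
qed

text \<open>All permutation vectors have the same norm, so expanding the squared distance of
  \<open>x\<close> and \<open>y\<close> compares the two inner products.\<close>

lemma val_neg_self:
  assumes x: "x permutes {1..n}" and y: "y permutes {1..n}" and ne: "x \<noteq> y"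
  shows "val (\<lambda>i. - real (y i)) y < val (\<lambda>i. - real (y i)) x"
proof -
  obtain k where k: "k \<in> {1..n}" "x k \<noteq> y k" using permutes_eqI[OF x y] ne by blast
  have "(\<Sum>i=1..n. (real (x i) - real (y i))\<^sup>2) > 0"
    using k by (intro sum_pos2[of _ k]) auto
  moreover have "(\<Sum>i=1..n. (real (z i))\<^sup>2) = (\<Sum>i=1..n. (real i)\<^sup>2)" if "z permutes {1..n}" for z
    using sum.permute[OF that, of "\<lambda>i. (real i)\<^sup>2"] by (simp add: o_def)
  from this[OF x] this[OF y] have "(\<Sum>i=1..n. (real (x i) - real (y i))\<^sup>2) =
      2 * (\<Sum>i=1..n. (real (y i))\<^sup>2) - 2 * (\<Sum>i=1..n. real (y i) * real (x i))"
    by (simp add: power2_diff sum.distrib sum_subtractf sum_distrib_left algebra_simps)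
  ultimately show ?thesis by (simp add: val_def sum_negf power2_eq_square)
qed

lemma opt_self:
  assumes "y \<in> D" shows "opt y = y"
proof (rule opt_eqI[OF D_permutes[OF assms] _ assms])
  show "refines y (\<lambda>i. - real (y i))" by (simp add: refines_def)
  show "val (\<lambda>i. - real (y i)) y < val (\<lambda>i. - real (y i)) x" if "x \<in> D" "x \<noteq> y" for x
    using that assms by (intro val_neg_self D_permutes)
qed

text \<open>\<open>c\<close> is perturbed in the direction that singles out \<open>y\<close>. The
  perturbed functional still lies in the closed chamber obtained by breaking ties with
  \<open>y\<close>, and \<open>y\<close> is its only minimizer.\<close>

lemma Fmin_opt:
  assumes y: "y \<in> Fmin c"
  shows "opt (sort_perm n c (\<lambda>i. real (y i))) = y"
proof -
  let ?g = "sort_perm n c (\<lambda>i. real (y i))"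
  have yD: "y \<in> D" and min: "\<And>x. x \<in> D \<Longrightarrow> val c y \<le> val c x" using y by (auto simp: Fmin_def)
  have yp: "y permutes {1..n}" by (rule D_permutes[OF yD])
  \<comment> \<open>The positive gaps of \<open>c\<close>. The 1 inserted below keeps the minimum
    defined when there are none, and division by \<open>n + 1\<close> leaves room for entries of
    \<open>y\<close> up to \<open>n\<close>.\<close>
  define E where "E = (\<lambda>(i, j). c i - c j) ` {(i, j) \<in> {1..n} \<times> {1..n}. c j < c i}"
  have finE: "finite E"
    unfolding E_def by (rule finite_imageI, rule finite_subset[of _ "{1..n} \<times> {1..n}"]) auto
  define \<epsilon> where "\<epsilon> = Min (insert 1 E) / (real n + 1)"
  have "Min (insert 1 E) > 0" using finE by (auto simp: E_def)
  then have \<epsilon>: "\<epsilon> > 0" by (simp add: \<epsilon>_def)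
  have gap: "\<epsilon> * (real n + 1) \<le> c i - c j" if "i \<in> {1..n}" "j \<in> {1..n}" "c j < c i" for i j
  proof -
    have "c i - c j \<in> insert 1 E" using that unfolding E_def by (intro insertI2 image_eqI[of _ _ "(i, j)"]) auto
    then have "Min (insert 1 E) \<le> c i - c j" using finE by (intro Min_le) auto
    then show ?thesis by (simp add: \<epsilon>_def)
  qed
  define c' where "c' i = c i - \<epsilon> * real (y i)" for i
  have inj: "inj_on (\<lambda>i. real (y i)) {1..n}" by (rule inj_on_real_permutes[OF yp])
  have c'val: "val c' x = val c x + \<epsilon> * val (\<lambda>i. - real (y i)) x" for x
    by (simp add: val_def c'_def sum_distrib_left algebra_simps sum_subtractf sum_negf)
  have "refines ?g c'"
    unfolding refines_def
  proof (intro ballI impI)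
    fix i j assume ij: "i \<in> {1..n}" "j \<in> {1..n}" "c' j < c' i"
    have "\<not> c i < c j"
    proof
      assume "c i < c j"
      then have "\<epsilon> * (real n + 1) \<le> c j - c i" using gap ij by blast
      moreover have "\<epsilon> * real (y j) \<le> \<epsilon> * real n"
        using permutes_range[OF yp, of j] ij \<epsilon> by (intro mult_left_mono) auto
      moreover have "0 \<le> \<epsilon> * real (y i)" using \<epsilon> by simp
      moreover have "\<epsilon> * (real n + 1) = \<epsilon> * real n + \<epsilon>" by (simp add: algebra_simps)
      ultimately show False using ij(3) \<epsilon> unfolding c'_def by linarith
    qed
    moreover have "y i < y j" if "c i = c j" using ij(3) that \<epsilon> by (simp add: c'_def)
    ultimately show "?g i < ?g j"
      using sort_perm_less_iff[OF inj ij(1,2), of c] by fastforce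
  qed
  moreover have "val c' y < val c' x" if "x \<in> D" "x \<noteq> y" for x
    using min[OF that(1)] mult_strict_left_mono[OF val_neg_self[OF D_permutes[OF that(1)] yp that(2)] \<epsilon>]
    unfolding c'val by linarith
  ultimately show ?thesis by (intro opt_eqI[of ?g c'] permutes_sort_perm inj yD)
qed

lemma Fmin_eq: "Fmin c = {opt g | g. g permutes {1..n} \<and> refines g c}"
proof (intro equalityI subsetI)
  fix y assume y: "y \<in> Fmin c"
  then have "inj_on (\<lambda>i. real (y i)) {1..n}" by (auto simp: Fmin_def intro: inj_on_real_permutes D_permutes)
  then show "y \<in> {opt g | g. g permutes {1..n} \<and> refines g c}"
    using Fmin_opt[OF y, symmetric] permutes_sort_perm refines_sort_perm by blast
qed (auto intro: opt_in_Fmin)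

lemma cnt_adj:
  assumes "adj n g i j" "m \<noteq> g i" shows "cnt n x (g \<circ> tp i j) q m = cnt n x g q m"
proof -
  have "(g \<circ> tp i j) l \<le> m \<longleftrightarrow> g l \<le> m" for l
    using assms by (auto simp: adj_def tp_def)
  then show ?thesis by (simp add: cnt_def del: comp_apply)
qed

text \<open>The initial segments of the two chambers differ only at length \<open>g i\<close>.
  Equality of all other counts makes the optima agree off \<open>i\<close> and \<open>j\<close>; the
  remaining count, maximized by \<open>opt g\<close>, fixes the direction of the exchange.\<close>

lemma opt_adj:
  assumes g: "g permutes {1..n}" and a: "adj n g i j"
  shows "opt (g \<circ> tp i j) = opt g \<or> (opt (g \<circ> tp i j) = opt g \<circ> tp i j \<and> opt g i < opt g j)"
proof -
  let ?h = "g \<circ> tp i j"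
  have h: "?h permutes {1..n}" by (rule adj_permutes[OF a g])
  have D: "opt g \<in> D" "opt ?h \<in> D" by (intro opt_in_D g h)+
  note p = D_permutes[OF D(1)] D_permutes[OF D(2)]
  have ij: "1 \<le> i" "i < j" "j \<le> n" "g j = Suc (g i)" using a by (auto simp: adj_def)
  have eq: "cnt n (opt g) g q m = cnt n (opt ?h) g q m" if "m \<noteq> g i" for q m
    using cnt_le_opt[OF g D(2), of q m] cnt_le_opt[OF h D(1), of q m] cnt_adj[OF a that] by simp
  have agree: "opt g l = opt ?h l" if l: "l \<noteq> i" "l \<noteq> j" for l
  proof (cases "l \<in> {1..n}")
    case True
    have "g l \<noteq> g i" using permutes_inj_eq[OF g] l by blast
    moreover have "g l - 1 \<noteq> g i"
    proof
      assume e: "g l - 1 = g i"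
      have "1 \<le> g l" using permutes_range[OF g, of l] True by auto
      then have "g l = g j" using e ij(4) by simp
      then show False using permutes_inj_eq[OF g] l by blast
    qed
    ultimately show ?thesis by (intro cnt_determines[OF g p True] eq)
  qed (metis p permutes_not_in)
  have le: "opt g i \<le> opt ?h i"
  proof -
    have "1 \<le> g i" using permutes_range[OF g, of i] ij by simp
    then have "g i - 1 \<noteq> g i" by arith
    then have "cnt n (opt g) g q (g i - 1) = cnt n (opt ?h) g q (g i - 1)" for q by (rule eq)
    then show ?thesis
      using cnt_le_opt[OF g D(2), of "opt ?h i" "g i"] cnt_position[OF g, of i "opt g" "opt ?h i"]
        cnt_position[OF g, of i "opt ?h" "opt ?h i"] ij by (auto split: if_splits)
  qed
  from agree_off_pair[OF p _ agree, of i j] ij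
  have "opt ?h = opt g \<or> opt ?h = opt g \<circ> tp i j" by simp
  then show ?thesis
  proof
    assume e: "opt ?h = opt g \<circ> tp i j"
    then have "opt g i \<le> opt g j" using le by simp
    then show ?thesis using e permutes_inj_eq[OF p(1), of i j] ij by simp
  qed simp
qed

text \<open>Otherwise two further downward exchanges would lead from
  \<open>opt g \<circ> tp i j\<close> to \<open>opt g\<close> with \<open>l\<close> and one of
  \<open>i\<close>, \<open>j\<close> exchanged. This point of \<open>D\<close> contradicts
  \<open>opt_local\<close>; which of the two is taken depends on whether \<open>g\<close> ranks
  \<open>l\<close> before \<open>i\<close> or after \<open>j\<close>. Length thus rises by exactly
  one.\<close>

lemma opt_adj_cover:
  assumes g: "g permutes {1..n}" and a: "adj n g i j" and ne: "opt (g \<circ> tp i j) \<noteq> opt g"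
    and l: "i < l" "l < j" "opt g i < opt g l" "opt g l < opt g j"
  shows False
proof -
  let ?z = "opt g"
  have zD: "?z \<in> D" "opt (g \<circ> tp i j) \<in> D" by (intro opt_in_D g adj_permutes[OF a])+
  have z: "?z permutes {1..n}" by (rule D_permutes[OF zD(1)])
  have ij: "1 \<le> i" "i < j" "j \<le> n" "g j = Suc (g i)" using a by (auto simp: adj_def)
  have top: "?z \<circ> tp i j \<in> D" using opt_adj[OF g a] ne zD by auto
  have inj: "g l \<noteq> g i" "g l \<noteq> g j" using permutes_inj_eq[OF g] l by auto
  show False
  proof (cases "g l < g i")
    case True
    let ?x = "?z \<circ> tp i j"
    have x1: "?x \<circ> tp l j \<in> D" using l ij by (intro D_down_step top) (auto simp: tp_def)
    have "?x \<circ> tp l j \<circ> tp i j \<in> D"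
      using l ij by (intro D_down_step x1) (auto simp: tp_def)
    moreover have "?x \<circ> tp l j \<circ> tp i j = ?z \<circ> tp l i"
      using l by (auto simp: fun_eq_iff tp_def)
    ultimately have "?z l < ?z i" using opt_local[OF g, of l i] True l ij by auto
    then show False using l by simp
  next
    case False
    then have gl: "g j < g l" using inj ij by simp
    let ?x = "?z \<circ> tp i j"
    have x1: "?x \<circ> tp i l \<in> D" using l ij by (intro D_down_step top) (auto simp: tp_def)
    have "?x \<circ> tp i l \<circ> tp i j \<in> D"
      using l ij by (intro D_down_step x1) (auto simp: tp_def)
    moreover have "?x \<circ> tp i l \<circ> tp i j = ?z \<circ> tp j l"
      using l by (auto simp: fun_eq_iff tp_def)
    ultimately have "?z j < ?z l" using opt_local[OF g, of j l] gl l ij by auto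
    then show False using l by simp
  qed
qed

lemma adj_Fmin:
  assumes g: "g permutes {1..n}" and a: "adj n g i j"
  obtains c where "Fmin c = {opt g, opt (g \<circ> tp i j)}"
proof -
  have ij: "1 \<le> i" "i < j" "j \<le> n" "g j = Suc (g i)" using a by (auto simp: adj_def)
  let ?h = "g \<circ> tp i j"
  have h: "?h permutes {1..n}" by (rule adj_permutes[OF a g])
  \<comment> \<open>A functional in the relative interior of the wall: it orders positions like
    \<open>g\<close> but ties \<open>i\<close> with \<open>j\<close>, so \<open>g\<close> and
    \<open>?h\<close> are the only chambers whose closure contains it.\<close>
  define c where "c l = - real (if l = j then g i else g l)" for l
  have nn: "g l \<noteq> g i" "g l \<noteq> Suc (g i)" if "l \<noteq> i" "l \<noteq> j" for l
    using that permutes_inj_eq[OF g, of l i] permutes_inj_eq[OF g, of l j] ij by auto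
  have "refines g c" "refines ?h c"
    unfolding refines_def
  proof (safe)
    fix a b assume lt: "c b < c a"
    define f where "f l = (if l = j then g i else g l)" for l
    have f: "f a < f b" using lt by (simp add: c_def f_def split: if_splits)
    have fl: "f i = g i" "f j = g i" "l \<noteq> j \<Longrightarrow> f l = g l" for l using ij by (auto simp: f_def)
    have hl: "?h i = Suc (g i)" "?h j = g i" "l \<noteq> i \<Longrightarrow> l \<noteq> j \<Longrightarrow> ?h l = g l" for l
      using ij by (auto simp: tp_def)
    consider "a = i" | "a = j" | "a \<noteq> i" "a \<noteq> j" by blast
    then have "g a < g b \<and> ?h a < ?h b"
    proof cases
      case 3
      then have "g a < f b" using f fl(3) by simp
      moreover have "f b \<le> g b" "f b \<le> ?h b" using ij hl fl by (cases "b = j"; cases "b = i"; simp)+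
      ultimately show ?thesis using hl(3)[OF 3] by simp
    qed (use f fl fl(3)[of b] hl(1,2) hl(3)[of b] nn[of b] ij in \<open>(cases "b = i"; cases "b = j"; simp)+\<close>)
    then show "g a < g b" "?h a < ?h b" by blast+
  qed
  moreover have "k = g \<or> k = ?h" if k: "k permutes {1..n}" "refines k c" for k
  proof -
    have off: "(a, b) \<in> inversions n k \<longleftrightarrow> (a, b) \<in> inversions n g" if "(a, b) \<noteq> (i, j)" "1 \<le> a" "a < b" "b \<le> n" for a b
    proof -
      have gab: "g a \<noteq> g b" using permutes_inj_eq[OF g] that by auto
      have kab: "k a \<noteq> k b" using permutes_inj_eq[OF k(1)] that by auto
      have "g a < g b \<Longrightarrow> c b < c a"
        using that ij permutes_inj_eq[OF g, of a j] permutes_inj_eq[OF g, of a i] permutes_inj_eq[OF g, of b i]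
        by (auto simp: c_def)
      moreover have "g b < g a \<Longrightarrow> c a < c b"
        using that ij permutes_inj_eq[OF g, of b j] permutes_inj_eq[OF g, of b i] permutes_inj_eq[OF g, of a i]
        by (auto simp: c_def)
      ultimately have "g a < g b \<Longrightarrow> k a < k b" "g b < g a \<Longrightarrow> k b < k a"
        using k(2) that by (auto simp: refines_def)
      then have "k b < k a \<longleftrightarrow> g b < g a" using gab kab by linarith
      then show ?thesis by (simp add: inversions_def)
    qed
    show ?thesis
    proof (cases "(i, j) \<in> inversions n k")
      case True
      have "inversions n k = inversions n ?h"
      proof (intro set_eqI)
        fix p show "p \<in> inversions n k \<longleftrightarrow> p \<in> inversions n ?h"
          using True off[of "fst p" "snd p"] unfolding inversions_adj[OF g a]
          by (cases "p = (i, j)") (auto simp: inversions_def)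
      qed
      then show ?thesis using inversions_eqD[OF k(1) h] by blast
    next
      case False
      have "inversions n k = inversions n g"
      proof (intro set_eqI)
        fix p show "p \<in> inversions n k \<longleftrightarrow> p \<in> inversions n g"
          using False adj_notin_inversions[OF a] off[of "fst p" "snd p"]
          by (cases "p = (i, j)") (auto simp: inversions_def)
      qed
      then show ?thesis using inversions_eqD[OF k(1) g] by blast
    qed
  qed
  ultimately have "Fmin c = {opt g, opt ?h}" unfolding Fmin_eq using g h by blast
  then show ?thesis by (rule that)
qed

text \<open>Inversion carries these to the covers of the poset. Defining them by walls ties them to
  weak order, and \<open>adj_Fmin\<close> supplies the edge.\<close>

definition wcov :: "(nat \<Rightarrow> nat) \<Rightarrow> (nat \<Rightarrow> nat) \<Rightarrow> bool" where
  "wcov x y \<longleftrightarrow> x \<noteq> y \<and> (\<exists>g i j. g permutes {1..n} \<and> adj n g i j \<and> x = opt g \<and> y = opt (g \<circ> tp i j))"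

abbreviation wle :: "(nat \<Rightarrow> nat) \<Rightarrow> (nat \<Rightarrow> nat) \<Rightarrow> bool" where
  "wle \<equiv> wcov\<^sup>*\<^sup>*"

lemma wcov_props:
  assumes "wcov x y"
  shows "x \<in> D" "y \<in> D" "step n x y" "card (inversions n y) = Suc (card (inversions n x))"
    "\<exists>c. Fmin c = {x, y}"
proof -
  obtain g i j where g: "g permutes {1..n}" and a: "adj n g i j" and x: "x = opt g" and y: "y = opt (g \<circ> tp i j)"
    and ne: "x \<noteq> y" using assms by (auto simp: wcov_def)
  show D: "x \<in> D" "y \<in> D" unfolding x y by (intro opt_in_D g adj_permutes[OF a])+
  have e: "y = x \<circ> tp i j" "x i < x j" using opt_adj[OF g a] ne x y by auto
  have ij: "1 \<le> i" "i < j" "j \<le> n" using a by (auto simp: adj_def)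
  show "step n x y" using e ij by (auto simp: step_def)
  show "card (inversions n y) = Suc (card (inversions n x))"
    unfolding e(1)
  proof (rule card_inversions_comp_tp(2)[OF D_permutes[OF D(1)] ij e(2)])
    fix l assume "i < l" "l < j"
    then show "\<not> (x i < x l \<and> x l < x j)" using opt_adj_cover[OF g a, of l] ne x y by metis
  qed
  show "\<exists>c. Fmin c = {x, y}" using adj_Fmin[OF g a] x y by metis
qed

lemma wle_D: "wle x y \<Longrightarrow> x \<in> D \<Longrightarrow> y \<in> D \<and> le n x y"
proof (induction rule: rtranclp_induct)
  case (step y z)
  then have "le n x y" "le n y z" using wcov_props[OF step(2)] by (auto intro: step_le D_permutes)
  then show ?case using wcov_props[OF step(2)] by (auto intro: le_trans)
qed (auto intro: le_refl D_permutes)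

lemma wle_antisym: "wle x y \<Longrightarrow> wle y x \<Longrightarrow> x \<in> D \<Longrightarrow> x = y"
  using wle_D[of x y] wle_D[of y x] le_antisym[of n x y] by blast

lemma wle_card: "wle x y \<Longrightarrow> x \<in> D \<Longrightarrow> x = y \<or> card (inversions n x) < card (inversions n y)"
  using wle_D[of x y] le_card_inversions[of n x y] by blast

lemma opt_mono:
  assumes "g permutes {1..n}" "h permutes {1..n}" "inversions n g \<subseteq> inversions n h"
  shows "wle (opt g) (opt h)"
  using assms
proof (induction rule: weak_order_induct)
  case (ascent g i j)
  show ?case
  proof (cases "opt g = opt (g \<circ> tp i j)")
    case False
    then have "wcov (opt g) (opt (g \<circ> tp i j))" using ascent by (auto simp: wcov_def)
    then show ?thesis using ascent.IH by (rule converse_rtranclp_into_rtranclp)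
  next
    case True
    show ?thesis unfolding True by (rule ascent.IH)
  qed
qed simp

lemma val_comp_tp:
  assumes "1 \<le> i" "i < j" "j \<le> n"
  shows "val c (x \<circ> tp i j) - val c x = (c i - c j) * (real (x j) - real (x i))"
proof -
  have split: "(\<Sum>l=1..n. f l) = f i + f j + (\<Sum>l\<in>{1..n} - {i, j}. f l)" for f :: "nat \<Rightarrow> real"
  proof -
    have "(\<Sum>l=1..n. f l) = (\<Sum>l\<in>{1..n} - {i, j}. f l) + (\<Sum>l\<in>{i, j}. f l)"
      by (rule sum.subset_diff[of "{i, j}" "{1..n}" f]) (use assms in auto)
    then show ?thesis using assms by (simp add: add.commute)
  qed
  have "(\<Sum>l\<in>{1..n} - {i, j}. c l * real ((x \<circ> tp i j) l)) = (\<Sum>l\<in>{1..n} - {i, j}. c l * real (x l))"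
    by (intro sum.cong) (auto simp: tp_def)
  then show ?thesis
    unfolding val_def split[of "\<lambda>l. c l * real ((x \<circ> tp i j) l)"] split[of "\<lambda>l. c l * real (x l)"]
    by (simp add: algebra_simps)
qed

text \<open>A move of \<open>opt\<close> on the way from \<open>g\<close> to \<open>h\<close>
  exchanges a newly inverted pair \<open>(i, j)\<close> and raises the value at \<open>i\<close> at
  the expense of \<open>j\<close>, so it cannot lower \<open>val c\<close>.\<close>

lemma val_opt_mono:
  assumes "g permutes {1..n}" "h permutes {1..n}" "inversions n g \<subseteq> inversions n h"
    and "\<And>i j. (i, j) \<in> inversions n h \<Longrightarrow> (i, j) \<notin> inversions n g \<Longrightarrow> c j \<le> c i"
  shows "val c (opt g) \<le> val c (opt h)"
  using assms
proof (induction rule: weak_order_induct)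
  case (ascent g i j)
  have ij: "1 \<le> i" "i < j" "j \<le> n" using ascent(2) by (auto simp: adj_def)
  have "val c (opt g) \<le> val c (opt (g \<circ> tp i j))"
    using opt_adj[OF ascent(1,2)]
  proof
    assume e: "opt (g \<circ> tp i j) = opt g \<circ> tp i j \<and> opt g i < opt g j"
    have "c j \<le> c i" using ascent.prems adj_notin_inversions[OF ascent(2)] ascent(3) by blast
    then have "0 \<le> (c i - c j) * (real (opt g j) - real (opt g i))" using e by simp
    then show ?thesis using val_comp_tp[OF ij, of c "opt g"] e by simp
  qed simp
  also have "\<dots> \<le> val c (opt h)"
  proof (rule ascent.IH)
    fix a b assume "(a, b) \<in> inversions n h" "(a, b) \<notin> inversions n (g \<circ> tp i j)"
    then show "c b \<le> c a" using ascent.prems[of a b] inversions_adj[OF ascent(1,2)] by blast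
  qed
  finally show ?case .
qed simp

end

section \<open>Fibres of the minimizer map and joins\<close>

lemma agree_off_triple:
  assumes x: "x permutes {1..n}" and z: "z permutes {1..n}"
    and agree: "\<And>l. l \<notin> {i, j, b} \<Longrightarrow> x l = z l" and a: "a \<in> {i, j, b}"
  shows "x a \<in> {z i, z j, z b}"
proof -
  obtain l where l: "x a = z l" using permutes_surj[OF z] by blast
  have "l \<in> {i, j, b}"
  proof (rule ccontr)
    assume "l \<notin> {i, j, b}"
    then have "x l = x a" using agree l by simp
    then show False using permutes_inj_eq[OF x] a \<open>l \<notin> {i, j, b}\<close> by blast
  qed
  then show ?thesis using l by auto
qed

context schubert begin

text \<open>On the three positions, each arrangement whose first value is not the smallest lies on
  or above \<open>z \<circ> tp i j\<close> in Bruhat order, and \<open>D\<close> is a lower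
  set.\<close>

lemma first_of_triple_fixed:
  assumes z: "z permutes {1..n}" and l: "1 \<le> i" "i < j" "j < b" "b \<le> n" and zl: "z i < z j" "z j < z b"
    and nD: "z \<circ> tp i j \<notin> D" and x: "x \<in> D" and agree: "\<And>l. l \<notin> {i, j, b} \<Longrightarrow> x l = z l"
  shows "x i = z i"
proof (rule ccontr)
  assume ne: "x i \<noteq> z i"
  note xp = D_permutes[OF x]
  have "x i \<in> {z i, z j, z b}" "x j \<in> {z i, z j, z b}" "x b \<in> {z i, z j, z b}"
    using agree_off_triple[OF xp z agree] by auto
  moreover have "x i \<noteq> x j" "x i \<noteq> x b" "x j \<noteq> x b" using permutes_inj_eq[OF xp] l by auto
  ultimately consider "x i = z j" "x j = z i" "x b = z b" | "x i = z j" "x j = z b" "x b = z i"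
    | "x i = z b" "x j = z i" "x b = z j" | "x i = z b" "x j = z j" "x b = z i"
    using ne by auto
  then have "z \<circ> tp i j \<in> D"
  proof cases
    case 1
    have "z \<circ> tp i j = x"
    proof (rule ext)
      fix k show "(z \<circ> tp i j) k = x k"
        using agree[of k] 1 l by (cases "k \<in> {i, j, b}") (auto simp: tp_def)
    qed
    then show ?thesis using x by simp
  next
    case 2
    have "z \<circ> tp i j = x \<circ> tp j b"
    proof (rule ext)
      fix k show "(z \<circ> tp i j) k = (x \<circ> tp j b) k"
        using agree[of k] 2 l by (cases "k \<in> {i, j, b}") (auto simp: tp_def)
    qed
    moreover have "x \<circ> tp j b \<in> D" using 2 l zl by (intro D_down_step x) auto
    ultimately show ?thesis by simp
  next
    case 3
    have "z \<circ> tp i j = x \<circ> tp i b"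
    proof (rule ext)
      fix k show "(z \<circ> tp i j) k = (x \<circ> tp i b) k"
        using agree[of k] 3 l by (cases "k \<in> {i, j, b}") (auto simp: tp_def)
    qed
    moreover have "x \<circ> tp i b \<in> D" using 3 l zl by (intro D_down_step x) auto
    ultimately show ?thesis by simp
  next
    case 4
    have "z \<circ> tp i j = x \<circ> tp j b \<circ> tp i b"
    proof (rule ext)
      fix k show "(z \<circ> tp i j) k = (x \<circ> tp j b \<circ> tp i b) k"
        using agree[of k] 4 l by (cases "k \<in> {i, j, b}") (auto simp: tp_def)
    qed
    moreover have 1: "x \<circ> tp j b \<in> D" using 4 l zl by (intro D_down_step x) auto
    have "x \<circ> tp j b \<circ> tp i b \<in> D"
      using 4 l zl by (intro D_down_step 1) (auto simp: tp_def)
    ultimately show ?thesis by simp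
  qed
  then show False using nD by simp
qed

text \<open>The mirror image: each arrangement whose last value is not the largest lies on or above
  \<open>z \<circ> tp i j\<close>.\<close>

lemma last_of_triple_fixed:
  assumes z: "z permutes {1..n}" and l: "1 \<le> a" "a < i" "i < j" "j \<le> n" and zl: "z a < z i" "z i < z j"
    and nD: "z \<circ> tp i j \<notin> D" and x: "x \<in> D" and agree: "\<And>l. l \<notin> {a, i, j} \<Longrightarrow> x l = z l"
  shows "x j = z j"
proof (rule ccontr)
  assume ne: "x j \<noteq> z j"
  note xp = D_permutes[OF x]
  have "x a \<in> {z a, z i, z j}" "x i \<in> {z a, z i, z j}" "x j \<in> {z a, z i, z j}"
    using agree_off_triple[OF xp z agree] by auto
  moreover have "x a \<noteq> x i" "x a \<noteq> x j" "x i \<noteq> x j" using permutes_inj_eq[OF xp] l by auto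
  ultimately consider "x a = z a" "x i = z j" "x j = z i" | "x a = z j" "x i = z a" "x j = z i"
    | "x a = z i" "x i = z j" "x j = z a" | "x a = z j" "x i = z i" "x j = z a"
    using ne by auto
  then have "z \<circ> tp i j \<in> D"
  proof cases
    case 1
    have "z \<circ> tp i j = x"
    proof (rule ext)
      fix k show "(z \<circ> tp i j) k = x k"
        using agree[of k] 1 l by (cases "k \<in> {a, i, j}") (auto simp: tp_def)
    qed
    then show ?thesis using x by simp
  next
    case 2
    have "z \<circ> tp i j = x \<circ> tp a i"
    proof (rule ext)
      fix k show "(z \<circ> tp i j) k = (x \<circ> tp a i) k"
        using agree[of k] 2 l by (cases "k \<in> {a, i, j}") (auto simp: tp_def)
    qed
    moreover have "x \<circ> tp a i \<in> D" using 2 l zl by (intro D_down_step x) auto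
    ultimately show ?thesis by simp
  next
    case 3
    have "z \<circ> tp i j = x \<circ> tp a j"
    proof (rule ext)
      fix k show "(z \<circ> tp i j) k = (x \<circ> tp a j) k"
        using agree[of k] 3 l by (cases "k \<in> {a, i, j}") (auto simp: tp_def)
    qed
    moreover have "x \<circ> tp a j \<in> D" using 3 l zl by (intro D_down_step x) auto
    ultimately show ?thesis by simp
  next
    case 4
    have "z \<circ> tp i j = x \<circ> tp a i \<circ> tp a j"
    proof (rule ext)
      fix k show "(z \<circ> tp i j) k = (x \<circ> tp a i \<circ> tp a j) k"
        using agree[of k] 4 l by (cases "k \<in> {a, i, j}") (auto simp: tp_def)
    qed
    moreover have 1: "x \<circ> tp a i \<in> D" using 4 l zl by (intro D_down_step x) auto
    have "x \<circ> tp a i \<circ> tp a j \<in> D"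
      using 4 l zl by (intro D_down_step 1) (auto simp: tp_def)
    ultimately show ?thesis by simp
  qed
  then show False using nD by simp
qed

lemma opt_order:
  assumes "g permutes {1..n}" "1 \<le> a" "a < b" "b \<le> n" "g a < g b"
  shows "opt g a < opt g b"
proof -
  have "(a, b) \<notin> inversions n (opt g)" using inversions_opt[OF assms(1)] assms by (auto simp: inversions_def)
  moreover have "opt g a \<noteq> opt g b"
    using permutes_inj_eq[OF D_permutes[OF opt_in_D[OF assms(1)]]] assms by simp
  ultimately show ?thesis using assms by (auto simp: inversions_def)
qed

text \<open>Beyond the wall \<open>j\<close> precedes \<open>i\<close>; were the exchanged point
  available, \<open>opt_local\<close> would demand the smaller value at \<open>j\<close>.\<close>

lemma contracted_notin_D:
  assumes g: "g permutes {1..n}" and a: "adj n g i j" and eq: "opt (g \<circ> tp i j) = opt g"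
  shows "opt g \<circ> tp i j \<notin> D"
proof
  assume D: "opt g \<circ> tp i j \<in> D"
  have ij: "1 \<le> i" "i < j" "j \<le> n" "g j = Suc (g i)" using a by (auto simp: adj_def)
  have "opt (g \<circ> tp i j) \<circ> tp j i \<in> D" using D eq transpose_commute[of i j] by simp
  then have "opt (g \<circ> tp i j) j < opt (g \<circ> tp i j) i"
    using ij by (intro opt_local adj_permutes[OF a g]) auto
  moreover have "opt g i < opt g j" using ij by (intro opt_order[OF g]) auto
  ultimately show False using eq by simp
qed

lemma opt_adj_cases:
  assumes "g permutes {1..n}" "adj n g i j"
  shows "opt (g \<circ> tp i j) = opt g \<or> opt (g \<circ> tp i j) = opt g \<circ> tp i j"
  using opt_adj[OF assms] by blast

text \<open>A genuine move would change the value at \<open>r\<close>, which \<open>key\<close> pins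
  down for every point of \<open>D\<close> that agrees with \<open>z\<close> off
  \<open>T\<close>.\<close>

lemma opt_adj_fixed:
  assumes g: "g permutes {1..n}" and a: "adj n g k l" and T: "k \<in> T" "l \<in> T" and r: "r = k \<or> r = l"
    and agree: "\<And>m. m \<notin> T \<Longrightarrow> opt g m = z m"
    and key: "\<And>x. x \<in> D \<Longrightarrow> (\<And>m. m \<notin> T \<Longrightarrow> x m = z m) \<Longrightarrow> x r = z r"
  shows "opt (g \<circ> tp k l) = opt g"
proof (rule ccontr)
  assume "opt (g \<circ> tp k l) \<noteq> opt g"
  then have e: "opt (g \<circ> tp k l) = opt g \<circ> tp k l" using opt_adj_cases[OF g a] by blast
  have "opt (g \<circ> tp k l) m = z m" if "m \<notin> T" for m
    using agree[OF that] that T unfolding e by (auto simp: tp_def)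
  then have "opt (g \<circ> tp k l) r = z r" by (intro key opt_in_D adj_permutes[OF a g])
  moreover have "opt g r = z r" by (intro key opt_in_D g agree)
  ultimately have "opt g l = opt g k" using e r by auto
  then show False using permutes_inj_eq[OF D_permutes[OF opt_in_D[OF g]]] a by (auto simp: adj_def)
qed

text \<open>The fan of \<open>Q\<^sub>w\<close> is obtained from the braid fan by gluing chambers. If the wall from \<open>g\<close> upwards
  in direction \<open>(i, j)\<close> disappears, then so do all later walls of the other boundary path of
  each polygon at \<open>g\<close> that contains it; hence the disappearance of the wall propagates
  upwards.\<close>

lemma contracted_propagates:
  assumes "g permutes {1..n}" "adj n g i j" "opt (g \<circ> tp i j) = opt g"
    and "h permutes {1..n}" "inversions n g \<subseteq> inversions n h"
  shows "\<exists>h'. h' permutes {1..n} \<and> inversions n h \<subseteq> inversions n h' \<and> opt h' = opt h \<and> (i, j) \<in> inversions n h'"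
  using assms
proof (induction "card ({1..n} \<times> {1..n} - inversions n g)" arbitrary: g i j h rule: less_induct)
  case less
  note g = less.prems(1) and ad = less.prems(2) and eq = less.prems(3) and h = less.prems(4) and sub = less.prems(5)
  have ij: "1 \<le> i" "i < j" "j \<le> n" "g j = Suc (g i)" using ad by (auto simp: adj_def)
  let ?z = "opt g"
  have zD: "?z \<in> D" by (rule opt_in_D[OF g])
  note z = D_permutes[OF zD]
  have nD: "?z \<circ> tp i j \<notin> D" by (rule contracted_notin_D[OF g ad eq])
  have dec: "card ({1..n} \<times> {1..n} - inversions n k) < card ({1..n} \<times> {1..n} - inversions n g)"
    if "inversions n g \<subset> inversions n k" for k
  proof (intro psubset_card_mono)
    have "inversions n k \<subseteq> {1..n} \<times> {1..n}" by (auto simp: inversions_def)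
    then show "{1..n} \<times> {1..n} - inversions n k \<subset> {1..n} \<times> {1..n} - inversions n g" using that by blast
  qed simp
  show ?case
  proof (cases "g = h")
    case True
    then show ?thesis
      using adj_permutes[OF ad g] inversions_adj[OF g ad] eq by (intro exI[of _ "g \<circ> tp i j"]) auto
  next
    case False
    then obtain a b where ad': "adj n g a b" and ab: "(a, b) \<in> inversions n h"
      using ex_ascent[OF g h sub] by blast
    have ab': "1 \<le> a" "a < b" "b \<le> n" "g b = Suc (g a)" using ad' by (auto simp: adj_def)
    define g1 where "g1 = g \<circ> tp a b"
    have g1: "g1 permutes {1..n}" unfolding g1_def by (rule adj_permutes[OF ad' g])
    have inv1: "inversions n g1 = insert (a, b) (inversions n g)"
      unfolding g1_def by (rule inversions_adj[OF g ad'])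
    have sub1: "inversions n g1 \<subseteq> inversions n h" using inv1 sub ab by auto
    have lt1: "inversions n g \<subset> inversions n g1" using inv1 adj_notin_inversions[OF ad'] by auto
    have y1: "opt g1 = ?z \<or> opt g1 = ?z \<circ> tp a b" unfolding g1_def by (rule opt_adj_cases[OF g ad'])
    have inj: "g k = g l \<longleftrightarrow> k = l" for k l by (rule permutes_inj_eq[OF g])
    \<comment> \<open>The hexagon scheme: on its other side the wall \<open>(k, l)\<close> and then
      the wall \<open>(i, j)\<close> are contracted, and the induction hypothesis is applied to each
      in turn.\<close>
    have via: ?thesis
      if kl: "adj n g1 k l" "opt (g1 \<circ> tp k l) = opt g1"
        and ad2: "adj n (g1 \<circ> tp k l) i j" "opt (g1 \<circ> tp k l \<circ> tp i j) = opt (g1 \<circ> tp k l)" for k l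
    proof -
      let ?g2 = "g1 \<circ> tp k l"
      have inv2: "inversions n ?g2 = insert (k, l) (inversions n g1)" by (rule inversions_adj[OF g1 kl(1)])
      obtain h1 where h1: "h1 permutes {1..n}" "inversions n h \<subseteq> inversions n h1" "opt h1 = opt h" "(k, l) \<in> inversions n h1"
        using less.hyps[OF dec[OF lt1] g1 kl h sub1] by blast
      have "inversions n g \<subset> inversions n ?g2" "inversions n ?g2 \<subseteq> inversions n h1"
        using lt1 inv2 sub1 h1 by auto
      then obtain h2 where "h2 permutes {1..n}" "inversions n h1 \<subseteq> inversions n h2" "opt h2 = opt h1" "(i, j) \<in> inversions n h2"
        using less.hyps[OF dec adj_permutes[OF kl(1) g1] ad2 h1(1)] by blast
      then show ?thesis using h1 by (intro exI[of _ h2]) auto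
    qed
    \<comment> \<open>The ascent \<open>(a, b)\<close> towards \<open>h\<close> is
      \<open>(i, j)\<close> itself, shares one position with it (a hexagon of weak order), or is
      disjoint from it (a square).\<close>
    consider "a = i" "b = j" | "a = j" | "b = i" | "a \<notin> {i, j}" "b \<notin> {i, j}"
      using inj[of a i] inj[of b j] ij ab' by fastforce
    then show ?thesis
    proof cases
      case 1
      then show ?thesis using h ab by blast
    next
      case 2
      have v1: "g1 i = g i" "g1 b = Suc (g i)" "g1 j = Suc (Suc (g i))"
        using 2 ij ab' by (auto simp: g1_def tp_def)
      have ad1: "adj n g1 i b" using v1 2 ij ab' by (auto simp: adj_def)
      have ad2: "adj n (g1 \<circ> tp i b) i j"
        using v1 2 ij ab' by (auto simp: adj_def tp_def)
      have zl: "?z i < ?z j" "?z j < ?z b" using ij ab' 2 by (auto intro!: opt_order[OF g])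
      \<comment> \<open>Both remaining walls on this side of the hexagon involve position
        \<open>i\<close>, whose value is forced.\<close>
      have key: "x i = ?z i" if "x \<in> D" "\<And>l. l \<notin> {i, j, b} \<Longrightarrow> x l = ?z l" for x
        using first_of_triple_fixed[OF z ij(1,2) _ ab'(3) zl nD that(1)] ab'(2) 2 that(2) by blast
      have o1: "opt g1 l = ?z l" if "l \<notin> {i, j, b}" for l
        using that y1 2 by (auto simp: tp_def)
      have e2: "opt (g1 \<circ> tp i b) = opt g1"
        by (rule opt_adj_fixed[where T="{i, j, b}" and r=i and z="?z", OF g1 ad1]) (use o1 key in blast)+
      have "opt (g1 \<circ> tp i b \<circ> tp i j) = opt (g1 \<circ> tp i b)"
        by (rule opt_adj_fixed[where T="{i, j, b}" and r=i and z="?z", OF adj_permutes[OF ad1 g1] ad2])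
          (use o1 e2 key in \<open>auto | blast\<close>)+
      then show ?thesis by (rule via[OF ad1 e2 ad2])
    next
      case 3
      have v1: "g1 i = g a" "g1 a = Suc (g a)" "g1 j = Suc (Suc (g a))"
        using 3 ij ab' by (auto simp: g1_def tp_def)
      have ad1: "adj n g1 a j" using v1 3 ij ab' by (auto simp: adj_def)
      have ad2: "adj n (g1 \<circ> tp a j) i j"
        using v1 3 ij ab' by (auto simp: adj_def tp_def)
      have zl: "?z a < ?z i" "?z i < ?z j" using ij ab' 3 by (auto intro!: opt_order[OF g])
      have key: "x j = ?z j" if "x \<in> D" "\<And>l. l \<notin> {a, i, j} \<Longrightarrow> x l = ?z l" for x
        using last_of_triple_fixed[OF z ab'(1) _ ij(2,3) zl nD that(1)] ab'(2) 3 that(2) by blast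
      have o1: "opt g1 l = ?z l" if "l \<notin> {a, i, j}" for l
        using that y1 3 by (auto simp: tp_def)
      have e2: "opt (g1 \<circ> tp a j) = opt g1"
        by (rule opt_adj_fixed[where T="{a, i, j}" and r=j and z="?z", OF g1 ad1]) (use o1 key in blast)+
      have "opt (g1 \<circ> tp a j \<circ> tp i j) = opt (g1 \<circ> tp a j)"
        by (rule opt_adj_fixed[where T="{a, i, j}" and r=j and z="?z", OF adj_permutes[OF ad1 g1] ad2])
          (use o1 e2 key in \<open>auto | blast\<close>)+
      then show ?thesis by (rule via[OF ad1 e2 ad2])
    next
      case 4
      have "g1 i = g i" "g1 j = g j" using 4 by (auto simp: g1_def tp_def)
      then have ad1: "adj n g1 i j" using ij by (auto simp: adj_def)
      have gp: "g \<circ> tp i j permutes {1..n}" by (rule adj_permutes[OF ad g])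
      have "(g \<circ> tp i j) a = g a" "(g \<circ> tp i j) b = g b" using 4 by (auto simp: tp_def)
      then have ad2: "adj n (g \<circ> tp i j) a b" using ab' by (simp add: adj_def del: comp_apply)
      \<comment> \<open>In the square the exchanges commute, and position \<open>i\<close> keeps its
        value along both paths, so the opposite wall is contracted too.\<close>
      have comm: "g1 \<circ> tp i j = g \<circ> tp i j \<circ> tp a b"
        using 4 by (auto simp: g1_def fun_eq_iff tp_def)
      have "opt (g1 \<circ> tp i j) = ?z \<or> opt (g1 \<circ> tp i j) = ?z \<circ> tp a b"
        using opt_adj_cases[OF gp ad2] eq unfolding comm by simp
      then have "opt (g1 \<circ> tp i j) i = ?z i" using 4 by (auto simp: tp_def)
      moreover have "opt g1 i = ?z i" using y1 4 by (auto simp: tp_def)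
      moreover have "opt g1 i \<noteq> opt g1 j"
        using permutes_inj_eq[OF D_permutes[OF opt_in_D[OF g1]]] ij by auto
      ultimately have "opt (g1 \<circ> tp i j) \<noteq> opt g1 \<circ> tp i j" by auto
      then have "opt (g1 \<circ> tp i j) = opt g1" using opt_adj_cases[OF g1 ad1] by blast
      then show ?thesis by (rule less.hyps[OF dec[OF lt1] g1 ad1 _ h sub1])
    qed
  qed
qed

text \<open>\<open>opt\<close> is constant on a chain from \<open>g\<close> up to \<open>k\<close>,
  so each wall on it is contracted. By propagation the wall can be added to \<open>N\<close> within
  the fibre of \<open>N\<close>, hence by maximality it is already an inversion of \<open>N\<close>.
  The fibres of \<open>N\<close> and \<open>k\<close> may differ.\<close>

lemma fibre_le:
  assumes N: "N permutes {1..n}"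
    and max: "\<And>h. h permutes {1..n} \<Longrightarrow> inversions n N \<subseteq> inversions n h \<Longrightarrow> opt h = opt N \<Longrightarrow> h = N"
    and k: "k permutes {1..n}" and g: "g permutes {1..n}" "inversions n g \<subseteq> inversions n k"
    and gN: "inversions n g \<subseteq> inversions n N" and eq: "opt g = opt k"
  shows "inversions n k \<subseteq> inversions n N"
proof -
  have "inversions n g \<subseteq> inversions n N \<longrightarrow> opt g = opt k \<longrightarrow> inversions n k \<subseteq> inversions n N"
    using g(1) k g(2)
  proof (induction rule: weak_order_induct)
    case (ascent g i j)
    show ?case
    proof (intro impI)
      assume gN: "inversions n g \<subseteq> inversions n N" and eq: "opt g = opt k"
      have g1: "g \<circ> tp i j permutes {1..n}" by (rule adj_permutes[OF ascent(2,1)])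
      have inv1: "inversions n (g \<circ> tp i j) = insert (i, j) (inversions n g)"
        by (rule inversions_adj[OF ascent(1,2)])
      have "wle (opt g) (opt (g \<circ> tp i j))" using inv1 by (intro opt_mono ascent g1) auto
      moreover have "wle (opt (g \<circ> tp i j)) (opt g)" unfolding eq by (intro opt_mono ascent g1 k)
      ultimately have e: "opt (g \<circ> tp i j) = opt g" using wle_antisym opt_in_D[OF ascent(1)] by metis
      obtain h where "h permutes {1..n}" "inversions n N \<subseteq> inversions n h" "opt h = opt N" "(i, j) \<in> inversions n h"
        using contracted_propagates[OF ascent(1,2) e N gN] by blast
      then have "(i, j) \<in> inversions n N" using max by blast
      then have sub: "inversions n (g \<circ> tp i j) \<subseteq> inversions n N" using inv1 gN by simp
      show "inversions n k \<subseteq> inversions n N"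
        by (rule ascent.IH[THEN mp, THEN mp, OF sub]) (simp only: e eq)
    qed
  qed simp
  then show ?thesis using gN eq by blast
qed

definition M :: "(nat \<Rightarrow> nat) \<Rightarrow> nat \<Rightarrow> nat" where
  "M u = (SOME N. N permutes {1..n} \<and> opt N = u \<and>
    (\<forall>h. h permutes {1..n} \<and> opt h = u \<longrightarrow> inversions n h \<subseteq> inversions n N))"

text \<open>\<open>u\<close> itself is the least chamber of its fibre, by \<open>opt_self\<close>
  and \<open>inversions_opt\<close>. From this common lower bound, \<open>fibre_le\<close> shows
  that a maximal element is the greatest.\<close>

lemma ex_M:
  assumes u: "u \<in> D"
  shows "\<exists>N. N permutes {1..n} \<and> opt N = u \<and>
    (\<forall>h. h permutes {1..n} \<and> opt h = u \<longrightarrow> inversions n h \<subseteq> inversions n N)"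
proof -
  let ?F = "{h. h permutes {1..n} \<and> opt h = u}"
  have "finite ?F" by (rule finite_subset[of _ "{h. h permutes {1..n}}"]) (auto simp: finite_permutations)
  moreover have uF: "u \<in> ?F" using D_permutes[OF u] opt_self[OF u] by simp
  ultimately obtain N where N: "N \<in> ?F"
    and mx: "\<forall>h\<in>?F. inversions n N \<subseteq> inversions n h \<longrightarrow> inversions n N = inversions n h"
    using finite_has_maximal[of "inversions n ` ?F"] by auto
  have max: "h = N" if h: "h permutes {1..n}" "inversions n N \<subseteq> inversions n h" "opt h = opt N" for h
    using mx N h inversions_eqD[of h n N] by auto
  have "inversions n k \<subseteq> inversions n N" if "k permutes {1..n}" "opt k = u" for k
  proof (rule fibre_le[OF _ max that(1) D_permutes[OF u]])
    show "inversions n u \<subseteq> inversions n k" using inversions_opt[OF that(1)] that(2) by simp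
    show "inversions n u \<subseteq> inversions n N" using inversions_opt[of N] N by auto
  qed (use N that opt_self[OF u] in auto)
  then show ?thesis using N by blast
qed

lemma M_props:
  assumes "u \<in> D"
  shows "M u permutes {1..n}" "opt (M u) = u"
    "\<And>h. h permutes {1..n} \<Longrightarrow> opt h = u \<Longrightarrow> inversions n h \<subseteq> inversions n (M u)"
  using someI_ex[OF ex_M[OF assms]] unfolding M_def by blast+

text \<open>Together with the maximality of \<open>M\<close>, this makes \<open>g\<close> to
  \<open>M (opt g)\<close> a closure operator on weak order, which is what transfers weak order to
  \<open>wle\<close>.\<close>

lemma M_closure:
  assumes v: "v \<in> D" and g: "g permutes {1..n}" and sub: "inversions n g \<subseteq> inversions n (M v)"
  shows "inversions n (M (opt g)) \<subseteq> inversions n (M v)"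
proof -
  let ?u = "opt g"
  have u: "?u \<in> D" by (rule opt_in_D[OF g])
  show ?thesis
  proof (rule fibre_le[OF M_props(1)[OF v] _ M_props(1)[OF u] D_permutes[OF u]])
    show "h = M v" if "h permutes {1..n}" "inversions n (M v) \<subseteq> inversions n h" "opt h = opt (M v)" for h
      using M_props(3)[OF v that(1)] that M_props(1,2)[OF v] by (intro inversions_eqD) auto
    show "inversions n ?u \<subseteq> inversions n (M ?u)" using inversions_opt[OF M_props(1)[OF u]] M_props(2)[OF u] by simp
    show "inversions n ?u \<subseteq> inversions n (M v)" using inversions_opt[OF g] sub by blast
    show "opt ?u = opt (M ?u)" using opt_self[OF u] M_props(2)[OF u] by simp
  qed
qed

lemma wle_iff:
  assumes u: "u \<in> D" and v: "v \<in> D"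
  shows "wle u v \<longleftrightarrow> inversions n (M u) \<subseteq> inversions n (M v)"
proof
  assume "wle u v"
  then show "inversions n (M u) \<subseteq> inversions n (M v)"
  proof (induction rule: rtranclp_induct)
    case (step y z)
    obtain g i j where g: "g permutes {1..n}" and a: "adj n g i j" and y: "y = opt g" and z: "z = opt (g \<circ> tp i j)"
      using step(2) by (auto simp: wcov_def)
    have "inversions n (g \<circ> tp i j) \<subseteq> inversions n (M z)"
      unfolding z by (intro M_props(3) opt_in_D adj_permutes[OF a g]) simp
    then have "inversions n g \<subseteq> inversions n (M z)" using inversions_adj[OF g a] by auto
    then have "inversions n (M y) \<subseteq> inversions n (M z)"
      using M_closure[OF _ g] wcov_props(2)[OF step(2)] y by blast
    then show ?case using step.IH by blast
  qed simp
next
  assume "inversions n (M u) \<subseteq> inversions n (M v)"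
  then show "wle u v" using opt_mono[OF M_props(1)[OF u] M_props(1)[OF v]] M_props(2)[OF u] M_props(2)[OF v] by simp
qed

lemma wle_opt:
  assumes "g permutes {1..n}" "v \<in> D" "inversions n g \<subseteq> inversions n (M v)"
  shows "wle (opt g) v"
  using opt_mono[OF assms(1) M_props(1)[OF assms(2)] assms(3)] M_props(2)[OF assms(2)] by simp

lemma wcov_M_adj:
  assumes u: "u \<in> D" and a: "adj n (M u) i j"
  shows "wcov u (opt (M u \<circ> tp i j))"
proof -
  have "opt (M u \<circ> tp i j) \<noteq> u"
  proof
    assume "opt (M u \<circ> tp i j) = u"
    then have "inversions n (M u \<circ> tp i j) \<subseteq> inversions n (M u)"
      by (rule M_props(3)[OF u adj_permutes[OF a M_props(1)[OF u]]])
    then show False using inversions_adj[OF M_props(1)[OF u] a] adj_notin_inversions[OF a] by auto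
  qed
  then show ?thesis unfolding wcov_def using a M_props(1,2)[OF u] by metis
qed

text \<open>A cover comes from a wall of some chamber in the fibre, but it can be found at
  \<open>M u\<close>: an ascent of \<open>M u\<close> that is an inversion of \<open>M a\<close>
  leads to an element below \<open>a\<close> of the same length.\<close>

lemma wcov_ex_M_adj:
  assumes c: "wcov u a"
  obtains i j where "adj n (M u) i j" "opt (M u \<circ> tp i j) = a"
proof -
  have D: "u \<in> D" "a \<in> D" using wcov_props[OF c] by auto
  have ne: "u \<noteq> a" using c by (simp add: wcov_def)
  have "wle u a" using c by blast
  then have sub: "inversions n (M u) \<subseteq> inversions n (M a)" using wle_iff[OF D] by simp
  have "M u \<noteq> M a" using ne M_props(2)[OF D(1)] M_props(2)[OF D(2)] by metis
  then obtain i j where ad: "adj n (M u) i j" and ij: "(i, j) \<in> inversions n (M a)"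
    using ex_ascent[OF M_props(1)[OF D(1)] M_props(1)[OF D(2)] sub] by blast
  let ?b = "opt (M u \<circ> tp i j)"
  have p: "M u \<circ> tp i j permutes {1..n}" by (rule adj_permutes[OF ad M_props(1)[OF D(1)]])
  have "wle ?b a"
    using inversions_adj[OF M_props(1)[OF D(1)] ad] sub ij by (intro wle_opt p D) auto
  moreover have "card (inversions n ?b) = card (inversions n a)"
    using wcov_props(4)[OF wcov_M_adj[OF D(1) ad]] wcov_props(4)[OF c] by simp
  ultimately have "?b = a" using wle_card[of ?b a] opt_in_D[OF p] by auto
  then show ?thesis using that ad by blast
qed

end

text \<open>The smallest and the largest chamber of the braid fan whose closure contains \<open>c\<close>.\<close>

definition lo :: "nat \<Rightarrow> (nat \<Rightarrow> real) \<Rightarrow> nat \<Rightarrow> nat" where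
  "lo n c = sort_perm n c real"

definition hi :: "nat \<Rightarrow> (nat \<Rightarrow> real) \<Rightarrow> nat \<Rightarrow> nat" where
  "hi n c = sort_perm n c (\<lambda>i. - real i)"

lemma permutes_lo: "lo n c permutes {1..n}"
  unfolding lo_def by (intro permutes_sort_perm) (simp add: inj_on_def)

lemma permutes_hi: "hi n c permutes {1..n}"
  unfolding hi_def by (intro permutes_sort_perm) (simp add: inj_on_def)

lemma lo_less_iff: "i \<in> {1..n} \<Longrightarrow> j \<in> {1..n} \<Longrightarrow> lo n c i < lo n c j \<longleftrightarrow> c j < c i \<or> c i = c j \<and> i < j"
  unfolding lo_def by (subst sort_perm_less_iff) (auto simp: inj_on_def)

lemma hi_less_iff: "i \<in> {1..n} \<Longrightarrow> j \<in> {1..n} \<Longrightarrow> hi n c i < hi n c j \<longleftrightarrow> c j < c i \<or> c i = c j \<and> j < i"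
  unfolding hi_def by (subst sort_perm_less_iff) (auto simp: inj_on_def)

lemma inversions_lo: "inversions n (lo n c) = {(i, j). 1 \<le> i \<and> i < j \<and> j \<le> n \<and> c i < c j}"
  by (auto simp: inversions_def lo_less_iff)

lemma inversions_hi: "inversions n (hi n c) = {(i, j). 1 \<le> i \<and> i < j \<and> j \<le> n \<and> c i \<le> c j}"
  by (auto simp: inversions_def hi_less_iff)

lemma lo_hi: "inversions n (lo n c) \<subseteq> inversions n (hi n c)"
  by (auto simp: inversions_lo inversions_hi)

lemma adj_lo_hi:
  assumes "adj n (lo n c) i j" "c i = c j"
  shows "inversions n (lo n c \<circ> tp i j) \<subseteq> inversions n (hi n c)"
  using assms lo_hi by (auto simp: inversions_adj[OF permutes_lo] adj_def inversions_hi inversions_lo)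

text \<open>In weak order \<open>hi n c\<close> is the join of \<open>lo n c\<close> with its
  ascents inside ties: a tied pair \<open>i < j\<close> is linked by consecutive ranks, all in the
  same tie class and increasing in position, so the inversions of the links compose.\<close>

lemma hi_least:
  assumes h: "h permutes {1..n}"
    and adj: "\<And>i j. adj n (lo n c) i j \<Longrightarrow> c i = c j \<Longrightarrow> (i, j) \<in> inversions n h"
    and lo: "inversions n (lo n c) \<subseteq> inversions n h"
  shows "inversions n (hi n c) \<subseteq> inversions n h"
proof -
  let ?g = "lo n c"
  have g: "?g permutes {1..n}" by (rule permutes_lo)
  have eq: "h j < h i" if "1 \<le> i" "i < j" "j \<le> n" "c i = c j" for i j
    using that
  proof (induction "?g j - ?g i" arbitrary: i rule: less_induct)
    case less
    have r: "i \<in> {1..n}" "j \<in> {1..n}" using less.prems by auto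
    have ij: "?g i < ?g j" using less.prems lo_less_iff[OF r, of c] by simp
    define k where "k = inv ?g (Suc (?g i))"
    have gk: "?g k = Suc (?g i)" by (simp add: k_def permutes_inverses[OF g])
    have k: "k \<in> {1..n}"
      using inv_range[OF g, of "Suc (?g i)"] permutes_range[OF g, of j] ij r by (simp add: k_def)
    have ik: "c k < c i \<or> c i = c k \<and> i < k" using lo_less_iff[OF r(1) k, of c] gk by simp
    show ?case
    proof (cases "k = j")
      case True
      then have "adj n ?g i j" using less.prems gk by (simp add: adj_def)
      then show ?thesis using adj less.prems by (auto simp: inversions_def)
    next
      case False
      have "?g k \<noteq> ?g j" using False permutes_inj_eq[OF g] by blast
      then have kj: "?g k < ?g j" using gk ij by simp
      then have "c j < c k \<or> c k = c j \<and> k < j" using lo_less_iff[OF k r(2), of c] by simp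
      then have e: "c i = c k" "i < k" "c k = c j" "k < j" using ik less.prems by auto
      then have "adj n ?g i k" using gk k less.prems by (simp add: adj_def)
      then have "h k < h i" using adj e by (auto simp: inversions_def)
      moreover have "h j < h k" using gk kj e k less.prems by (intro less.hyps) auto
      ultimately show ?thesis by simp
    qed
  qed
  show ?thesis
  proof
    fix p assume "p \<in> inversions n (hi n c)"
    then obtain i j where p: "p = (i, j)" "1 \<le> i" "i < j" "j \<le> n" "c i \<le> c j" by (auto simp: inversions_hi)
    show "p \<in> inversions n h"
    proof (cases "c i = c j")
      case True
      then show ?thesis using p eq by (auto simp: inversions_def)
    next
      case False
      then have "(i, j) \<in> inversions n (lo n c)" using p by (auto simp: inversions_lo)
      then show ?thesis using lo p by blast
    qed
  qed
qed

text \<open>At some point \<open>(p, q)\<close> between \<open>v\<close> and \<open>v \<circ> (i j)\<close> the rank function of \<open>v\<close> does not see the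
  elements of \<open>B\<close>, and it is as small there as the values on \<open>B\<close> allow.\<close>

lemma not_le_across_blocks:
  assumes u: "u permutes {1..n}" and v: "v permutes {1..n}" and B: "B \<subseteq> {1..n}"
    and ij: "1 \<le> i" "i < j" "j \<le> n" "v j < v i" "i \<notin> B" "j \<in> B"
    and vB: "\<And>k l. 1 \<le> k \<Longrightarrow> k < l \<Longrightarrow> l \<le> n \<Longrightarrow> k \<in> B \<Longrightarrow> l \<notin> B \<Longrightarrow> v k < v l"
    and same: "\<And>q. card {k \<in> B. u k \<le> q} = card {k \<in> B. v k \<le> q}"
  shows "\<not> le n u (v \<circ> tp i j)"
proof
  assume uz: "le n u (v \<circ> tp i j)"
  \<comment> \<open>The rank function of the tableau criterion: it grows along Bruhat order, and the
    exchange of \<open>i\<close> and \<open>j\<close> lowers it by one on the rectangle of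
    \<open>rk_z\<close>.\<close>
  define rk where "rk x p q = card {k \<in> {1..p}. q \<le> x k}" for x :: "nat \<Rightarrow> nat" and p q :: nat
  have rk_step: "rk x p q \<le> rk y p q" if st: "step n x y" for x y p q
  proof -
    obtain a b where ab: "1 \<le> a" "a < b" "b \<le> n" "x a < x b" "y = x \<circ> tp a b"
      using st by (auto simp: step_def)
    define f where "f k = (if k = b \<and> q \<le> x b \<and> b \<le> p then (if q \<le> x a then b else a) else k)" for k
    have "inj_on f {k \<in> {1..p}. q \<le> x k}"
      by (auto simp: inj_on_def f_def split: if_splits)
    moreover have "f ` {k \<in> {1..p}. q \<le> x k} \<subseteq> {k \<in> {1..p}. q \<le> y k}"
      using ab by (auto simp: f_def tp_def split: if_splits)
    ultimately show ?thesis unfolding rk_def by (intro card_inj_on_le) auto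
  qed
  have rk_le: "rk u p q \<le> rk (v \<circ> tp i j) p q" for p q
  proof -
    have "(step n)\<^sup>*\<^sup>* u (v \<circ> tp i j)" using uz by (simp add: le_def)
    then show ?thesis by (induction rule: rtranclp_induct) (auto intro: order_trans rk_step)
  qed
  have rk_z: "Suc (rk (v \<circ> tp i j) p q) = rk v p q" if "i \<le> p" "p < j" "v j < q" "q \<le> v i" for p q
  proof -
    have "{k \<in> {1..p}. q \<le> v k} = insert i {k \<in> {1..p}. q \<le> (v \<circ> tp i j) k}"
      using that ij by (auto simp: tp_def)
    moreover have "i \<notin> {k \<in> {1..p}. q \<le> (v \<circ> tp i j) k}" using that by auto
    ultimately show ?thesis by (simp add: rk_def)
  qed
  define R1 where "R1 p q \<longleftrightarrow> (\<forall>k\<in>B. k \<le> p \<longrightarrow> v k < q)" for p q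
  define R2 where "R2 p q \<longleftrightarrow> (\<forall>k\<in>{1..n} - B. p < k \<longrightarrow> q \<le> v k)" for p q
  \<comment> \<open>At such a point \<open>rk v p q\<close> is the number of large values of
    \<open>v\<close> off \<open>B\<close> minus the number of positions off \<open>B\<close> beyond
    \<open>p\<close>. For \<open>u\<close> the same difference is a lower bound, and the two
    differences agree because \<open>u\<close> and \<open>v\<close> have equal counts on
    \<open>B\<close>. This contradicts \<open>rk_le\<close> and \<open>rk_z\<close>.\<close>
  have good: False if p: "i \<le> p" "p < j" and q: "v j < q" "q \<le> v i" and R: "R1 p q" "R2 p q" for p q
  proof -
    let ?N = "{1..n} - B"
    have vN: "card {k \<in> ?N. q \<le> v k} = card {k \<in> ?N. p < k} + rk v p q"
    proof -
      have "{k \<in> ?N. q \<le> v k} = {k \<in> ?N. p < k} \<union> {k \<in> {1..p}. q \<le> v k}"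
        using R p ij by (auto simp: R1_def R2_def)
      moreover have "{k \<in> ?N. p < k} \<inter> {k \<in> {1..p}. q \<le> v k} = {}" by auto
      ultimately show ?thesis by (simp add: rk_def card_Un_disjoint)
    qed
    have uN: "card {k \<in> ?N. q \<le> u k} \<le> card {k \<in> ?N. p < k} + rk u p q"
    proof -
      have "card {k \<in> ?N. q \<le> u k} \<le> card ({k \<in> ?N. p < k} \<union> {k \<in> {1..p}. q \<le> u k})"
        by (intro card_mono) auto
      also have "\<dots> \<le> card {k \<in> ?N. p < k} + rk u p q" unfolding rk_def by (rule card_Un_le)
      finally show ?thesis .
    qed
    have total: "card {k \<in> ?N. q \<le> x k} + card {k \<in> B. q \<le> x k} = card {k \<in> {1..n}. q \<le> k}" if "x permutes {1..n}" for x
    proof -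
      have "finite B" using B finite_subset by blast
      have "bij_betw x {k \<in> {1..n}. q \<le> x k} {k \<in> {1..n}. q \<le> k}"
      proof (rule bij_betw_byWitness[of _ "inv x"])
        show "x ` {k \<in> {1..n}. q \<le> x k} \<subseteq> {k \<in> {1..n}. q \<le> k}" using permutes_range[OF that] by force
        show "inv x ` {k \<in> {1..n}. q \<le> k} \<subseteq> {k \<in> {1..n}. q \<le> x k}"
          using inv_range[OF that] by (force simp: permutes_inverses[OF that])
      qed (simp_all add: permutes_inverses[OF that])
      then have "card {k \<in> {1..n}. q \<le> k} = card {k \<in> {1..n}. q \<le> x k}" by (simp add: bij_betw_same_card)
      also have "{k \<in> {1..n}. q \<le> x k} = {k \<in> ?N. q \<le> x k} \<union> {k \<in> B. q \<le> x k}" using B by auto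
      also have "card \<dots> = card {k \<in> ?N. q \<le> x k} + card {k \<in> B. q \<le> x k}"
        using \<open>finite B\<close> by (intro card_Un_disjoint) auto
      finally show ?thesis by simp
    qed
    have compl: "card {k \<in> B. q \<le> x k} + card {k \<in> B. x k \<le> q - 1} = card B" if "x permutes {1..n}" for x
    proof -
      have "finite B" using B finite_subset by blast
      moreover have "B = {k \<in> B. q \<le> x k} \<union> {k \<in> B. x k \<le> q - 1}" by auto
      moreover have "{k \<in> B. q \<le> x k} \<inter> {k \<in> B. x k \<le> q - 1} = {}" using q by auto
      ultimately show ?thesis by (metis (no_types, lifting) card_Un_disjoint finite_Un)
    qed
    have "card {k \<in> B. q \<le> u k} = card {k \<in> B. q \<le> v k}"
      using compl[OF u] compl[OF v] same[of "q - 1"] by simp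
    then have "card {k \<in> ?N. q \<le> u k} = card {k \<in> ?N. q \<le> v k}" using total[OF u] total[OF v] by simp
    then have "rk v p q \<le> rk u p q" using uN vN by simp
    then show False using rk_le[of p q] rk_z[OF p q] by simp
  qed
  \<comment> \<open>A walk in search of a good point: along \<open>q = v i\<close> to
    \<open>p = j - 1\<close>, then down to \<open>q = Suc (v j)\<close>. \<open>R1\<close> persists
    because each failure of \<open>R2\<close> supplies a small value off \<open>B\<close> further
    right, which \<open>vB\<close> turns into a bound on \<open>B\<close>. At the end
    \<open>R2\<close> holds as well.\<close>
  have right: "R1 p (v i)" if "i \<le> p" "p < j" for p
    using that
  proof (induction p rule: dec_induct)
    case base
    have "v k < v i" if "k \<in> B" "k \<le> i" for k
    proof -
      have "k < i" using that ij by (metis le_neq_implies_less)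
      then show ?thesis using vB[of k i] that ij B by auto
    qed
    then show ?case by (simp add: R1_def)
  next
    case (step p)
    then have "\<not> R2 p (v i)" using good[of p "v i"] ij by auto
    then obtain k where k: "k \<in> {1..n}" "k \<notin> B" "p < k" "v k < v i" by (auto simp: R2_def)
    have "v l < v i" if "l \<in> B" "l \<le> Suc p" for l
    proof (cases "l = Suc p")
      case True
      then have "l < k" using k that by (metis Suc_lessI)
      then have "v l < v k" using vB[of l k] that k B by auto
      then show ?thesis using k by simp
    next
      case False
      then show ?thesis using that step by (auto simp: R1_def)
    qed
    then show ?case by (simp add: R1_def)
  qed
  have down: "R1 (j - 1) (v i - d)" if "v j < v i - d" for d
    using that
  proof (induction d)
    case 0
    have "i \<le> j - 1" "j - 1 < j" using ij by linarith+
    then show ?case using right[of "j - 1"] by simp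
  next
    case (Suc d)
    let ?q = "v i - d" and ?p = "j - 1"
    have q: "v j < ?q" "?q \<le> v i" "v i - Suc d = ?q - 1" using Suc.prems by auto
    then have "R1 ?p ?q" using Suc.IH by blast
    moreover have "i \<le> ?p" "?p < j" using ij by linarith+
    ultimately have "\<not> R2 ?p ?q" using good[of ?p ?q] q by blast
    then obtain k where k: "k \<in> {1..n}" "k \<notin> B" "?p < k" "v k < ?q" by (auto simp: R2_def)
    have "v l < ?q - 1" if "l \<in> B" "l \<le> ?p" for l
    proof -
      have "l < k" using that k by simp
      then have "v l < v k" using vB[of l k] that k B by auto
      then show ?thesis using k by simp
    qed
    then show ?case unfolding q by (simp add: R1_def)
  qed
  have p: "i \<le> j - 1" "j - 1 < j" using ij by linarith+
  have "v i - (v i - Suc (v j)) = Suc (v j)" using ij by simp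
  then have 1: "R1 (j - 1) (Suc (v j))" using down[of "v i - Suc (v j)"] by simp
  have "Suc (v j) \<le> v k" if k: "k \<in> {1..n} - B" "j - 1 < k" for k
  proof -
    have "j \<noteq> k" using k ij by auto
    then have "j < k" using k by simp
    then have "v j < v k" using vB[of j k] k ij by auto
    then show ?thesis by simp
  qed
  then have "R2 (j - 1) (Suc (v j))" by (simp add: R2_def)
  then show False using good[of "j - 1" "Suc (v j)", OF p] 1 ij by simp
qed

context schubert begin

lemma val_eq_on_Fmin:
  assumes "x \<in> Fmin c" "y \<in> Fmin c" shows "val c x = val c y"
  using assms by (auto simp: Fmin_def intro: antisym)

text \<open>A superlevel set of \<open>c\<close> is an initial segment of every chamber refining
  \<open>c\<close>, where the optimum maximizes counts over \<open>D\<close>. Both minimizers are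
  such optima, so neither count exceeds the other.\<close>

lemma Fmin_level_counts:
  assumes x: "x \<in> Fmin c" and y: "y \<in> Fmin c"
  shows "card {k \<in> {k \<in> {1..n}. t \<le> c k}. x k \<le> q} = card {k \<in> {k \<in> {1..n}. t \<le> c k}. y k \<le> q}"
proof -
  define B where "B = {k \<in> {1..n}. t \<le> c k}"
  have key: "card {k \<in> B. y k \<le> q} \<le> card {k \<in> B. x k \<le> q}" if x: "x \<in> Fmin c" and y: "y \<in> Fmin c" for x y
  proof -
    obtain g where g: "g permutes {1..n}" "refines g c" "x = opt g" using x by (auto simp: Fmin_eq)
    have ex: "g k \<le> card B \<longleftrightarrow> k \<in> B" if k: "k \<in> {1..n}" for k
    proof -
      have ord: "g a < g b" if "a \<in> B" "b \<in> {1..n} - B" for a b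
        using that g(2) by (auto simp: B_def refines_def)
      note cardg = card_le_value[OF g(1) k]
      have "finite B" by (simp add: B_def)
      show ?thesis
      proof
        assume "k \<in> B"
        then have "{l \<in> {1..n}. g l \<le> g k} \<subseteq> B" using ord[of k] by force
        then have "card {l \<in> {1..n}. g l \<le> g k} \<le> card B" using \<open>finite B\<close> by (rule card_mono[rotated])
        then show "g k \<le> card B" using cardg by simp
      next
        assume le: "g k \<le> card B"
        show "k \<in> B"
        proof (rule ccontr)
          assume "k \<notin> B"
          then have "insert k B \<subseteq> {l \<in> {1..n}. g l \<le> g k}"
            using ord[of _ k] k by (force simp: B_def)
          then have "card (insert k B) \<le> card {l \<in> {1..n}. g l \<le> g k}" by (intro card_mono) auto
          then show False using cardg \<open>k \<notin> B\<close> \<open>finite B\<close> le by simp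
        qed
      qed
    qed
    have "{k \<in> {1..n}. x k \<le> q \<and> g k \<le> card B} = {k \<in> B. x k \<le> q}" for x :: "nat \<Rightarrow> nat"
      using ex by (auto simp: B_def)
    then have "cnt n x g q (card B) = card {k \<in> B. x k \<le> q}" for x by (simp add: cnt_def)
    moreover have "cnt n y g q (card B) \<le> cnt n (opt g) g q (card B)"
      using y by (intro cnt_le_opt g) (simp add: Fmin_def)
    ultimately show ?thesis using g(3) by simp
  qed
  show ?thesis using key[OF x y] key[OF y x] by (simp add: B_def)
qed

text \<open>Descending from \<open>v\<close>, a step that exchanges tied positions keeps the value
  of \<open>c\<close>. A step across different values of \<open>c\<close> would leave the elements
  above \<open>u\<close>, by the rank argument for the superlevel set separating the two
  positions.\<close>

lemma interval_subset_Fmin: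
  assumes u: "u \<in> Fmin c" and v: "v \<in> Fmin c" and uy: "le n u y" and yv: "le n y v"
  shows "y \<in> Fmin c"
proof -
  have "le n y v \<Longrightarrow> le n u y \<longrightarrow> y \<in> Fmin c"
  proof (induction rule: le_induct)
    case (step y z)
    show ?case
    proof
      assume uy: "le n u y"
      have yz: "le n y z" using step by (intro step_le)
      then have z: "z \<in> Fmin c" using step.IH uy le_trans by blast
      have zD: "z \<in> D" using z by (simp add: Fmin_def)
      obtain i j where ij: "1 \<le> i" "i < j" "j \<le> n" "y i < y j" "z = y \<circ> tp i j"
        using step(1) by (auto simp: step_def)
      have yz': "y = z \<circ> tp i j" using ij by (simp add: comp_assoc)
      have zij: "z j < z i" using ij by simp
      have yD: "y \<in> D" by (rule D_down[OF zD yz])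
      have ord: "c k \<le> c l" if "1 \<le> k" "k < l" "l \<le> n" "z l < z k" for k l
      proof (rule ccontr)
        assume "\<not> c k \<le> c l"
        then have "(c k - c l) * (real (z l) - real (z k)) < 0" using that by (intro mult_pos_neg) auto
        then have "val c (z \<circ> tp k l) < val c z" using val_comp_tp[OF that(1-3), of c z] by simp
        moreover have "z \<circ> tp k l \<in> D" by (rule D_down_step[OF zD that])
        ultimately show False using z by (force simp: Fmin_def)
      qed
      show "y \<in> Fmin c"
      proof (cases "c i = c j")
        case True
        then have "val c y = val c z" using val_comp_tp[OF ij(1-3), of c y] ij(5) by simp
        then show ?thesis using z yD by (simp add: Fmin_def)
      next
        case False
        then have cij: "c i < c j" using ord[of i j] ij zij by force
        let ?B = "{k \<in> {1..n}. c j \<le> c k}"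
        have "\<not> le n u (z \<circ> tp i j)"
        proof (rule not_le_across_blocks[of _ _ _ ?B])
          show "u permutes {1..n}" using u by (simp add: Fmin_def D_permutes)
          show "z permutes {1..n}" by (rule D_permutes[OF zD])
          show "z k < z l" if "1 \<le> k" "k < l" "l \<le> n" "k \<in> ?B" "l \<notin> ?B" for k l
          proof (rule ccontr)
            assume "\<not> z k < z l"
            then have "z l < z k" using permutes_inj_eq[OF D_permutes[OF zD], of k l] that by auto
            then show False using ord[of k l] that by auto
          qed
          show "card {k \<in> ?B. u k \<le> q} = card {k \<in> ?B. z k \<le> q}" for q by (rule Fmin_level_counts[OF u z])
        qed (use ij zij cij in auto)
        then show ?thesis using uy yz' by simp
      qed
    qed
  qed (use v in simp)
  then show ?thesis using uy yv by blast
qed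

lemma lo_refines: "refines (lo n c) c"
  unfolding lo_def by (intro refines_sort_perm) (simp add: inj_on_def)

lemma hi_refines: "refines (hi n c) c"
  unfolding hi_def by (intro refines_sort_perm) (simp add: inj_on_def)

lemma refines_between:
  assumes g: "g permutes {1..n}" and r: "refines g c"
  shows "inversions n (lo n c) \<subseteq> inversions n g" "inversions n g \<subseteq> inversions n (hi n c)"
proof -
  show "inversions n (lo n c) \<subseteq> inversions n g"
    using r unfolding inversions_lo by (auto simp: refines_def inversions_def)
  show "inversions n g \<subseteq> inversions n (hi n c)"
  proof
    fix p assume "p \<in> inversions n g"
    then obtain a b where p: "p = (a, b)" "1 \<le> a" "a < b" "b \<le> n" "g b < g a" by (auto simp: inversions_def)
    then have "\<not> c b < c a" using r by (force simp: refines_def)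
    then show "p \<in> inversions n (hi n c)" using p by (auto simp: inversions_hi)
  qed
qed

lemma Fmin_between: "y \<in> Fmin c \<Longrightarrow> wle (opt (lo n c)) y \<and> wle y (opt (hi n c))"
proof -
  assume "y \<in> Fmin c"
  then obtain g where "y = opt g" "g permutes {1..n}" "refines g c" by (auto simp: Fmin_eq)
  then show ?thesis using refines_between[of g c] by (simp add: opt_mono permutes_lo permutes_hi)
qed

lemma Fmin_interval: "Fmin c = {y. le n (opt (lo n c)) y \<and> le n y (opt (hi n c))}"
proof (intro equalityI subsetI)
  fix y assume y: "y \<in> Fmin c"
  have "opt (lo n c) \<in> D" "y \<in> D" using y by (auto simp: Fmin_def opt_in_D permutes_lo)
  then show "y \<in> {y. le n (opt (lo n c)) y \<and> le n y (opt (hi n c))}"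
    using Fmin_between[OF y] wle_D[of "opt (lo n c)" y] wle_D[of y "opt (hi n c)"] by blast
next
  fix y assume "y \<in> {y. le n (opt (lo n c)) y \<and> le n y (opt (hi n c))}"
  then have "le n (opt (lo n c)) y" "le n y (opt (hi n c))" by simp_all
  then show "y \<in> Fmin c"
    by (rule interval_subset_Fmin[OF opt_in_Fmin[OF permutes_lo lo_refines] opt_in_Fmin[OF permutes_hi hi_refines]])
qed

section \<open>Joins of sets of atoms\<close>

definition ascents_into :: "(nat \<Rightarrow> nat) \<Rightarrow> (nat \<Rightarrow> nat) set \<Rightarrow> nat set" where
  "ascents_into u S = {k. \<exists>i j. adj n (M u) i j \<and> M u i = k \<and> opt (M u \<circ> tp i j) \<in> S}"

text \<open>A functional in the closed chamber of \<open>M u\<close>. It drops after each rank at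
  which no ascent into \<open>S\<close> occurs, so its level sets are the runs of ranks joined by
  such ascents, the orbits of the parabolic subgroup.\<close>

definition blocks :: "(nat \<Rightarrow> nat) \<Rightarrow> (nat \<Rightarrow> nat) set \<Rightarrow> nat \<Rightarrow> real" where
  "blocks u S i = - real (card {k. 1 \<le> k \<and> k < M u i \<and> k \<notin> ascents_into u S})"

definition J :: "(nat \<Rightarrow> nat) \<Rightarrow> (nat \<Rightarrow> nat) set \<Rightarrow> nat \<Rightarrow> nat" where
  "J u S = opt (hi n (blocks u S))"

lemma adj_in_ascents_iff:
  assumes u: "u \<in> D" and a: "adj n (M u) i j"
  shows "M u i \<in> ascents_into u S \<longleftrightarrow> opt (M u \<circ> tp i j) \<in> S"
proof
  assume "M u i \<in> ascents_into u S"
  then obtain i' j' where *: "adj n (M u) i' j'" "M u i' = M u i" "opt (M u \<circ> tp i' j') \<in> S"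
    by (auto simp: ascents_into_def)
  then have "i' = i" "M u j' = M u j" using a permutes_inj_eq[OF M_props(1)[OF u]] by (auto simp: adj_def)
  then have "i' = i" "j' = j" using permutes_inj_eq[OF M_props(1)[OF u]] by auto
  then show "opt (M u \<circ> tp i j) \<in> S" using * by simp
next
  assume "opt (M u \<circ> tp i j) \<in> S"
  then show "M u i \<in> ascents_into u S" unfolding ascents_into_def using a by blast
qed

lemma finite_below: "finite {k. 1 \<le> k \<and> k < (m::nat) \<and> P k}"
  by (rule finite_subset[of _ "{..<m}"]) auto

lemma blocks_antimono:
  assumes "M u i \<le> M u j" shows "blocks u S j \<le> blocks u S i"
proof -
  have "card {k. 1 \<le> k \<and> k < M u i \<and> k \<notin> ascents_into u S} \<le>
      card {k. 1 \<le> k \<and> k < M u j \<and> k \<notin> ascents_into u S}"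
    by (rule card_mono[OF finite_below]) (use assms in auto)
  then show ?thesis by (simp add: blocks_def)
qed

lemma blocks_strict:
  assumes "M u i \<le> k" "k < M u j" "1 \<le> k" "k \<notin> ascents_into u S"
  shows "blocks u S j < blocks u S i"
proof -
  have "{l. 1 \<le> l \<and> l < M u i \<and> l \<notin> ascents_into u S} \<subset> {l. 1 \<le> l \<and> l < M u j \<and> l \<notin> ascents_into u S}"
  proof (rule psubsetI)
    show "{l. 1 \<le> l \<and> l < M u i \<and> l \<notin> ascents_into u S} \<subseteq> {l. 1 \<le> l \<and> l < M u j \<and> l \<notin> ascents_into u S}"
      using assms by auto
    have "k \<in> {l. 1 \<le> l \<and> l < M u j \<and> l \<notin> ascents_into u S}" "k \<notin> {l. 1 \<le> l \<and> l < M u i \<and> l \<notin> ascents_into u S}"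
      using assms by auto
    then show "{l. 1 \<le> l \<and> l < M u i \<and> l \<notin> ascents_into u S} \<noteq> {l. 1 \<le> l \<and> l < M u j \<and> l \<notin> ascents_into u S}"
      by blast
  qed
  then have "card {l. 1 \<le> l \<and> l < M u i \<and> l \<notin> ascents_into u S} <
      card {l. 1 \<le> l \<and> l < M u j \<and> l \<notin> ascents_into u S}"
    by (rule psubset_card_mono[OF finite_below])
  then show ?thesis by (simp add: blocks_def)
qed

lemma adj_blocks_eq_iff:
  assumes u: "u \<in> D" and a: "adj n (M u) i j"
  shows "blocks u S i = blocks u S j \<longleftrightarrow> opt (M u \<circ> tp i j) \<in> S"
proof (cases "M u i \<in> ascents_into u S")
  case True
  have "{k. 1 \<le> k \<and> k < M u j \<and> k \<notin> ascents_into u S} = {k. 1 \<le> k \<and> k < M u i \<and> k \<notin> ascents_into u S}"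
    using a True by (auto simp: adj_def less_Suc_eq)
  then show ?thesis using adj_in_ascents_iff[OF u a] True by (simp add: blocks_def)
next
  case False
  have "1 \<le> M u i" using permutes_range[OF M_props(1)[OF u], of i] a by (auto simp: adj_def)
  then have "blocks u S j < blocks u S i" using False a by (intro blocks_strict[of u i "M u i"]) (auto simp: adj_def)
  then show ?thesis using adj_in_ascents_iff[OF u a] False by auto
qed

text \<open>Within a run the ranks of \<open>M u\<close> follow ascents, so positions increase as
  they do in \<open>lo\<close>. Conversely, an inversion of \<open>M u\<close> must cross a break
  between two runs.\<close>

lemma lo_blocks:
  assumes u: "u \<in> D" shows "lo n (blocks u S) = M u"
proof (rule inversions_eqD[OF permutes_lo M_props(1)[OF u]])
  note m = M_props(1)[OF u]
  have "blocks u S i < blocks u S j \<longleftrightarrow> M u j < M u i" if ij: "1 \<le> i" "i < j" "j \<le> n" for i j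
  proof
    assume "blocks u S i < blocks u S j"
    then show "M u j < M u i" using blocks_antimono[of u i j S] by fastforce
  next
    assume lt: "M u j < M u i"
    have "\<exists>k. M u j \<le> k \<and> k < M u i \<and> k \<notin> ascents_into u S"
    proof (rule ccontr)
      assume no: "\<not> ?thesis"
      have "j \<le> inv (M u) k" if "M u j \<le> k" "k \<le> M u i" for k
        using that
      proof (induction k rule: dec_induct)
        case base
        then show ?case by (simp add: permutes_inverses[OF m])
      next
        case (step k)
        then have "k \<in> ascents_into u S" using no by auto
        then obtain a b where "adj n (M u) a b" "M u a = k" by (auto simp: ascents_into_def)
        then have "inv (M u) k = a" "inv (M u) (Suc k) = b" "a < b"
          by (auto simp: adj_def permutes_inv_eq[OF m])
        then show ?case using step by simp
      qed
      from this[of "M u i"] show False using lt ij by (simp add: permutes_inverses[OF m])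
    qed
    then show "blocks u S i < blocks u S j"
      using permutes_range[OF m, of j] ij by (auto intro: blocks_strict)
  qed
  then show "inversions n (lo n (blocks u S)) = inversions n (M u)"
    unfolding inversions_lo by (auto simp: inversions_def)
qed

lemma J_in_D: "J u S \<in> D"
  unfolding J_def by (rule opt_in_D[OF permutes_hi])

lemma wle_J:
  assumes u: "u \<in> D" shows "wle u (J u S)"
  using opt_mono[OF permutes_lo permutes_hi lo_hi, of "blocks u S"] lo_blocks[OF u] M_props(2)[OF u]
  by (simp add: J_def)

text \<open>Weak order supplies the join: \<open>hi n (blocks u S)\<close> is the least chamber
  above \<open>M u\<close> and the chosen ascents. \<open>opt_mono\<close> and the greatest chambers
  \<open>M\<close> carry this over to \<open>wle\<close>.\<close>

lemma J_le_iff: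
  assumes u: "u \<in> D" and S: "\<And>a. a \<in> S \<Longrightarrow> wcov u a" and uz: "wle u z"
  shows "wle (J u S) z \<longleftrightarrow> (\<forall>a\<in>S. wle a z)"
proof
  assume Jz: "wle (J u S) z"
  show "\<forall>a\<in>S. wle a z"
  proof
    fix a assume a: "a \<in> S"
    obtain i j where ad: "adj n (M u) i j" and oa: "opt (M u \<circ> tp i j) = a" by (rule wcov_ex_M_adj[OF S[OF a]])
    have "blocks u S i = blocks u S j" using adj_blocks_eq_iff[OF u ad] oa a by simp
    then have "inversions n (M u \<circ> tp i j) \<subseteq> inversions n (hi n (blocks u S))"
      using adj_lo_hi[of n "blocks u S" i j] ad unfolding lo_blocks[OF u] by blast
    then have "wle a (J u S)"
      unfolding J_def oa[symmetric] by (intro opt_mono adj_permutes[OF ad M_props(1)[OF u]] permutes_hi)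
    then show "wle a z" using Jz by simp
  qed
next
  assume all: "\<forall>a\<in>S. wle a z"
  have z: "z \<in> D" using wle_D[OF uz u] by simp
  have "inversions n (hi n (blocks u S)) \<subseteq> inversions n (M z)"
  proof (rule hi_least[OF M_props(1)[OF z]])
    show "inversions n (lo n (blocks u S)) \<subseteq> inversions n (M z)"
      unfolding lo_blocks[OF u] using uz wle_iff[OF u z] by simp
    fix i j assume "adj n (lo n (blocks u S)) i j" and eq: "blocks u S i = blocks u S j"
    then have ad: "adj n (M u) i j" unfolding lo_blocks[OF u] by blast
    let ?a = "opt (M u \<circ> tp i j)"
    have p: "M u \<circ> tp i j permutes {1..n}" by (rule adj_permutes[OF ad M_props(1)[OF u]])
    have aD: "?a \<in> D" by (rule opt_in_D[OF p])
    have "?a \<in> S" using adj_blocks_eq_iff[OF u ad] eq by simp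
    then have "wle ?a z" using all by blast
    then have "inversions n (M ?a) \<subseteq> inversions n (M z)" using wle_iff[OF aD z] by simp
    moreover have "inversions n (M u \<circ> tp i j) \<subseteq> inversions n (M ?a)" by (rule M_props(3)[OF aD p]) simp
    ultimately show "(i, j) \<in> inversions n (M z)" using inversions_adj[OF M_props(1)[OF u] ad] by auto
  qed
  then show "wle (J u S) z" unfolding J_def by (intro wle_opt permutes_hi z)
qed

text \<open>If \<open>a\<close> lay below \<open>J u S\<close> without belonging to
  \<open>S\<close>, adding it would not change the join. But \<open>\<rho>\<close> is constant on a
  face containing \<open>u\<close> and \<open>J u S\<close>, strictly larger at \<open>a\<close>
  than at \<open>u\<close>, and does not decrease from \<open>a\<close> to the enlarged
  join.\<close>

lemma le_J_imp:
  assumes u: "u \<in> D" and S: "\<And>a. a \<in> S \<Longrightarrow> wcov u a" and a: "wcov u a" and le: "wle a (J u S)"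
  shows "a \<in> S"
proof (rule ccontr)
  assume nS: "a \<notin> S"
  let ?T = "insert a S"
  have T: "wcov u b" if "b \<in> ?T" for b using that S a by blast
  obtain i j where ad: "adj n (M u) i j" and oa: "opt (M u \<circ> tp i j) = a" by (rule wcov_ex_M_adj[OF a])
  note m = M_props(1)[OF u]
  have p: "M u \<circ> tp i j permutes {1..n}" by (rule adj_permutes[OF ad m])
  have ij: "1 \<le> i" "i < j" "j \<le> n" "M u j = Suc (M u i)" using ad by (auto simp: adj_def)
  have "\<forall>b\<in>S. wle b (J u S)" using J_le_iff[where S=S, OF u S wle_J[OF u, of S]] by simp
  then have TS: "wle (J u ?T) (J u S)" using J_le_iff[where S="?T", OF u T wle_J[OF u, of S]] le by simp
  moreover have ST: "wle (J u S) (J u ?T)"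
  proof -
    have "\<forall>b\<in>?T. wle b (J u ?T)" using J_le_iff[where S="?T", OF u T wle_J[OF u, of ?T]] by simp
    then show ?thesis using J_le_iff[where S=S, OF u S wle_J[OF u, of ?T]] by simp
  qed
  ultimately have eq: "J u ?T = J u S" using wle_antisym J_in_D by blast
  \<comment> \<open>The indicator of the first \<open>M u i\<close> ranks. Rank \<open>M u i\<close>
    is a break for \<open>S\<close>, so \<open>M u\<close> and the top chamber of \<open>S\<close>
    both refine it.\<close>
  define \<rho> where "\<rho> l = (if M u l \<le> M u i then 1 else 0 :: real)" for l
  have kS: "M u i \<notin> ascents_into u S" using adj_in_ascents_iff[OF u ad] oa nS by blast
  have "refines (hi n (blocks u S)) \<rho>" "refines (M u) \<rho>"
  proof -
    show "refines (M u) \<rho>" by (auto simp: refines_def \<rho>_def split: if_splits)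
    show "refines (hi n (blocks u S)) \<rho>"
      unfolding refines_def
    proof (intro ballI impI)
      fix k l assume kl: "k \<in> {1..n}" "l \<in> {1..n}" "\<rho> l < \<rho> k"
      then have "M u k \<le> M u i" "M u i < M u l" by (auto simp: \<rho>_def split: if_splits)
      moreover have "1 \<le> M u i" using permutes_range[OF m, of i] ij by auto
      ultimately have "blocks u S l < blocks u S k" using kS by (intro blocks_strict[of u k "M u i"])
      then show "hi n (blocks u S) k < hi n (blocks u S) l" using hi_less_iff kl by simp
    qed
  qed
  then have "J u S \<in> Fmin \<rho>" "u \<in> Fmin \<rho>"
    using opt_in_Fmin[OF permutes_hi] opt_in_Fmin[OF m] M_props(2)[OF u] by (auto simp: J_def)
  then have val1: "val \<rho> (J u S) = val \<rho> u" by (rule val_eq_on_Fmin)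
  have val2: "val \<rho> u < val \<rho> a"
  proof -
    have "a \<noteq> u" using a unfolding wcov_def by blast
    then have "a = u \<circ> tp i j" "u i < u j" using opt_adj[OF m ad] oa M_props(2)[OF u] by auto
    moreover have "\<rho> i = 1" "\<rho> j = 0" using ij by (auto simp: \<rho>_def)
    ultimately show ?thesis using val_comp_tp[OF ij(1-3), of \<rho> u] by simp
  qed
  have "val \<rho> (opt (M u \<circ> tp i j)) \<le> val \<rho> (opt (hi n (blocks u ?T)))"
  proof (rule val_opt_mono[OF p permutes_hi])
    have "blocks u ?T i = blocks u ?T j" using adj_blocks_eq_iff[OF u ad] oa by simp
    then show "inversions n (M u \<circ> tp i j) \<subseteq> inversions n (hi n (blocks u ?T))"
      using adj_lo_hi[of n "blocks u ?T" i j] ad unfolding lo_blocks[OF u] by blast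
    fix k l assume "(k, l) \<in> inversions n (hi n (blocks u ?T))" "(k, l) \<notin> inversions n (M u \<circ> tp i j)"
    then have "(k, l) \<notin> inversions n (M u)" "1 \<le> k" "k < l" "l \<le> n"
      using inversions_adj[OF m ad] by (auto simp: inversions_def)
    then have "M u k \<le> M u l" by (auto simp: inversions_def)
    then show "\<rho> l \<le> \<rho> k" by (auto simp: \<rho>_def)
  qed
  then have val3: "val \<rho> a \<le> val \<rho> (J u ?T)" by (simp add: J_def oa)
  show False using val1 val2 val3 eq by simp
qed

definition skeleton_rel :: "(nat \<Rightarrow> nat) rel" where
  "skeleton_rel = {(x, y). x \<in> D \<and> y \<in> D \<and> wle x y}"

lemma partial_order_skeleton_rel: "partial_order_on D skeleton_rel"
  unfolding partial_order_on_def preorder_on_def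
proof (intro conjI)
  show "skeleton_rel \<subseteq> D \<times> D" by (auto simp: skeleton_rel_def)
  show "refl_on D skeleton_rel" by (auto simp: skeleton_rel_def refl_on_def)
  show "trans skeleton_rel" by (auto simp: skeleton_rel_def trans_def)
  show "antisym skeleton_rel" by (auto simp: skeleton_rel_def antisym_def intro: wle_antisym)
qed

lemma atom_joins_skeleton_rel:
  assumes u: "u \<in> D" shows "atom_joins D skeleton_rel u {a. wcov u a} (J u)"
proof
  show "partial_order_on D skeleton_rel" by (rule partial_order_skeleton_rel)
  show "finite D" by (rule finite_D)
  show "(u, a) \<in> skeleton_rel \<and> a \<noteq> u" if "a \<in> {a. wcov u a}" for a
  proof -
    have c: "wcov u a" using that by simp
    then have "wle u a" by blast
    then show ?thesis using wcov_props(1,2)[OF c] c by (auto simp: skeleton_rel_def wcov_def)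
  qed
  show "\<exists>a\<in>{a. wcov u a}. (a, z) \<in> skeleton_rel" if z: "(u, z) \<in> skeleton_rel" "z \<noteq> u" for z
  proof -
    have "wle u z" "z \<in> D" using z by (auto simp: skeleton_rel_def)
    then obtain a where "wcov u a" "wle a z" using z(2) by (metis converse_rtranclpE)
    then show ?thesis using \<open>z \<in> D\<close> wcov_props(2)[of u a] by (auto simp: skeleton_rel_def)
  qed
  show "((J u S, z) \<in> skeleton_rel) = (\<forall>a\<in>S. (a, z) \<in> skeleton_rel)" if "S \<subseteq> {a. wcov u a}" "(u, z) \<in> skeleton_rel" for S z
  proof -
    have "z \<in> D" "wle u z" "\<And>a. a \<in> S \<Longrightarrow> wcov u a" "\<And>a. a \<in> S \<Longrightarrow> a \<in> D"
      using that wcov_props(2) by (auto simp: skeleton_rel_def)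
    then show ?thesis using J_le_iff[OF u, of S z] J_in_D by (auto simp: skeleton_rel_def)
  qed
  show "(u, J u S) \<in> skeleton_rel" for S using u J_in_D wle_J by (auto simp: skeleton_rel_def)
  show "a \<in> S" if "S \<subseteq> {a. wcov u a}" "a \<in> {a. wcov u a}" "(a, J u S) \<in> skeleton_rel" for S a
    using that le_J_imp[OF u, of S a] by (auto simp: skeleton_rel_def)
qed

text \<open>For a face cut out by \<open>c\<close>, the chambers \<open>lo n c\<close> and
  \<open>hi n c\<close> are mapped to \<open>u\<close> and \<open>v\<close>. Although
  \<open>lo n c\<close> may differ from \<open>M u\<close>, each of its ascents inside ties leads to
  \<open>u\<close> or to an atom below \<open>v\<close>, hence below the join;
  \<open>hi_least\<close> lifts this to \<open>v\<close>.\<close>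

lemma face_iff_J:
  assumes uv: "wle u v" and u: "u \<in> D"
  shows "(\<exists>c. Fmin c = {y. le n u y \<and> le n y v}) \<longleftrightarrow> v = J u {a. wcov u a \<and> wle a v}"
proof
  let ?A = "{a. wcov u a \<and> wle a v}"
  assume v: "v = J u ?A"
  have "Fmin (blocks u ?A) = {y. le n u y \<and> le n y v}"
    unfolding Fmin_interval lo_blocks[OF u] M_props(2)[OF u] using v by (simp add: J_def)
  then show "\<exists>c. Fmin c = {y. le n u y \<and> le n y v}" by blast
next
  let ?A = "{a. wcov u a \<and> wle a v}"
  assume "\<exists>c. Fmin c = {y. le n u y \<and> le n y v}"
  then obtain c where c: "Fmin c = {y. le n u y \<and> le n y v}" by blast
  have v: "v \<in> D" and luv: "le n u v" using wle_D[OF uv u] by auto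
  have uF: "u \<in> Fmin c" and vF: "v \<in> Fmin c" using c luv u v le_refl D_permutes by auto
  let ?x = "opt (lo n c)" and ?y = "opt (hi n c)"
  have xF: "?x \<in> Fmin c" and yF: "?y \<in> Fmin c"
    by (intro opt_in_Fmin permutes_lo permutes_hi lo_refines hi_refines)+
  have xD: "?x \<in> D" by (intro opt_in_D permutes_lo)
  have xu: "?x = u"
  proof (rule le_antisym)
    show "le n ?x u" using Fmin_between[OF uF] wle_D[OF _ xD] by blast
    show "le n u ?x" using xF c by blast
  qed
  have yv: "?y = v"
  proof (rule le_antisym)
    show "le n v ?y" using Fmin_between[OF vF] wle_D[OF _ v] by blast
    show "le n ?y v" using yF c by blast
  qed
  let ?J = "J u ?A"
  have A: "\<And>a. a \<in> ?A \<Longrightarrow> wcov u a" by blast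
  have Jv: "wle ?J v" using J_le_iff[where S="?A", OF u A uv] by blast
  have aJ: "\<forall>a\<in>?A. wle a ?J" using J_le_iff[where S="?A", OF u A wle_J[OF u, of ?A]] by simp
  have "inversions n (hi n c) \<subseteq> inversions n (M ?J)"
  proof (rule hi_least[OF M_props(1)[OF J_in_D]])
    have loM: "inversions n (lo n c) \<subseteq> inversions n (M u)" using M_props(3)[OF u permutes_lo xu] .
    have uJ: "inversions n (M u) \<subseteq> inversions n (M ?J)" using wle_iff[OF u J_in_D] wle_J[OF u] by blast
    then show "inversions n (lo n c) \<subseteq> inversions n (M ?J)" using loM by blast
    fix i j assume ad: "adj n (lo n c) i j" and eq: "c i = c j"
    let ?g = "lo n c \<circ> tp i j" 
    have g: "?g permutes {1..n}" by (rule adj_permutes[OF ad permutes_lo])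
    have gD: "opt ?g \<in> D" by (rule opt_in_D[OF g])
    have gv: "wle (opt ?g) v" using opt_mono[OF g permutes_hi adj_lo_hi[OF ad eq]] yv by simp
    have "wle (opt ?g) ?J"
    proof (cases "opt ?g = u")
      case True
      then show ?thesis using wle_J[OF u] by simp
    next
      case False
      then have "wcov u (opt ?g)" unfolding wcov_def using ad permutes_lo xu by metis
      then show ?thesis using aJ gv by blast
    qed
    then have "inversions n (M (opt ?g)) \<subseteq> inversions n (M ?J)" using wle_iff[OF gD J_in_D] by blast
    moreover have "inversions n ?g \<subseteq> inversions n (M (opt ?g))" by (rule M_props(3)[OF gD g]) simp
    ultimately show "(i, j) \<in> inversions n (M ?J)" using inversions_adj[OF permutes_lo ad] by auto
  qed
  then have "wle v ?J" using wle_opt[OF permutes_hi J_in_D] yv by metis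
  then show "v = ?J" using wle_antisym[OF _ Jv v] by blast
qed

end

section \<open>Faces of the Bruhat interval polytope\<close>

lemma id_le:
  assumes "x permutes {1..n}" shows "le n id x"
  using assms
proof (induction "card (inversions n x)" arbitrary: x rule: less_induct)
  case (less x)
  show ?case
  proof (cases "x = id")
    case True
    then show ?thesis using le_refl[OF less.prems] by simp
  next
    case False
    then obtain i where i: "1 \<le> i" "i < n" "x (Suc i) < x i" using ex_descent[OF less.prems] by blast
    let ?y = "x \<circ> tp i (Suc i)"
    have y: "?y permutes {1..n}" using i less.prems by (intro permutes_comp_tp) auto
    have "step n ?y x"
      unfolding step_def using i by (intro exI[of _ i] exI[of _ "Suc i"]) (simp add: comp_assoc)
    moreover from this have "card (inversions n ?y) < card (inversions n x)" by (rule step_card_inversions[OF _ y])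
    ultimately show ?thesis using less.hyps[OF _ y] step_le[OF _ y] le_trans by blast
  qed
qed

lemma card_inversions_inv:
  assumes x: "x permutes {1..n}" shows "card (inversions n (inv x)) = card (inversions n x)"
proof -
  have sub: "(\<lambda>(i, j). (y j, y i)) ` inversions n y \<subseteq> inversions n (inv y)" if y: "y permutes {1..n}" for y
  proof
    fix p assume "p \<in> (\<lambda>(i, j). (y j, y i)) ` inversions n y"
    then obtain i j where "p = (y j, y i)" "1 \<le> i" "i < j" "j \<le> n" "y j < y i" by (auto simp: inversions_def)
    then show "p \<in> inversions n (inv y)"
      using permutes_range[OF y, of i] permutes_range[OF y, of j] by (simp add: inversions_def permutes_inverses[OF y])
  qed
  have le: "card (inversions n y) \<le> card (inversions n (inv y))" if y: "y permutes {1..n}" for y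
  proof (rule card_inj_on_le[OF _ sub[OF y]])
    show "inj_on (\<lambda>(i, j). (y j, y i)) (inversions n y)"
      by (auto simp: inj_on_def permutes_inj_eq[OF y])
  qed simp
  show ?thesis using le[OF x] le[OF permutes_inv[OF x]] by (simp add: permutes_inv_inv[OF x])
qed

lemma face_of_minimizers:
  fixes S :: "'v::euclidean_space set"
  assumes fin: "finite S" and ne: "S \<noteq> {}"
  shows "convex hull {s \<in> S. \<forall>t\<in>S. a \<bullet> s \<le> a \<bullet> t} face_of convex hull S"
proof -
  let ?T = "{s \<in> S. \<forall>t\<in>S. a \<bullet> s \<le> a \<bullet> t}"
  define m where "m = Min ((\<lambda>s. a \<bullet> s) ` S)"
  have m: "m \<le> a \<bullet> s" if "s \<in> S" for s unfolding m_def using fin that by (intro Min_le) auto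
  have "m \<in> (\<lambda>s. a \<bullet> s) ` S" unfolding m_def using fin ne by (intro Min_in) auto
  then have T: "?T = {s \<in> S. a \<bullet> s = m}" using m by (auto intro: antisym)
  let ?F = "convex hull S \<inter> {x. a \<bullet> x = m}"
  have "convex hull S \<subseteq> {x. m \<le> a \<bullet> x}"
    by (rule hull_minimal) (use m in \<open>auto simp: convex_halfspace_ge\<close>)
  then have F: "?F face_of convex hull S"
    by (intro face_of_Int_supporting_hyperplane_ge) auto
  then obtain S' where S': "S' \<subseteq> S" "?F = convex hull S'"
    using face_of_convex_hull_subset[of S] fin finite_imp_compact by blast
  have "S' \<subseteq> ?T" using S' hull_subset[of S' convex] unfolding T by blast
  then have "?F \<subseteq> convex hull ?T" using S'(2) hull_mono[of S' ?T] by simp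
  moreover have "convex hull ?T \<subseteq> ?F"
  proof (rule hull_minimal)
    show "?T \<subseteq> ?F" unfolding T using hull_subset[of S convex] by blast
    show "convex ?F" by (intro convex_Int convex_convex_hull convex_hyperplane)
  qed
  ultimately show ?thesis using F by simp
qed

text \<open>All other points of the sphere lie strictly on one side of the tangent hyperplane at
  \<open>s\<close>.\<close>

lemma sphere_point_in_hull:
  fixes s :: "'v::euclidean_space"
  assumes norm: "\<And>t. t \<in> T \<Longrightarrow> t \<bullet> t = s \<bullet> s" and s: "s \<in> convex hull T"
  shows "s \<in> T"
proof (rule ccontr)
  assume "s \<notin> T"
  have "s \<bullet> t < s \<bullet> s" if t: "t \<in> T" for t
  proof -
    have "0 < (s - t) \<bullet> (s - t)" using \<open>s \<notin> T\<close> t by auto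
    then show ?thesis using norm[OF t] by (simp add: inner_diff inner_commute)
  qed
  then have "convex hull T \<subseteq> {x. s \<bullet> x < s \<bullet> s}"
    by (intro hull_minimal) (auto simp: convex_halfspace_lt)
  then show False using s by auto
qed

text \<open>Faces of polytopes are exposed, and by the sphere condition a point of \<open>S\<close>
  in the face already belongs to \<open>T\<close>. The sign changes because exposed faces are given
  by maxima.\<close>

lemma face_imp_minimizers:
  fixes S :: "'v::euclidean_space set"
  assumes fin: "finite S" and T: "T \<subseteq> S" "T \<noteq> {}"
    and norm: "\<And>s t. s \<in> S \<Longrightarrow> t \<in> S \<Longrightarrow> s \<bullet> s = t \<bullet> t"
    and face: "convex hull T face_of convex hull S"
  shows "\<exists>a. T = {s \<in> S. \<forall>t\<in>S. a \<bullet> s \<le> a \<bullet> t}"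
proof -
  have "polyhedron (convex hull S)" by (rule polytope_imp_polyhedron[OF polytope_convex_hull[OF fin]])
  then have "convex hull T exposed_face_of convex hull S" using face exposed_face_of_polyhedron by blast
  then obtain a b where ab: "convex hull S \<subseteq> {x. a \<bullet> x \<le> b}" "convex hull T = convex hull S \<inter> {x. a \<bullet> x = b}"
    by (auto simp: exposed_face_of_def)
  have le: "a \<bullet> s \<le> b" if "s \<in> S" for s using ab(1) hull_inc[OF that, of convex] by blast
  have eq: "a \<bullet> t = b" if "t \<in> T" for t using ab(2) hull_inc[OF that, of convex] by blast
  have "s \<in> T" if s: "s \<in> S" "a \<bullet> s = b" for s
  proof (rule sphere_point_in_hull)
    show "s \<in> convex hull T" using s ab(2) hull_inc[OF s(1), of convex] by blast
    show "t \<bullet> t = s \<bullet> s" if "t \<in> T" for t using norm that s T by blast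
  qed
  then have T_eq: "T = {s \<in> S. a \<bullet> s = b}" using T eq by blast
  obtain t0 where t0: "t0 \<in> T" using T by blast
  have "a \<bullet> s = b \<longleftrightarrow> (\<forall>t\<in>S. (- a) \<bullet> s \<le> (- a) \<bullet> t)" if s: "s \<in> S" for s
  proof
    assume "\<forall>t\<in>S. (- a) \<bullet> s \<le> (- a) \<bullet> t"
    then have "(- a) \<bullet> s \<le> (- a) \<bullet> t0" using t0 T by blast
    then show "a \<bullet> s = b" using le[OF s] eq[OF t0] by simp
  qed (use le in simp)
  then have "T = {s \<in> S. \<forall>t\<in>S. (- a) \<bullet> s \<le> (- a) \<bullet> t}" using T_eq by blast
  then show ?thesis by blast
qed

section \<open>Translation between the polytope and the minimizer map\<close>

locale bruhat_polytope_setup =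
  fixes n :: nat and e :: "'n::finite \<Rightarrow> nat" and w :: "nat \<Rightarrow> nat"
  assumes e: "bij_betw e UNIV {1..n}" and w: "w permutes {1..n}"
begin

text \<open>\<open>perm_vec\<close> lists the values of the inverse permutation, and inversion
  preserves Bruhat order; an element \<open>z\<close> of the interval thus corresponds to the point
  \<open>inv z\<close> of \<open>D\<close>.\<close>

sublocale schubert n "inv w"
  by unfold_locales (rule permutes_inv[OF w])

abbreviation "I \<equiv> bruhat_interval n id w"

lemma in_interval_iff:
  "u permutes {1..n} \<Longrightarrow> v permutes {1..n} \<Longrightarrow>
    z \<in> bruhat_interval n u v \<longleftrightarrow> z permutes {1..n} \<and> le n (inv u) (inv z) \<and> le n (inv z) (inv v)"
  using bruhat_le_inv[of u n z] bruhat_le_inv[of z n v] by (auto simp: bruhat_interval_def bruhat_le_def)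

lemma in_I_iff: "z \<in> I \<longleftrightarrow> z permutes {1..n} \<and> inv z \<in> D"
  using in_interval_iff[OF permutes_id w, of z] id_le[OF permutes_inv, of z n] by (auto simp: D_def)

lemma D_inv: "x \<in> D \<Longrightarrow> inv x \<in> I \<and> inv (inv x) = x"
  by (simp add: in_I_iff D_permutes permutes_inv permutes_inv_inv[of x "{1..n}"])

lemma inner_perm_vec: "(\<chi> i. c (e i)) \<bullet> perm_vec e z = val c (inv z)"
proof -
  have "(\<chi> i. c (e i)) \<bullet> perm_vec e z = (\<Sum>i\<in>UNIV. c (e i) * real (inv z (e i)))"
    by (simp add: inner_vec_def perm_vec_def)
  also have "\<dots> = (\<Sum>j=1..n. c j * real (inv z j))"
    by (rule sum.reindex_bij_betw[OF e])
  finally show ?thesis by (simp add: val_def)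
qed

lemma vec_eq_functional: "a = (\<chi> i. a $ inv_into UNIV e (e i))"
  using e by (simp add: vec_eq_iff bij_betw_def)

lemma perm_vec_norm:
  assumes "z permutes {1..n}"
  shows "perm_vec e z \<bullet> perm_vec e z = (\<Sum>j=1..n. (real j)\<^sup>2)"
proof -
  have "perm_vec e z \<bullet> perm_vec e z = (\<Sum>i\<in>UNIV. (real (inv z (e i)))\<^sup>2)"
    by (simp add: inner_vec_def perm_vec_def power2_eq_square)
  also have "\<dots> = (\<Sum>j=1..n. (real (inv z j))\<^sup>2)"
    by (rule sum.reindex_bij_betw[OF e])
  also have "\<dots> = (\<Sum>j=1..n. (real j)\<^sup>2)"
    using sum.permute[OF permutes_inv[OF assms], of "\<lambda>j. (real j)\<^sup>2"] by (simp add: o_def)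
  finally show ?thesis .
qed

lemma perm_vec_inj:
  assumes z: "z permutes {1..n}" and z': "z' permutes {1..n}" and eq: "perm_vec e z = perm_vec e z'"
  shows "z = z'"
proof -
  have "inv z (e i) = inv z' (e i)" for i
    using arg_cong[OF eq, of "\<lambda>v. v $ i"] by (simp add: perm_vec_def)
  then have "inv z j = inv z' j" if "j \<in> {1..n}" for j
    using e that by (metis bij_betw_imp_surj_on imageE)
  then have "inv z = inv z'" by (intro permutes_eqI[OF permutes_inv[OF z] permutes_inv[OF z']])
  then show ?thesis using permutes_inv_inv[OF z] permutes_inv_inv[OF z'] by metis
qed

text \<open>Every functional has the form of \<open>inner_perm_vec\<close>, and faces are sets of
  minimizers; injectivity of \<open>perm_vec\<close> and of inversion makes the correspondence of
  index sets exact.\<close>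

lemma face_iff_Fmin:
  assumes F: "F \<subseteq> I" "F \<noteq> {}"
  shows "convex hull (perm_vec e ` F) face_of bruhat_polytope n e id w \<longleftrightarrow> (\<exists>c. Fmin c = inv ` F)"
proof -
  let ?S = "perm_vec e ` I" and ?T = "perm_vec e ` F"
  have fin: "finite ?S" by (simp add: finite_bruhat_interval)
  have inj: "perm_vec e z = perm_vec e z' \<longleftrightarrow> z = z'" if "z \<in> I" "z' \<in> I" for z z'
    using perm_vec_inj that in_I_iff by blast
  have invinj: "inv z = inv z' \<longleftrightarrow> z = z'" if "z \<in> I" "z' \<in> I" for z z'
    using that permutes_inv_inv in_I_iff by metis
  have DI: "D = inv ` I" using D_inv in_I_iff by (auto simp: image_iff) metis
  have key: "?T = {s \<in> ?S. \<forall>t\<in>?S. (\<chi> i. c (e i)) \<bullet> s \<le> (\<chi> i. c (e i)) \<bullet> t} \<longleftrightarrow> Fmin c = inv ` F" for c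
  proof -
    have 1: "{s \<in> ?S. \<forall>t\<in>?S. (\<chi> i. c (e i)) \<bullet> s \<le> (\<chi> i. c (e i)) \<bullet> t} =
        perm_vec e ` {z \<in> I. \<forall>t\<in>I. val c (inv z) \<le> val c (inv t)}"
      by (auto simp: inner_perm_vec)
    have 2: "Fmin c = inv ` {z \<in> I. \<forall>t\<in>I. val c (inv z) \<le> val c (inv t)}"
      unfolding Fmin_def DI by auto
    let ?Z = "{z \<in> I. \<forall>t\<in>I. val c (inv z) \<le> val c (inv t)}"
    have "perm_vec e ` F = perm_vec e ` ?Z \<longleftrightarrow> F = ?Z"
      by (rule inj_on_image_eq_iff[of _ I]) (use F inj in \<open>auto simp: inj_on_def\<close>)
    moreover have "inv ` ?Z = inv ` F \<longleftrightarrow> ?Z = F"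
      by (rule inj_on_image_eq_iff[of _ I]) (use F invinj in \<open>auto simp: inj_on_def\<close>)
    ultimately show ?thesis unfolding 1 2 by auto
  qed
  show ?thesis
  proof
    assume "convex hull ?T face_of bruhat_polytope n e id w"
    then have "convex hull ?T face_of convex hull ?S" by (simp add: bruhat_polytope_def)
    moreover have "s \<bullet> s = t \<bullet> t" if "s \<in> ?S" "t \<in> ?S" for s t
      using that perm_vec_norm in_I_iff by auto
    ultimately obtain a where "?T = {s \<in> ?S. \<forall>t\<in>?S. a \<bullet> s \<le> a \<bullet> t}"
      using face_imp_minimizers[OF fin, of ?T] F by blast
    then have "Fmin (\<lambda>j. a $ inv_into UNIV e j) = inv ` F"
      using key[of "\<lambda>j. a $ inv_into UNIV e j"] vec_eq_functional[of a] by simp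
    then show "\<exists>c. Fmin c = inv ` F" by blast
  next
    assume "\<exists>c. Fmin c = inv ` F"
    then obtain c where "?T = {s \<in> ?S. \<forall>t\<in>?S. (\<chi> i. c (e i)) \<bullet> s \<le> (\<chi> i. c (e i)) \<bullet> t}"
      using key by blast
    moreover have "?S \<noteq> {}" using F by blast
    ultimately show "convex hull ?T face_of bruhat_polytope n e id w"
      using face_of_minimizers[OF fin, of "\<chi> i. c (e i)"] by (simp add: bruhat_polytope_def)
  qed
qed

lemma P_cover_iff: "P_cover n e w z z' \<longleftrightarrow> z \<in> I \<and> z' \<in> I \<and> wcov (inv z) (inv z')"
proof -
  have len: "coxeter_length n z = card (inversions n (inv z))" if "z \<in> I" for z
    using that in_I_iff coxeter_length_eq card_inversions_inv by metis
  have face: "closed_segment (perm_vec e z) (perm_vec e z') face_of bruhat_polytope n e id w \<longleftrightarrow>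
      (\<exists>c. Fmin c = {inv z, inv z'})" if "z \<in> I" "z' \<in> I" for z z'
    using face_iff_Fmin[of "{z, z'}"] that by (simp add: segment_convex_hull)
  show ?thesis
  proof safe
    assume c: "P_cover n e w z z'"
    then show z: "z \<in> I" "z' \<in> I" by (auto simp: P_cover_def)
    let ?x = "inv z" and ?y = "inv z'"
    have D: "?x \<in> D" "?y \<in> D" using z in_I_iff by auto
    have card: "card (inversions n ?y) = Suc (card (inversions n ?x))"
      using c z len by (simp add: P_cover_def)
    obtain c where c: "Fmin c = {?x, ?y}"
      using c face z by (auto simp: P_cover_def edge_of_def)
    \<comment> \<open>The bottom of the edge is one of its ends and lies below both. The length
      condition makes it \<open>?x\<close>, and a chain of covers between lengths that differ by one
      is a single cover.\<close>
    have lo: "opt (lo n c) \<in> {?x, ?y}" "opt (lo n c) \<in> D"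
      using opt_in_Fmin[OF permutes_lo lo_refines] c opt_in_D[OF permutes_lo] by auto
    have "wle (opt (lo n c)) ?x" using Fmin_between c by blast
    then have lox: "opt (lo n c) = ?x" using wle_card[OF _ lo(2)] lo(1) card by fastforce
    have "wle (opt (lo n c)) ?y" using Fmin_between c by blast
    then have xy: "wle ?x ?y" using lox by simp
    have "?x \<noteq> ?y" using card by auto
    then obtain a where a: "wcov ?x a" "wle a ?y" using xy by (metis converse_rtranclpE)
    then have "a = ?y" using wle_card[OF a(2)] wcov_props(2,4)[OF a(1)] card by auto
    then show "wcov ?x ?y" using a by simp
  next
    assume z: "z \<in> I" "z' \<in> I" and c: "wcov (inv z) (inv z')"
    have "z \<noteq> z'" using c by (auto simp: wcov_def)
    then have "perm_vec e z \<noteq> perm_vec e z'" using perm_vec_inj z in_I_iff by blast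
    then have "aff_dim (closed_segment (perm_vec e z) (perm_vec e z')) = 1"
      by (simp add: segment_convex_hull aff_dim_convex_hull)
    then show "P_cover n e w z z'"
      using z face[OF z] wcov_props(4,5)[OF c] len by (simp add: P_cover_def edge_of_def)
  qed
qed

lemma P_rel_iff: "(z, z') \<in> P_rel n e w \<longleftrightarrow> z \<in> I \<and> z' \<in> I \<and> (inv z, inv z') \<in> skeleton_rel"
proof -
  have "(P_cover n e w)\<^sup>*\<^sup>* z z' \<longleftrightarrow> wle (inv z) (inv z')" if z: "z \<in> I" "z' \<in> I"
  proof
    assume "(P_cover n e w)\<^sup>*\<^sup>* z z'"
    then show "wle (inv z) (inv z')"
      by (induction rule: rtranclp_induct) (auto simp: P_cover_iff intro: rtranclp.rtrancl_into_rtrancl)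
  next
    assume "wle (inv z) (inv z')"
    then have "(P_cover n e w)\<^sup>*\<^sup>* (inv (inv z)) (inv (inv z'))"
    proof (induction rule: rtranclp_induct)
      case (step x y)
      then have "P_cover n e w (inv x) (inv y)"
        using D_inv wcov_props(1,2)[OF step(2)] by (simp add: P_cover_iff)
      then show ?case using step.IH by (rule rtranclp.rtrancl_into_rtrancl[rotated])
    qed simp
    then show "(P_cover n e w)\<^sup>*\<^sup>* z z'" using z in_I_iff permutes_inv_inv by metis
  qed
  then show ?thesis using in_I_iff by (auto simp: P_rel_def skeleton_rel_def)
qed

lemma inv_image_covers: "u \<in> I \<Longrightarrow> inv ` {a. P_cover n e w u a \<and> Q (inv a)} = {a. wcov (inv u) a \<and> Q a}"
proof (intro equalityI subsetI)
  fix a assume u: "u \<in> I" and a: "a \<in> {a. wcov (inv u) a \<and> Q a}"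
  then have "inv a \<in> I" "inv (inv a) = a" using D_inv wcov_props(2)[of "inv u" a] by auto
  then show "a \<in> inv ` {a. P_cover n e w u a \<and> Q (inv a)}"
    using u a by (intro image_eqI[of _ _ "inv a"]) (auto simp: P_cover_iff)
qed (auto simp: P_cover_iff)

lemma atom_joins_P:
  assumes u: "u \<in> I"
  shows "atom_joins I (P_rel n e w) u {a. P_cover n e w u a} (\<lambda>S. inv (J (inv u) (inv ` S)))"
proof -
  have uD: "inv u \<in> D" using u in_I_iff by blast
  interpret Rj: atom_joins D skeleton_rel "inv u" "{a. wcov (inv u) a}" "J (inv u)" by (rule atom_joins_skeleton_rel[OF uD])
  have inv_inj: "inv z = inv z' \<Longrightarrow> z = z'" if "z \<in> I" "z' \<in> I" for z z'
    using that permutes_inv_inv in_I_iff by metis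
  have JI: "inv (J (inv u) S) \<in> I" "inv (inv (J (inv u) S)) = J (inv u) S" for S
    using D_inv J_in_D by auto
  have sub: "inv ` S \<subseteq> {a. wcov (inv u) a}" if "S \<subseteq> {a. P_cover n e w u a}" for S
    using that by (auto simp: P_cover_iff)
  show ?thesis
  proof
    show "partial_order_on I (P_rel n e w)" by (rule partial_order_P_rel)
    show "finite I" by (rule finite_bruhat_interval)
    show "(u, a) \<in> P_rel n e w \<and> a \<noteq> u" if "a \<in> {a. P_cover n e w u a}" for a
      using that Rj.above[of "inv a"] u by (auto simp: P_cover_iff P_rel_iff)
    show "\<exists>a\<in>{a. P_cover n e w u a}. (a, z) \<in> P_rel n e w" if z: "(u, z) \<in> P_rel n e w" "z \<noteq> u" for z
    proof -
      have "(inv u, inv z) \<in> skeleton_rel" "inv z \<noteq> inv u" "z \<in> I" using z inv_inj u by (auto simp: P_rel_iff)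
      then obtain a where a: "wcov (inv u) a" "(a, inv z) \<in> skeleton_rel" using Rj.atomic by blast
      then have "inv a \<in> I" "inv (inv a) = a" using D_inv wcov_props(2) by blast+
      then show ?thesis using a u \<open>z \<in> I\<close> by (intro bexI[of _ "inv a"]) (simp_all add: P_rel_iff P_cover_iff)
    qed
    show "((inv (J (inv u) (inv ` S)), z) \<in> P_rel n e w) = (\<forall>a\<in>S. (a, z) \<in> P_rel n e w)"
      if S: "S \<subseteq> {a. P_cover n e w u a}" and z: "(u, z) \<in> P_rel n e w" for S z
    proof -
      have "\<forall>a\<in>S. a \<in> I" using S by (auto simp: P_cover_iff)
      moreover have "z \<in> I" "(inv u, inv z) \<in> skeleton_rel" using z by (auto simp: P_rel_iff)
      ultimately show ?thesis using Rj.J_le_iff[OF sub[OF S]] JI by (auto simp: P_rel_iff)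
    qed
    show "(u, inv (J (inv u) (inv ` S))) \<in> P_rel n e w" if "S \<subseteq> {a. P_cover n e w u a}" for S
      using u JI Rj.u_le_J[OF sub[OF that]] by (simp add: P_rel_iff)
    show "a \<in> S" if S: "S \<subseteq> {a. P_cover n e w u a}" and a: "a \<in> {a. P_cover n e w u a}"
      and le: "(a, inv (J (inv u) (inv ` S))) \<in> P_rel n e w" for S a
    proof -
      have "inv a \<in> inv ` S" using Rj.le_J_imp[OF sub[OF S], of "inv a"] a le JI by (simp add: P_rel_iff P_cover_iff)
      then obtain b where "b \<in> S" "inv a = inv b" by blast
      then show ?thesis using inv_inj[of a b] a S by (auto simp: P_cover_iff)
    qed
  qed
qed

lemma bruhat_polytope_face_iff:
  assumes uv: "(u, v) \<in> P_rel n e w"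
  shows "bruhat_polytope n e u v face_of bruhat_polytope n e id w \<longleftrightarrow>
    v = inv (J (inv u) (inv ` P_atoms n e w u v))"
proof -
  have I: "u \<in> I" "v \<in> I" and le: "wle (inv u) (inv v)" using uv by (auto simp: P_rel_iff skeleton_rel_def)
  have p: "u permutes {1..n}" "v permutes {1..n}" and D: "inv u \<in> D" "inv v \<in> D" using I in_I_iff by auto
  have uv: "le n (inv u) (inv v)" using wle_D[OF le D(1)] by simp
  let ?F = "bruhat_interval n u v"
  have F: "inv ` ?F = {y. le n (inv u) y \<and> le n y (inv v)}"
  proof (intro equalityI subsetI)
    fix y assume y: "y \<in> {y. le n (inv u) y \<and> le n y (inv v)}"
    then have yp: "y permutes {1..n}" by (auto simp: le_def)
    then show "y \<in> inv ` ?F"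
      using y by (intro image_eqI[of _ _ "inv y"]) (auto simp: in_interval_iff[OF p] permutes_inv permutes_inv_inv[OF yp])
  qed (auto simp: in_interval_iff[OF p])
  have FI: "?F \<subseteq> I" using D_down[OF D(2)] by (auto simp: in_interval_iff[OF p] in_I_iff)
  have "u \<in> ?F" using p uv by (auto simp: in_interval_iff[OF p] permutes_inv intro: le_refl)
  then have "bruhat_polytope n e u v face_of bruhat_polytope n e id w \<longleftrightarrow> (\<exists>c. Fmin c = inv ` ?F)"
    using face_iff_Fmin[OF FI] unfolding bruhat_polytope_def[of n e u v] by blast
  also have "\<dots> \<longleftrightarrow> inv v = J (inv u) {a. wcov (inv u) a \<and> wle a (inv v)}"
    unfolding F by (rule face_iff_J[OF le D(1)])
  also have "{a. wcov (inv u) a \<and> wle a (inv v)} = inv ` P_atoms n e w u v"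
  proof -
    have "P_atoms n e w u v = {a. P_cover n e w u a \<and> wle (inv a) (inv v)}"
      using I D by (auto simp: P_atoms_def P_rel_iff skeleton_rel_def P_cover_iff in_I_iff)
    then show ?thesis using inv_image_covers[OF I(1), of "\<lambda>a. wle a (inv v)"] by simp
  qed
  also have "inv v = J (inv u) (inv ` P_atoms n e w u v) \<longleftrightarrow> v = inv (J (inv u) (inv ` P_atoms n e w u v))"
    using permutes_inv_inv[OF p(2)] D_inv[OF J_in_D] by metis
  finally show ?thesis .
qed

end

theorem theorem1p1:
  fixes n :: nat and e :: "'n::finite \<Rightarrow> nat" and w u v :: "nat \<Rightarrow> nat"
  assumes "bij_betw e UNIV {1..n}"
    and "w permutes {1..n}"
    and "(u, v) \<in> P_rel n e w"
  shows "(if bruhat_polytope n e u v face_of bruhat_polytope n e id w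
          then geometric_realization (order_complex (open_interval (P_rel n e w) u v))
                 homotopy_equivalent_space
               sphere_top (int (card (P_atoms n e w u v)) - 2)
          else contractible_space
                 (geometric_realization (order_complex (open_interval (P_rel n e w) u v))) \<and>
               topspace
                 (geometric_realization (order_complex (open_interval (P_rel n e w) u v))) \<noteq> {})
       \<and> moebius (P_rel n e w) u v =
           (if bruhat_polytope n e u v face_of bruhat_polytope n e id w
            then (-1) ^ card (P_atoms n e w u v) else 0)"
proof -
  interpret bruhat_polytope_setup n e w using assms(1,2) by unfold_locales
  have u: "u \<in> I" using assms(3) by (simp add: P_rel_def)
  interpret P: atom_joins I "P_rel n e w" u "{a. P_cover n e w u a}" "\<lambda>S. inv (J (inv u) (inv ` S))"
    by (rule atom_joins_P[OF u])
  have atoms: "P.atoms v = P_atoms n e w u v" by (auto simp: P.atoms_def P_atoms_def)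
  \<comment> \<open>The face condition becomes the equality of \<open>v\<close> with the join of its
    atoms, which is the case distinction of both poset results.\<close>
  show ?thesis
    unfolding bruhat_polytope_face_iff[OF assms(3)]
    using P.interval_homotopy_type[OF assms(3)] P.moebius_eq[OF assms(3)] unfolding atoms
    by (rule conjI)
qed

end
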